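(* For $k=1$, the \textsc{Directed Anchored $k$-Core} problem can be solved in time $2^{O(p)}\cdot n^2\log n$ on directed graphs with $n$ vertices. In particular, for $k=1$ the problem is fixed-parameter tractable parameterized by $p$.
   Context: Directed graphs are finite, without loops or multiple arcs; $d^-_G(v)$ denotes in-degree of $v$ in $G$ and $G[U]$ the subgraph induced by $U$. \textsc{Directed Anchored $k$-Core}: given a directed graph $G$ and integers $b,k,p$, decide whether there exist sets of vertices $A\subseteq H\subseteq V(G)$ with $|A|\leq b$, $|H|\geq p$, and $d^-_{G[H]}(v)\geq k$ for every $v\in H\setminus A$. *)

theory Defs
  imports
    "Graph_Theory.Graph_Theory"
    "HOL-Library.Landau_Symbols"
    "HOL-Library.Log_Nat"
begin

section \<open>The problem\<close>

definition directed_anchored_core ::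
  "('a, 'b) pre_digraph \<Rightarrow> int \<Rightarrow> int \<Rightarrow> int \<Rightarrow> bool" where
  "directed_anchored_core G b k p \<longleftrightarrow>
     (\<exists>A H. A \<subseteq> H \<and> H \<subseteq> verts G \<and> int (card A) \<le> b \<and> int (card H) \<ge> p \<and>
        (\<forall>v \<in> H - A. int (in_degree (G \<restriction> H) v) \<ge> k))"


section \<open>Random access machines\<close>

text \<open>
  The uniform-cost RAM with integer registers and a read-only input array. Every
  instruction takes one time step. Addition, subtraction and halving are the only arithmetic
  operations: with multiplication at unit cost the machine could build numbers of
  exponential bit length in linear time.
\<close>

datatype instr =
    Const nat int
  | Read nat nat
  | Load nat nat
  | Store nat nat
  | Add nat nat nat
  | Sub nat nat nat
  | Half nat nat
  | Jump nat
  | JPos nat nat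

type_synonym program = "instr list"

text \<open>Program counter and register contents.\<close>

type_synonym config = "nat \<times> (nat \<Rightarrow> int)"

text \<open>
  Indirect addressing goes through \<^const>\<open>nat\<close>, so a negative address denotes cell 0. Input cells
  beyond the end of the input hold 0.
\<close>

fun exec :: "int list \<Rightarrow> instr \<Rightarrow> config \<Rightarrow> config" where
  "exec xs (Const d c) (pc, r) = (Suc pc, r(d := c))"
| "exec xs (Read d s) (pc, r) =
     (Suc pc, r(d := (if nat (r s) < length xs then xs ! nat (r s) else 0)))"
| "exec xs (Load d s) (pc, r) = (Suc pc, r(d := r (nat (r s))))"
| "exec xs (Store d s) (pc, r) = (Suc pc, r(nat (r d) := r s))"
| "exec xs (Add d s t) (pc, r) = (Suc pc, r(d := r s + r t))"
| "exec xs (Sub d s t) (pc, r) = (Suc pc, r(d := r s - r t))"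
| "exec xs (Half d s) (pc, r) = (Suc pc, r(d := r s div 2))"
| "exec xs (Jump l) (pc, r) = (l, r)"
| "exec xs (JPos s l) (pc, r) = (if r s > 0 then l else Suc pc, r)"

text \<open>The machine has halted once the program counter is outside the program.\<close>

definition step :: "program \<Rightarrow> int list \<Rightarrow> config \<Rightarrow> config" where
  "step P xs c = (if fst c < length P then exec xs (P ! fst c) c else c)"

definition run :: "program \<Rightarrow> int list \<Rightarrow> nat \<Rightarrow> config" where
  "run P xs t = (step P xs ^^ t) (0, \<lambda>_. 0)"

text \<open>Since halted configurations are fixed by \<^const>\<open>step\<close>, the following says: on input \<open>xs\<close>,
  program \<open>P\<close> halts after at most \<open>t\<close> steps with \<open>y\<close> in register 0.\<close>

definition outputs_within :: "program \<Rightarrow> int list \<Rightarrow> int \<Rightarrow> nat \<Rightarrow> bool" where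
  "outputs_within P xs y t \<longleftrightarrow> fst (run P xs t) \<ge> length P \<and> snd (run P xs t) 0 = y"

definition computable :: "(nat \<Rightarrow> nat) \<Rightarrow> bool" where
  "computable f \<longleftrightarrow> (\<exists>P. \<forall>x. \<exists>t. outputs_within P [int x] (int (f x)) t)"


section \<open>Decision problems\<close>

text \<open>
  A decision problem is given by its set \<open>I\<close> of instances, their encoding \<open>enc\<close> as machine
  inputs, and the predicate \<open>Q\<close> of yes-instances.
\<close>

definition solves_in_time ::
  "program \<Rightarrow> 'i set \<Rightarrow> ('i \<Rightarrow> int list) \<Rightarrow> ('i \<Rightarrow> bool) \<Rightarrow> ('i \<Rightarrow> real) \<Rightarrow> bool" where
  "solves_in_time P I enc Q T \<longleftrightarrow>
     (\<forall>x \<in> I. \<exists>t. real t \<le> T x \<and> outputs_within P (enc x) (if Q x then 1 else 0) t)"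

definition input_size :: "int list \<Rightarrow> nat" where
  "input_size xs = (\<Sum>x\<leftarrow>xs. nat (bitlen \<bar>x\<bar>) + 1)"

text \<open>Fixed-parameter tractability with respect to the parameter \<open>\<kappa>\<close>.\<close>

definition fpt ::
  "'i set \<Rightarrow> ('i \<Rightarrow> int list) \<Rightarrow> ('i \<Rightarrow> bool) \<Rightarrow> ('i \<Rightarrow> nat) \<Rightarrow> bool" where
  "fpt I enc Q \<kappa> \<longleftrightarrow>
     (\<exists>P f c. computable f \<and>
        solves_in_time P I enc Q (\<lambda>x. real (f (\<kappa> x) * input_size (enc x) ^ c)))"


section \<open>Instances of the problem for fixed k\<close>

text \<open>
  Vertices and arcs are natural numbers, so that one program serves all finite digraphs (every
  finite digraph is isomorphic to one of these, and every numbering of its vertices occurs). In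
  \<^locale>\<open>digraph\<close>, finiteness and the absence of loops and multiple arcs are included.
\<close>

type_synonym inst = "(nat, nat) pre_digraph \<times> int \<times> int"

definition instances :: "inst set" where
  "instances = {(G, b, p). digraph G}"

fun core_inst :: "int \<Rightarrow> inst \<Rightarrow> bool" where
  "core_inst k (G, b, p) = directed_anchored_core G b k p"

text \<open>Number of vertices, \<open>b\<close>, \<open>p\<close>, and the adjacency matrix row by row.\<close>

fun encode :: "inst \<Rightarrow> int list" where
  "encode (G, b, p) =
     (let vs = sorted_list_of_set (verts G)
      in [int (length vs), b, p] @ [if u \<rightarrow>\<^bsub>G\<^esub> v then 1 else 0. u \<leftarrow> vs, v \<leftarrow> vs])"

fun num_verts :: "inst \<Rightarrow> nat" where
  "num_verts (G, b, p) = card (verts G)"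

text \<open>A negative \<open>p\<close>, for which the size constraint is void, counts as parameter value 0.\<close>

fun param :: "inst \<Rightarrow> nat" where
  "param (G, b, p) = nat p"

end

theory Submission
  imports Defs "HOL-Computational_Algebra.Polynomial"
begin

text \<open>For \<open>k = 1\<close> every set \<open>H\<close> admissible for the anchors \<open>A\<close> lies in the union of the 1-core \<open>R\<close>,
  which is what remains after deleting vertices of in-degree 0 repeatedly, and the sets reached
  from the anchors; and the whole union is admissible. So, unless \<open>p \<le> |R|\<close>, one asks whether some \<open>b\<close> of the
  sets \<open>U v\<close>, consisting of \<open>R\<close> and what is reached from \<open>v\<close>, cover \<open>p\<close> vertices. If some \<open>U v\<close> has
  \<open>p\<close> elements the answer is clear; otherwise each \<open>U v\<close> is found by visiting fewer than \<open>p\<close> vertices.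

  A vertex \<open>x\<close> is represented by the vector \<open>(1, x, \<dots>, x ^ (p - 1))\<close>. A product of \<open>p\<close> such vectors
  in the exterior algebra, which has rank \<open>2 ^ p\<close>, is a Vandermonde determinant: it vanishes iff two of the vertices
  coincide. Let \<open>L i\<close> be the lattice spanned by the products of vertices out of a union of \<open>i\<close> sets.
  Generators of \<open>L (i + 1)\<close> are obtained by multiplying the basis of \<open>L i\<close> by the products from each \<open>U v\<close>, of
  which there are at most \<open>2 ^ p\<close>, and \<open>b\<close> sets cover \<open>p\<close> vertices iff \<open>L b\<close> has
  elements in top degree. The determinants are smaller than \<open>n ^ p\<^sup>2\<close> in absolute value, so it suffices to know
  the lattices modulo \<open>2 ^ k\<close> with \<open>k\<close> about \<open>p\<^sup>2 log n\<close>; echelon bases over the 2-adic integers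
  are maintained with additions, subtractions and halvings only. They have \<open>2 ^ O(p) log n\<close> rows, which
  leads to \<open>2 ^ O(p) n log n\<close> insertions of \<open>2 ^ O(p) n\<close> steps each.\<close>

section \<open>A language of bounded loops\<close>

text \<open>Exact integers are used because a determinant that is nonzero may vanish modulo a small
  prime, while a larger field would need products and inverses, which the machine cannot form in one
  step. Modulo a power of 2 a pivot only has to be odd: one subtraction clears the parity of a
  coordinate, and a vector that has become even is halved and passed to the next level. The price is
  a basis with \<open>k\<close> levels of rows in place of a single one. Entries are never reduced
  modulo \<open>2 ^ k\<close>. Arithmetic has unit cost whatever the size of the numbers, and the
  truncation consists only in dropping what is left of a vector after the last level. The two
  directions rest on different invariants. Every row, scaled by its level, is an exact integer
  combination of products (\<open>generated\<close>), so a nonzero top entry proves that a cover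
  exists. Conversely, products lie in the span of the rows only modulo \<open>2 ^ k\<close>
  (\<open>lspan\<close>), and the size bound on determinants turns this into an odd top pivot. An
  insertion takes about \<open>n\<close> steps because multiplying by a vertex is done by up to
  \<open>n\<close> additions.\<close>

datatype expr =
    Num int
  | Var nat
  | Arr nat expr
  | Inp expr
  | Plus expr expr
  | Minus expr expr
  | Halve expr

text \<open>Counted loops are the only form of repetition, so every statement terminates and its
  time can be bounded through the values of the loop limits.\<close>

datatype stmt =
    Skip
  | Assign nat expr
  | Put nat expr expr
  | Seq stmt stmt (infixr \<open>;;\<close> 60)
  | Cond expr stmt stmt
  | For nat nat stmt

datatype state = State (cell: "nat \<Rightarrow> nat \<Rightarrow> int")

definition upd :: "state \<Rightarrow> nat \<Rightarrow> nat \<Rightarrow> int \<Rightarrow> state" where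
  "upd s a i v = State (\<lambda>b j. if b = a \<and> j = i then v else cell s b j)"

text \<open>A negative address is one of register 0 in the machine, whose accesses truncate it.\<close>

definition rd :: "state \<Rightarrow> nat \<Rightarrow> int \<Rightarrow> int" where
  "rd s a z = (if z < 0 then cell s 0 0 else cell s a (nat z))"

definition wr :: "state \<Rightarrow> nat \<Rightarrow> int \<Rightarrow> int \<Rightarrow> state" where
  "wr s a z v = (if z < 0 then upd s 0 0 v else upd s a (nat z) v)"

definition input_at :: "int list \<Rightarrow> int \<Rightarrow> int" where
  "input_at xs z = (if nat z < length xs then xs ! nat z else 0)"

primrec eval_expr :: "int list \<Rightarrow> expr \<Rightarrow> state \<Rightarrow> int" where
  "eval_expr xs (Num c) s = c"
| "eval_expr xs (Var x) s = cell s 0 x"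
| "eval_expr xs (Arr a e) s = rd s a (eval_expr xs e s)"
| "eval_expr xs (Inp e) s = input_at xs (eval_expr xs e s)"
| "eval_expr xs (Plus e1 e2) s = eval_expr xs e1 s + eval_expr xs e2 s"
| "eval_expr xs (Minus e1 e2) s = eval_expr xs e1 s - eval_expr xs e2 s"
| "eval_expr xs (Halve e) s = eval_expr xs e s div 2"

primrec loop :: "(nat \<Rightarrow> 'a \<Rightarrow> 'a) \<Rightarrow> nat \<Rightarrow> 'a \<Rightarrow> 'a" where
  "loop f 0 s = s"
| "loop f (Suc m) s = f m (loop f m s)"

text \<open>A loop reads its limit once, on entry. At the end the counter holds that limit (0 for a
  negative one), which is what the register of the compiled loop contains on exit.\<close>

primrec sem :: "int list \<Rightarrow> stmt \<Rightarrow> state \<Rightarrow> state" where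
  "sem xs Skip s = s"
| "sem xs (Assign x e) s = upd s 0 x (eval_expr xs e s)"
| "sem xs (Put a e1 e2) s = wr s a (eval_expr xs e1 s) (eval_expr xs e2 s)"
| "sem xs (c1 ;; c2) s = sem xs c2 (sem xs c1 s)"
| "sem xs (Cond e c1 c2) s = (if eval_expr xs e s > 0 then sem xs c1 s else sem xs c2 s)"
| "sem xs (For x l c) s =
     upd (loop (\<lambda>j t. sem xs c (upd t 0 x (int j))) (nat (cell s 0 l)) s) 0 x (int (nat (cell s 0 l)))"

text \<open>An array access costs seven instructions beyond its index: four doublings for the factor
  16, the constant for the array, an addition and the load.\<close>

primrec expr_cost :: "expr \<Rightarrow> nat" where
  "expr_cost (Num c) = 1"
| "expr_cost (Var x) = 2"
| "expr_cost (Arr a e) = expr_cost e + 7"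
| "expr_cost (Inp e) = expr_cost e + 1"
| "expr_cost (Plus e1 e2) = expr_cost e1 + expr_cost e2 + 1"
| "expr_cost (Minus e1 e2) = expr_cost e1 + expr_cost e2 + 1"
| "expr_cost (Halve e) = expr_cost e + 1"

text \<open>In a loop the 5 stands for the subtraction, the test, the two instructions that advance
  the counter and the jump back; the 4 stands for clearing the counter and for the last, failing
  test. A conditional is charged for its test and for a jump that only the else branch
  executes.\<close>

primrec time :: "int list \<Rightarrow> stmt \<Rightarrow> state \<Rightarrow> nat" where
  "time xs Skip s = 0"
| "time xs (Assign x e) s = expr_cost e + 2"
| "time xs (Put a e1 e2) s = expr_cost e1 + expr_cost e2 + 7"
| "time xs (c1 ;; c2) s = time xs c1 s + time xs c2 (sem xs c1 s)"
| "time xs (Cond e c1 c2) s =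
     expr_cost e + 2 + (if eval_expr xs e s > 0 then time xs c1 s else time xs c2 s)"
| "time xs (For x l c) s =
     4 + (\<Sum>j<nat (cell s 0 l). 5 + time xs c (upd (loop (\<lambda>j t. sem xs c (upd t 0 x (int j))) j s) 0 x (int j)))"

text \<open>A write to any array may hit scalar 0, since a negative index is redirected
  there.\<close>

primrec scalars :: "stmt \<Rightarrow> nat set" where
  "scalars Skip = {}"
| "scalars (Assign x e) = {x}"
| "scalars (Put a e1 e2) = (if a = 0 then UNIV else {0})"
| "scalars (c1 ;; c2) = scalars c1 \<union> scalars c2"
| "scalars (Cond e c1 c2) = scalars c1 \<union> scalars c2"
| "scalars (For x l c) = insert x (scalars c)"

primrec arrays :: "stmt \<Rightarrow> nat set" where
  "arrays Skip = {}"
| "arrays (Assign x e) = {}"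
| "arrays (Put a e1 e2) = {a}"
| "arrays (c1 ;; c2) = arrays c1 \<union> arrays c2"
| "arrays (Cond e c1 c2) = arrays c1 \<union> arrays c2"
| "arrays (For x l c) = arrays c"

primrec wf_expr :: "expr \<Rightarrow> bool" where
  "wf_expr (Num c) \<longleftrightarrow> True"
| "wf_expr (Var x) \<longleftrightarrow> x < 64"
| "wf_expr (Arr a e) \<longleftrightarrow> 0 < a \<and> a < 16 \<and> wf_expr e"
| "wf_expr (Inp e) \<longleftrightarrow> wf_expr e"
| "wf_expr (Plus e1 e2) \<longleftrightarrow> wf_expr e1 \<and> wf_expr e2"
| "wf_expr (Minus e1 e2) \<longleftrightarrow> wf_expr e1 \<and> wf_expr e2"
| "wf_expr (Halve e) \<longleftrightarrow> wf_expr e"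

text \<open>The compiled loop reads counter and limit again before every pass, whereas
  \<open>sem\<close> fixes the limit on entry; the two agree because the body may assign
  neither.\<close>

primrec wf_stmt :: "stmt \<Rightarrow> bool" where
  "wf_stmt Skip \<longleftrightarrow> True"
| "wf_stmt (Assign x e) \<longleftrightarrow> x < 64 \<and> wf_expr e"
| "wf_stmt (Put a e1 e2) \<longleftrightarrow> 0 < a \<and> a < 16 \<and> wf_expr e1 \<and> wf_expr e2"
| "wf_stmt (c1 ;; c2) \<longleftrightarrow> wf_stmt c1 \<and> wf_stmt c2"
| "wf_stmt (Cond e c1 c2) \<longleftrightarrow> wf_expr e \<and> wf_stmt c1 \<and> wf_stmt c2"
| "wf_stmt (For x l c) \<longleftrightarrow> x < 64 \<and> l < 64 \<and> x \<noteq> l \<and> x \<notin> scalars c \<and> l \<notin> scalars c \<and> wf_stmt c"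

lemma upd_apply [simp]: "cell (upd s a i v) b j = (if b = a \<and> j = i then v else cell s b j)"
  by (simp add: upd_def)

lemma upd_other_array [simp]: "b \<noteq> a \<Longrightarrow> cell (upd s a i v) b = cell s b"
  by (rule ext) simp

section \<open>Frame properties: what a statement leaves unchanged\<close>

lemma loop_scalar_frame:
  assumes "\<And>j t. cell (f j t) 0 x = cell t 0 x"
  shows "cell (loop f m s) 0 x = cell s 0 x"
  by (induction m) (auto simp: assms)

lemma loop_array_frame:
  assumes "\<And>j t. cell (f j t) a = cell t a"
  shows "cell (loop f m s) a = cell s a"
  by (induction m) (auto simp: assms)

lemma sem_scalar_frame: "x \<notin> scalars c \<Longrightarrow> cell (sem xs c s) 0 x = cell s 0 x"
proof (induction c arbitrary: s)
  case (Put a e1 e2)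
  then show ?case by (auto simp: wr_def split: if_splits)
next
  case (For y l c)
  have "cell (loop (\<lambda>j t. sem xs c (upd t 0 y (int j))) m s) 0 x = cell s 0 x" for m
    by (rule loop_scalar_frame) (use For in auto)
  then show ?case using For.prems by simp
qed auto

lemma sem_array_frame: "a \<noteq> 0 \<Longrightarrow> a \<notin> arrays c \<Longrightarrow> cell (sem xs c s) a = cell s a"
proof (induction c arbitrary: s)
  case (Put b e1 e2)
  then show ?case by (auto simp: wr_def split: if_splits)
next
  case (For y l c)
  have "cell (loop (\<lambda>j t. sem xs c (upd t 0 y (int j))) m s) a = cell s a" for m
    by (rule loop_array_frame) (use For in auto)
  then show ?case using For.prems by simp
qed auto

subsection \<open>Compilation\<close>

definition tmp :: "nat \<Rightarrow> nat" where
  "tmp d = 16 * (64 + d)"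

text \<open>The value is left in stack register \<open>tmp d\<close>; deeper stack registers are
  scratch space. The machine has no copy instruction, so a variable is fetched by adding it to
  0.\<close>

primrec comp_expr :: "expr \<Rightarrow> nat \<Rightarrow> instr list" where
  "comp_expr (Num c) d = [Const (tmp d) c]"
| "comp_expr (Var x) d = [Const (tmp d) 0, Add (tmp d) (tmp d) (16 * x)]"
| "comp_expr (Arr a e) d = comp_expr e d @
     [Add (tmp d) (tmp d) (tmp d), Add (tmp d) (tmp d) (tmp d),
      Add (tmp d) (tmp d) (tmp d), Add (tmp d) (tmp d) (tmp d),
      Const (tmp (Suc d)) (int a), Add (tmp d) (tmp d) (tmp (Suc d)), Load (tmp d) (tmp d)]"
| "comp_expr (Inp e) d = comp_expr e d @ [Read (tmp d) (tmp d)]"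
| "comp_expr (Plus e1 e2) d =
     comp_expr e1 d @ comp_expr e2 (Suc d) @ [Add (tmp d) (tmp d) (tmp (Suc d))]"
| "comp_expr (Minus e1 e2) d =
     comp_expr e1 d @ comp_expr e2 (Suc d) @ [Sub (tmp d) (tmp d) (tmp (Suc d))]"
| "comp_expr (Halve e) d = comp_expr e d @ [Half (tmp d) (tmp d)]"

text \<open>Jump targets are absolute, so lengths have to be known before the code is generated;
  they do not depend on its position.\<close>

primrec code_size :: "stmt \<Rightarrow> nat" where
  "code_size Skip = 0"
| "code_size (Assign x e) = expr_cost e + 2"
| "code_size (Put a e1 e2) = expr_cost e1 + expr_cost e2 + 7"
| "code_size (c1 ;; c2) = code_size c1 + code_size c2"
| "code_size (Cond e c1 c2) = expr_cost e + code_size c1 + code_size c2 + 2"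
| "code_size (For x l c) = code_size c + 7"

primrec comp :: "stmt \<Rightarrow> nat \<Rightarrow> instr list" where
  "comp Skip pc = []"
| "comp (Assign x e) pc = comp_expr e 0 @ [Const (tmp 1) 0, Add (16 * x) (tmp 0) (tmp 1)]"
| "comp (Put a e1 e2) pc = comp_expr e1 0 @ comp_expr e2 1 @
     [Add (tmp 0) (tmp 0) (tmp 0), Add (tmp 0) (tmp 0) (tmp 0),
      Add (tmp 0) (tmp 0) (tmp 0), Add (tmp 0) (tmp 0) (tmp 0),
      Const (tmp 2) (int a), Add (tmp 0) (tmp 0) (tmp 2), Store (tmp 0) (tmp 1)]"
| "comp (c1 ;; c2) pc = comp c1 pc @ comp c2 (pc + code_size c1)"
| "comp (Cond e c1 c2) pc = comp_expr e 0 @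
     [JPos (tmp 0) (pc + expr_cost e + code_size c2 + 2)] @
     comp c2 (pc + expr_cost e + 1) @ [Jump (pc + code_size (Cond e c1 c2))] @
     comp c1 (pc + expr_cost e + code_size c2 + 2)"
| "comp (For x l c) pc =
     [Const (16 * x) 0, Sub (tmp 0) (16 * l) (16 * x), JPos (tmp 0) (pc + 4),
      Jump (pc + code_size (For x l c))] @ comp c (pc + 4) @
     [Const (tmp 0) 1, Add (16 * x) (16 * x) (tmp 0), Jump (pc + 1)]"

lemma length_comp_expr [simp]: "length (comp_expr e d) = expr_cost e"
  by (induction e arbitrary: d) auto

lemma length_comp [simp]: "length (comp c pc) = code_size c"
  by (induction c arbitrary: pc) auto

fun code_at :: "program \<Rightarrow> nat \<Rightarrow> instr list \<Rightarrow> bool" where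
  "code_at P pc [] \<longleftrightarrow> True"
| "code_at P pc (i # rest) \<longleftrightarrow> pc < length P \<and> P ! pc = i \<and> code_at P (Suc pc) rest"

lemma code_at_append [simp]:
  "code_at P pc (a @ b) \<longleftrightarrow> code_at P pc a \<and> code_at P (pc + length a) b"
  by (induction a arbitrary: pc) auto

lemma code_at_self: "code_at (a @ P) (length a) P"
proof (induction P arbitrary: a)
  case (Cons i P)
  then show ?case using Cons[of "a @ [i]"] by (simp add: nth_append)
qed simp

text \<open>Only an upper bound on the number of steps is recorded, because \<open>time\<close>
  charges both branches of a conditional for a jump that one of them lacks.\<close>

definition reach :: "program \<Rightarrow> int list \<Rightarrow> config \<Rightarrow> nat \<Rightarrow> config \<Rightarrow> bool" where
  "reach P xs c T c' \<longleftrightarrow> (\<exists>t\<le>T. (step P xs ^^ t) c = c')"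

lemma reach_refl [simp]: "reach P xs c T c"
  unfolding reach_def by (rule exI[of _ 0]) simp

lemma reach_step:
  assumes "code_at P pc (i # rest)" "reach P xs (exec xs i (pc, r)) T c"
  shows "reach P xs (pc, r) (Suc T) c"
proof -
  obtain t where t: "t \<le> T" "(step P xs ^^ t) (exec xs i (pc, r)) = c"
    using assms(2) by (auto simp: reach_def)
  have "step P xs (pc, r) = exec xs i (pc, r)" using assms(1) by (auto simp: step_def)
  then have "(step P xs ^^ Suc t) (pc, r) = c" using t by (simp add: funpow_swap1 del: funpow.simps(2) add: funpow_Suc_right)
  then show ?thesis using t(1) unfolding reach_def by (intro exI[of _ "Suc t"]) auto
qed

lemma reach_trans:
  assumes "reach P xs c T c'" "reach P xs c' T' c''"
  shows "reach P xs c (T + T') c''"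
proof -
  obtain t t' where t: "t \<le> T" "(step P xs ^^ t) c = c'" "t' \<le> T'" "(step P xs ^^ t') c' = c''"
    using assms by (auto simp: reach_def)
  then have "(step P xs ^^ (t' + t)) c = c''" by (simp add: funpow_add)
  then show ?thesis using t unfolding reach_def by (intro exI[of _ "t' + t"]) auto
qed

fun straight :: "instr \<Rightarrow> bool" where
  "straight (Jump l) \<longleftrightarrow> False"
| "straight (JPos s l) \<longleftrightarrow> False"
| "straight _ \<longleftrightarrow> True"

lemma reach_straight:
  assumes "code_at P pc rest" "\<forall>i\<in>set rest. straight i"
  shows "reach P xs (pc, r) (length rest) (pc + length rest, fold (\<lambda>i r. snd (exec xs i (0, r))) rest r)"
  using assms
proof (induction rest arbitrary: pc r)
  case (Cons i rest)
  have "exec xs i (pc, r) = (Suc pc, snd (exec xs i (0, r)))"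
    using Cons.prems(2) by (cases i) auto
  then show ?case
    using Cons.IH[of "Suc pc" "snd (exec xs i (0, r))"] Cons.prems
    by (auto intro: reach_step[of P pc i rest])
qed simp

text \<open>Cell \<open>i\<close> of array \<open>a\<close> lives in register \<open>16 * i + a\<close>; array 0 holds the scalars, and its
  cells from 64 on are the evaluation stack of the compiled expressions.\<close>

lemma address_eq_iff:
  fixes i j a b :: nat
  assumes "a < 16" "b < 16"
  shows "16 * i + a = 16 * j + b \<longleftrightarrow> i = j \<and> a = b"
proof
  assume eq: "16 * i + a = 16 * j + b"
  have "(16 * i + a) div 16 = i" "(16 * j + b) div 16 = j" using assms by auto
  with eq show "i = j \<and> a = b" by auto
qed simp

definition represents :: "(nat \<Rightarrow> int) \<Rightarrow> state \<Rightarrow> bool" where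
  "represents r s \<longleftrightarrow> (\<forall>a<16. \<forall>i. (a = 0 \<longrightarrow> i < 64) \<longrightarrow> r (16 * i + a) = cell s a i)"

lemma represents_scalar: "represents r s \<Longrightarrow> x < 64 \<Longrightarrow> r (16 * x) = cell s 0 x"
  unfolding represents_def by (metis add.right_neutral zero_less_numeral)

lemma tmp_neq_scalar: "x < 64 \<Longrightarrow> 16 * x \<noteq> tmp d" "x < 64 \<Longrightarrow> tmp d \<noteq> 16 * x"
  by (auto simp: tmp_def)

lemma tmp_eq_iff [simp]: "tmp d = tmp d' \<longleftrightarrow> d = d'"
  by (auto simp: tmp_def)

lemma tmp_pos [simp]: "tmp d \<noteq> 0" "0 \<noteq> tmp d"
  by (auto simp: tmp_def)

text \<open>The stack discipline: evaluation at depth \<open>d\<close> may disturb only stack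
  registers of depth \<open>d\<close> or more.\<close>

definition agree_below :: "nat \<Rightarrow> (nat \<Rightarrow> int) \<Rightarrow> (nat \<Rightarrow> int) \<Rightarrow> bool" where
  "agree_below d r r' \<longleftrightarrow> (\<forall>x. (\<forall>d'\<ge>d. x \<noteq> tmp d') \<longrightarrow> r' x = r x)"

lemma agree_below_refl [simp]: "agree_below d r r"
  by (simp add: agree_below_def)

lemma agree_below_trans:
  "agree_below d r r' \<Longrightarrow> agree_below d' r' r'' \<Longrightarrow> d \<le> d' \<Longrightarrow> agree_below d r r''"
  unfolding agree_below_def by (metis order_trans)

lemma agree_below_upd [simp]:
  "d \<le> d' \<Longrightarrow> agree_below d r r' \<Longrightarrow> agree_below d r (r'(tmp d' := v))"
  by (auto simp: agree_below_def)

lemma agree_below_tmp: "agree_below d r r' \<Longrightarrow> d' < d \<Longrightarrow> r' (tmp d') = r (tmp d')"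
  by (auto simp: agree_below_def)

lemma represents_agree: "represents r s \<Longrightarrow> agree_below d r r' \<Longrightarrow> represents r' s"
proof -
  have "16 * i + a \<noteq> tmp d'" if "a < 16" "a = 0 \<longrightarrow> i < 64" for a i d'
    using that address_eq_iff[of a 0 i "64 + d'"] unfolding tmp_def by auto
  then have *: "agree_below d r r' \<Longrightarrow> r' (16 * i + a) = r (16 * i + a)" if "a < 16" "a = 0 \<longrightarrow> i < 64" for a i
    using that unfolding agree_below_def by simp
  show "represents r s \<Longrightarrow> agree_below d r r' \<Longrightarrow> represents r' s"
    unfolding represents_def using * by simp
qed

text \<open>As \<open>a < 16\<close>, a negative index gives a negative address, which the machine
  truncates to register 0, the register of scalar 0. This is the case built into
  \<open>rd\<close>.\<close>

lemma represents_read: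
  assumes "represents r s" "0 < a" "a < 16"
  shows "r (nat (16 * z + int a)) = rd s a z"
proof (cases "z < 0")
  case True
  then have "nat (16 * z + int a) = 0" using assms by auto
  then show ?thesis using True represents_scalar[OF assms(1), of 0] by (simp add: rd_def)
next
  case False
  then have "nat (16 * z + int a) = 16 * nat z + a" by (simp add: nat_add_distrib nat_mult_distrib)
  then show ?thesis using False assms by (auto simp: represents_def rd_def)
qed

lemma represents_upd_scalar:
  "represents r s \<Longrightarrow> x < 64 \<Longrightarrow> represents (r(16 * x := v)) (upd s 0 x v)"
  unfolding represents_def using address_eq_iff[of _ 0 _ x] by auto

lemma represents_write:
  assumes "represents r s" "0 < a" "a < 16"
  shows "represents (r(nat (16 * z + int a) := v)) (wr s a z v)"
proof (cases "z < 0")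
  case True
  then have "nat (16 * z + int a) = 0" using assms by auto
  then show ?thesis using True represents_upd_scalar[OF assms(1), of 0] by (simp add: wr_def)
next
  case False
  then have *: "nat (16 * z + int a) = 16 * nat z + a" by (simp add: nat_add_distrib nat_mult_distrib)
  have "16 * i + b = 16 * nat z + a \<longleftrightarrow> i = nat z \<and> b = a" if "b < 16" for i b
    using address_eq_iff[of b a i "nat z"] that assms by auto
  then show ?thesis using False assms(1) unfolding * represents_def wr_def by auto
qed

text \<open>\<open>agree_below\<close> is part of the induction because the left operand, stored at
  depth \<open>d\<close>, must survive the evaluation of the right one at depth
  \<open>Suc d\<close>.\<close>

lemma comp_expr_correct:
  assumes "code_at P pc (comp_expr e d)" "represents r s" "wf_expr e"
  shows "\<exists>r'. reach P xs (pc, r) (expr_cost e) (pc + expr_cost e, r') \<and>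
     r' (tmp d) = eval_expr xs e s \<and> agree_below d r r'"
  using assms
proof (induction e arbitrary: pc d r)
  case (Num c)
  show ?case
    using reach_straight[of P pc "comp_expr (Num c) d" xs r] Num
    by (intro exI[of _ "r(tmp d := c)"]) (simp_all add: fun_upd_same del: fun_upd_apply)
next
  case (Var x)
  have "(r(tmp d := 0)) (16 * x) = cell s 0 x"
    using Var represents_scalar[of r s x] tmp_neq_scalar[of x d] by simp
  then have "reach P xs (pc, r) 2 (pc + 2, r(tmp d := cell s 0 x))"
    using reach_straight[of P pc "comp_expr (Var x) d" xs r] Var.prems(1)
    by (simp add: numeral_2_eq_2 del: fun_upd_apply) (simp add: fun_upd_same)
  then show ?case
    by (intro exI[of _ "r(tmp d := cell s 0 x)"]) (simp add: fun_upd_same del: fun_upd_apply)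
next
  case (Arr a e)
  obtain r1 where r1: "reach P xs (pc, r) (expr_cost e) (pc + expr_cost e, r1)"
     "r1 (tmp d) = eval_expr xs e s" "agree_below d r r1"
    using Arr.IH[of pc d r] Arr.prems by auto
  let ?z = "eval_expr xs e s"
  let ?r2 = "r1(tmp d := 16 * ?z + int a, tmp (Suc d) := int a)"
  have rep: "represents ?r2 s"
    using represents_agree[OF Arr.prems(2), of d ?r2] r1(3) by (simp add: fun_upd_twist)
  have seven: "7 = Suc (Suc (Suc (Suc (Suc (Suc (Suc 0))))))" by simp
  have "reach P xs (pc + expr_cost e, r1) 7 (pc + expr_cost e + 7, ?r2(tmp d := rd s a ?z))"
    using reach_straight[of P "pc + expr_cost e" "drop (expr_cost e) (comp_expr (Arr a e) d)" xs r1]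
      represents_read[OF rep, of a ?z] Arr.prems r1(2)
    by (simp add: fun_upd_twist algebra_simps seven)
  from reach_trans[OF r1(1) this] show ?case
    using r1(3) by (intro exI[of _ "?r2(tmp d := rd s a ?z)"]) (simp add: add.assoc fun_upd_same del: fun_upd_apply)
next
  case (Inp e)
  obtain r1 where r1: "reach P xs (pc, r) (expr_cost e) (pc + expr_cost e, r1)"
     "r1 (tmp d) = eval_expr xs e s" "agree_below d r r1"
    using Inp.IH[of pc d r] Inp.prems by auto
  have "reach P xs (pc + expr_cost e, r1) (Suc 0)
      (pc + expr_cost e + 1, r1(tmp d := input_at xs (eval_expr xs e s)))"
    using reach_straight[of P "pc + expr_cost e" "[Read (tmp d) (tmp d)]" xs r1] Inp.prems r1(2)
    by (cases "nat (eval_expr xs e s) < length xs") (simp_all add: input_at_def)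
  from reach_trans[OF r1(1) this] show ?case
    using r1(3) by (intro exI[of _ "r1(tmp d := input_at xs (eval_expr xs e s))"]) (simp add: fun_upd_same del: fun_upd_apply)
next
  case (Plus e1 e2)
  obtain r1 where r1: "reach P xs (pc, r) (expr_cost e1) (pc + expr_cost e1, r1)"
     "r1 (tmp d) = eval_expr xs e1 s" "agree_below d r r1"
    using Plus.IH(1)[of pc d r] Plus.prems by auto
  obtain r2 where r2: "reach P xs (pc + expr_cost e1, r1) (expr_cost e2) (pc + expr_cost e1 + expr_cost e2, r2)"
     "r2 (tmp (Suc d)) = eval_expr xs e2 s" "agree_below (Suc d) r1 r2"
    using Plus.IH(2)[of "pc + expr_cost e1" "Suc d" r1] Plus.prems represents_agree[OF _ r1(3)] by auto
  let ?r3 = "r2(tmp d := eval_expr xs e1 s + eval_expr xs e2 s)"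
  have "reach P xs (pc + expr_cost e1 + expr_cost e2, r2) (Suc 0) (pc + expr_cost e1 + expr_cost e2 + 1, ?r3)"
    using reach_straight[of P "pc + expr_cost e1 + expr_cost e2" "[Add (tmp d) (tmp d) (tmp (Suc d))]" xs r2]
      Plus.prems r1 r2 agree_below_tmp[OF r2(3), of d] by (simp add: add.assoc)
  from reach_trans[OF r1(1) reach_trans[OF r2(1) this]] show ?case
    using agree_below_trans[OF r1(3) r2(3)] by (intro exI[of _ ?r3]) (simp add: add.assoc fun_upd_same del: fun_upd_apply)
next
  case (Minus e1 e2)
  obtain r1 where r1: "reach P xs (pc, r) (expr_cost e1) (pc + expr_cost e1, r1)"
     "r1 (tmp d) = eval_expr xs e1 s" "agree_below d r r1"
    using Minus.IH(1)[of pc d r] Minus.prems by auto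
  obtain r2 where r2: "reach P xs (pc + expr_cost e1, r1) (expr_cost e2) (pc + expr_cost e1 + expr_cost e2, r2)"
     "r2 (tmp (Suc d)) = eval_expr xs e2 s" "agree_below (Suc d) r1 r2"
    using Minus.IH(2)[of "pc + expr_cost e1" "Suc d" r1] Minus.prems represents_agree[OF _ r1(3)] by auto
  let ?r3 = "r2(tmp d := eval_expr xs e1 s - eval_expr xs e2 s)"
  have "reach P xs (pc + expr_cost e1 + expr_cost e2, r2) (Suc 0) (pc + expr_cost e1 + expr_cost e2 + 1, ?r3)"
    using reach_straight[of P "pc + expr_cost e1 + expr_cost e2" "[Sub (tmp d) (tmp d) (tmp (Suc d))]" xs r2]
      Minus.prems r1 r2 agree_below_tmp[OF r2(3), of d] by (simp add: add.assoc)
  from reach_trans[OF r1(1) reach_trans[OF r2(1) this]] show ?case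
    using agree_below_trans[OF r1(3) r2(3)] by (intro exI[of _ ?r3]) (simp add: add.assoc fun_upd_same del: fun_upd_apply)
next
  case (Halve e)
  obtain r1 where r1: "reach P xs (pc, r) (expr_cost e) (pc + expr_cost e, r1)"
     "r1 (tmp d) = eval_expr xs e s" "agree_below d r r1"
    using Halve.IH[of pc d r] Halve.prems by auto
  have "reach P xs (pc + expr_cost e, r1) (Suc 0)
      (pc + expr_cost e + 1, r1(tmp d := eval_expr xs e s div 2))"
    using reach_straight[of P "pc + expr_cost e" "[Half (tmp d) (tmp d)]" xs r1] Halve.prems r1(2)
    by simp
  from reach_trans[OF r1(1) this] show ?case
    using r1(3) by (intro exI[of _ "r1(tmp d := eval_expr xs e s div 2)"]) (simp add: fun_upd_same del: fun_upd_apply)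
qed

lemma comp_correct:
  assumes "code_at P pc (comp c pc)" "represents r s" "wf_stmt c"
  shows "\<exists>r'. reach P xs (pc, r) (time xs c s) (pc + code_size c, r') \<and> represents r' (sem xs c s)"
  using assms
proof (induction c arbitrary: pc r s)
  case Skip
  then show ?case by (intro exI[of _ r]) (simp add: fun_upd_same del: fun_upd_apply)
next
  case (Assign x e)
  obtain r1 where r1: "reach P xs (pc, r) (expr_cost e) (pc + expr_cost e, r1)"
     "r1 (tmp 0) = eval_expr xs e s" "agree_below 0 r r1"
    using comp_expr_correct[of P pc e 0 r s xs] Assign.prems by auto
  let ?r2 = "r1(tmp 1 := 0, 16 * x := eval_expr xs e s)"
  have "reach P xs (pc + expr_cost e, r1) (Suc (Suc 0)) (pc + expr_cost e + 2, ?r2)"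
    using reach_straight[of P "pc + expr_cost e" "drop (expr_cost e) (comp (Assign x e) pc)" xs r1]
      Assign.prems r1(2) by simp
  moreover have "represents ?r2 (upd s 0 x (eval_expr xs e s))"
    by (rule represents_upd_scalar) (use Assign.prems represents_agree[OF Assign.prems(2), of 0 "r1(tmp 1 := 0)"] r1(3) in auto)
  ultimately show ?case
    using reach_trans[OF r1(1), of 2 "(pc + expr_cost e + 2, ?r2)"]
    by (intro exI[of _ ?r2]) (simp add: add.assoc numeral_2_eq_2 del: fun_upd_apply)
next
  case (Put a e1 e2)
  obtain r1 where r1: "reach P xs (pc, r) (expr_cost e1) (pc + expr_cost e1, r1)"
     "r1 (tmp 0) = eval_expr xs e1 s" "agree_below 0 r r1"
    using comp_expr_correct[of P pc e1 0 r s xs] Put.prems by auto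
  obtain r2 where r2: "reach P xs (pc + expr_cost e1, r1) (expr_cost e2) (pc + expr_cost e1 + expr_cost e2, r2)"
     "r2 (tmp 1) = eval_expr xs e2 s" "agree_below 1 r1 r2"
    using comp_expr_correct[of P "pc + expr_cost e1" e2 1 r1 s xs] Put.prems represents_agree[OF _ r1(3)] by auto
  let ?z = "eval_expr xs e1 s" and ?v = "eval_expr xs e2 s"
  let ?r3 = "r2(tmp 0 := 16 * ?z + int a, tmp 2 := int a)"
  have seven: "7 = Suc (Suc (Suc (Suc (Suc (Suc (Suc 0))))))" by simp
  have z: "r2 (tmp 0) = ?z" using agree_below_tmp[OF r2(3), of 0] r1(2) by simp
  have "reach P xs (pc + expr_cost e1 + expr_cost e2, r2) 7
     (pc + expr_cost e1 + expr_cost e2 + 7, ?r3(nat (16 * ?z + int a) := ?v))"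
    using reach_straight[of P "pc + expr_cost e1 + expr_cost e2"
        "drop (expr_cost e1 + expr_cost e2) (comp (Put a e1 e2) pc)" xs r2] Put.prems z r2(2)
    by (simp add: fun_upd_twist algebra_simps seven)
  note reach = reach_trans[OF r1(1) reach_trans[OF r2(1) this]]
  have "represents ?r3 s"
    using represents_agree[OF Put.prems(2), of 0 ?r3] agree_below_trans[OF r1(3) r2(3)] by simp
  then have "represents (?r3(nat (16 * ?z + int a) := ?v)) (wr s a ?z ?v)"
    by (rule represents_write) (use Put.prems in auto)
  then show ?case
    using reach by (intro exI[of _ "?r3(nat (16 * ?z + int a) := ?v)"]) (simp add: add.assoc del: fun_upd_apply)
next
  case (Seq c1 c2)
  obtain r1 where r1: "reach P xs (pc, r) (time xs c1 s) (pc + code_size c1, r1)" "represents r1 (sem xs c1 s)"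
    using Seq.IH(1)[of pc r s] Seq.prems by auto
  obtain r2 where r2: "reach P xs (pc + code_size c1, r1) (time xs c2 (sem xs c1 s)) (pc + code_size c1 + code_size c2, r2)"
      "represents r2 (sem xs c2 (sem xs c1 s))"
    using Seq.IH(2)[of "pc + code_size c1" r1 "sem xs c1 s"] Seq.prems r1(2) by auto
  show ?case using reach_trans[OF r1(1) r2(1)] r2(2) by (intro exI[of _ r2]) (simp add: add.assoc fun_upd_same del: fun_upd_apply)
next
  case (Cond e c1 c2)
  obtain r1 where r1: "reach P xs (pc, r) (expr_cost e) (pc + expr_cost e, r1)"
     "r1 (tmp 0) = eval_expr xs e s" "agree_below 0 r r1"
    using comp_expr_correct[of P pc e 0 r s xs] Cond.prems by auto
  have rep: "represents r1 s" using represents_agree[OF Cond.prems(2) r1(3)] .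
  show ?case
  proof (cases "eval_expr xs e s > 0")
    case True
    obtain r2 where r2: "reach P xs (pc + expr_cost e + code_size c2 + 2, r1) (time xs c1 s)
       (pc + expr_cost e + code_size c2 + 2 + code_size c1, r2)" "represents r2 (sem xs c1 s)"
      using Cond.IH(1)[of "pc + expr_cost e + code_size c2 + 2" r1 s] Cond.prems rep by auto
    have "reach P xs (pc + expr_cost e, r1) (Suc (time xs c1 s)) (pc + expr_cost e + code_size c2 + 2 + code_size c1, r2)"
      by (rule reach_step[where i = "JPos (tmp 0) (pc + expr_cost e + code_size c2 + 2)" and rest = "[]"])
         (use Cond.prems True r1(2) r2 in auto)
    from reach_trans[OF reach_trans[OF r1(1) this] reach_refl[where T = 1]] show ?thesis
      using True r2 by (intro exI[of _ r2]) (simp add: algebra_simps)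
  next
    case False
    obtain r2 where r2: "reach P xs (pc + expr_cost e + 1, r1) (time xs c2 s)
       (pc + expr_cost e + 1 + code_size c2, r2)" "represents r2 (sem xs c2 s)"
      using Cond.IH(2)[of "pc + expr_cost e + 1" r1 s] Cond.prems rep by auto
    have a: "reach P xs (pc + expr_cost e, r1) (Suc (time xs c2 s)) (pc + expr_cost e + 1 + code_size c2, r2)"
      by (rule reach_step[where i = "JPos (tmp 0) (pc + expr_cost e + code_size c2 + 2)" and rest = "[]"])
         (use Cond.prems False r1(2) r2 in auto)
    have b: "reach P xs (pc + expr_cost e + 1 + code_size c2, r2) (Suc 0) (pc + code_size (Cond e c1 c2), r2)"
      by (rule reach_step[where i = "Jump (pc + code_size (Cond e c1 c2))" and rest = "[]"])
         (use Cond.prems in auto)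
    from reach_trans[OF reach_trans[OF r1(1) a] b] show ?thesis
      using False r2 by (intro exI[of _ r2]) (simp add: algebra_simps)
  qed
next
  case (For x l c)
  let ?L = "loop (\<lambda>j t. sem xs c (upd t 0 x (int j)))"
  let ?m = "nat (cell s 0 l)" and ?end = "pc + code_size (For x l c)"
  have wf: "x < 64" "l < 64" "x \<noteq> l" "x \<notin> scalars c" "l \<notin> scalars c" "wf_stmt c" using For.prems by auto
  have code: "code_at P pc [Const (16 * x) 0]"
     "code_at P (pc + 1) [Sub (tmp 0) (16 * l) (16 * x), JPos (tmp 0) (pc + 4), Jump ?end]"
     "code_at P (pc + 4) (comp c (pc + 4))"
     "code_at P (pc + 4 + code_size c) [Const (tmp 0) 1, Add (16 * x) (16 * x) (tmp 0), Jump (pc + 1)]"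
    using For.prems(1) by (auto simp: eval_nat_numeral)
  \<comment> \<open>The machine looks up the limit in every pass; the frame property shows that it
    always finds the value on entry.\<close>
  have lim: "cell (?L j s) 0 l = cell s 0 l" for j
    by (rule loop_scalar_frame) (use wf sem_scalar_frame in auto)
  have test: "reach P xs (pc + 1, r1) (Suc (Suc T)) c'"
    if "represents r1 t" "r2 = r1(tmp 0 := cell t 0 l - cell t 0 x)"
       "reach P xs (if cell t 0 l - cell t 0 x > 0 then pc + 4 else pc + 3, r2) T c'" for r1 r2 t T c'
    using that represents_scalar[OF that(1)] wf code(2)
    by (intro reach_step[where i = "Sub (tmp 0) (16 * l) (16 * x)" and rest = "[]"]
        reach_step[where i = "JPos (tmp 0) (pc + 4)" and rest = "[]" and pc = "Suc (pc + 1)", simplified])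
      (auto simp: eval_nat_numeral intro!: reach_step[where i = "JPos (tmp 0) (Suc (Suc (Suc (Suc pc))))" and rest = "[]"] split: if_splits)
  \<comment> \<open>The invariant is stated at the loop test, where the counter register already
    contains \<open>j\<close> although the state \<open>?L j s\<close> has not been told so.\<close>
  have iter: "\<exists>r1. reach P xs (pc + 1, r(16 * x := 0)) (\<Sum>i<j. 5 + time xs c (upd (?L i s) 0 x (int i))) (pc + 1, r1) \<and>
      represents r1 (upd (?L j s) 0 x (int j))" if "j \<le> ?m" for j
    using that
  proof (induction j)
    case 0
    show ?case using represents_upd_scalar[OF For.prems(2) wf(1), of 0]
      by (intro exI[of _ "r(16 * x := 0)"]) (simp del: fun_upd_apply)
  next
    case (Suc j)
    then obtain r1 where r1: "reach P xs (pc + 1, r(16 * x := 0)) (\<Sum>i<j. 5 + time xs c (upd (?L i s) 0 x (int i))) (pc + 1, r1)"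
      "represents r1 (upd (?L j s) 0 x (int j))" using Suc_leD by blast
    let ?t = "upd (?L j s) 0 x (int j)"
    let ?r2 = "r1(tmp 0 := cell ?t 0 l - cell ?t 0 x)"
    have rep: "represents ?r2 ?t" using represents_agree[OF r1(2), of 0 ?r2] by simp
    obtain r3 where r3: "reach P xs (pc + 4, ?r2) (time xs c ?t) (pc + 4 + code_size c, r3)"
        "represents r3 (sem xs c ?t)"
      using For.IH[OF code(3) rep wf(6)] by blast
    let ?r4 = "r3(tmp 0 := 1, 16 * x := int j + 1)"
    have x: "r3 (16 * x) = int j"
      using represents_scalar[OF r3(2) wf(1)] sem_scalar_frame[OF wf(4)] by simp
    have "reach P xs (pc + 4 + code_size c, r3) (Suc (Suc (Suc 0))) (pc + 1, ?r4)"
      using reach_straight[of P "pc + 4 + code_size c"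
          "[Const (tmp 0) 1, Add (16 * x) (16 * x) (tmp 0)]" xs r3] code(4) x tmp_neq_scalar[OF wf(1)]
        reach_step[of P "pc + 4 + code_size c + 2" "Jump (pc + 1)" "[]" xs ?r4 0 "(pc + 1, ?r4)"]
        reach_trans[of P xs "(pc + 4 + code_size c, r3)" 2 "(pc + 4 + code_size c + 2, ?r4)" "Suc 0" "(pc + 1, ?r4)"]
      by (simp add: eval_nat_numeral)
    note r4 = reach_trans[OF r3(1) this]
    have pos: "cell ?t 0 l - cell ?t 0 x > 0" using Suc.prems lim wf by auto
    have "reach P xs (pc + 1, r1) (Suc (Suc (time xs c ?t + Suc (Suc (Suc 0))))) (pc + 1, ?r4)"
      by (rule test[OF r1(2) refl]) (use pos r4 in simp)
    from reach_trans[OF r1(1) this]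
    have "reach P xs (pc + 1, r(16 * x := 0)) (\<Sum>i<Suc j. 5 + time xs c (upd (?L i s) 0 x (int i))) (pc + 1, ?r4)"
      by (simp add: algebra_simps eval_nat_numeral)
    moreover have "represents ?r4 (upd (sem xs c ?t) 0 x (int j + 1))"
      by (rule represents_upd_scalar) (use wf represents_agree[OF r3(2), of 0 "r3(tmp 0 := 1)"] in auto)
    ultimately show ?case by (intro exI[of _ ?r4]) (simp add: add.commute del: fun_upd_apply)
  qed
  obtain r1 where r1: "reach P xs (pc + 1, r(16 * x := 0)) (\<Sum>i<?m. 5 + time xs c (upd (?L i s) 0 x (int i))) (pc + 1, r1)"
      "represents r1 (upd (?L ?m s) 0 x (int ?m))" using iter[OF order_refl] by auto
  let ?t = "upd (?L ?m s) 0 x (int ?m)"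
  let ?r2 = "r1(tmp 0 := cell ?t 0 l - cell ?t 0 x)"
  have "reach P xs (pc + 1, r1) (Suc (Suc (Suc 0))) (?end, ?r2)"
    by (rule test[OF r1(2) refl], rule reach_step[where i = "Jump ?end" and rest = "[]"])
       (use code(2) lim wf in \<open>auto simp: eval_nat_numeral\<close>)
  from reach_trans[OF r1(1) this]
  have "reach P xs (pc, r) (Suc ((\<Sum>i<?m. 5 + time xs c (upd (?L i s) 0 x (int i))) + Suc (Suc (Suc 0)))) (?end, ?r2)"
    by (intro reach_step[OF code(1)]) (simp add: fun_upd_def)
  moreover have "represents ?r2 ?t" using represents_agree[OF r1(2), of 0 ?r2] by simp
  ultimately show ?case by (intro exI[of _ ?r2]) (simp add: eval_nat_numeral del: fun_upd_apply)
qed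

text \<open>At the end of the code the program counter equals the length of the program. Halted
  configurations persist, so any larger \<open>T\<close> serves as well.\<close>

theorem comp_outputs:
  assumes "wf_stmt c" "time xs c (State (\<lambda>_ _. 0)) \<le> T"
  shows "outputs_within (comp c 0) xs (cell (sem xs c (State (\<lambda>_ _. 0))) 0 0) T"
proof -
  let ?P = "comp c 0"
  have "represents (\<lambda>_. 0) (State (\<lambda>_ _. 0))" by (simp add: represents_def)
  then obtain r where r: "reach ?P xs (0, \<lambda>_. 0) (time xs c (State (\<lambda>_ _. 0))) (code_size c, r)"
      "represents r (sem xs c (State (\<lambda>_ _. 0)))"
    using comp_correct[of ?P 0 c "\<lambda>_. 0" "State (\<lambda>_ _. 0)" xs] assms(1) code_at_self[of "[]" ?P] by auto
  then obtain t where t: "t \<le> time xs c (State (\<lambda>_ _. 0))" "run ?P xs t = (code_size c, r)"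
    by (auto simp: reach_def run_def)
  have "run ?P xs (t + u) = (code_size c, r)" for u
    by (induction u) (use t in \<open>auto simp: run_def step_def\<close>)
  from this[of "T - t"] have "run ?P xs T = (code_size c, r)" using t assms(2) by simp
  then show ?thesis using represents_scalar[OF r(2), of 0] by (simp add: outputs_within_def)
qed

subsection \<open>Static time bounds\<close>

primrec limits :: "stmt \<Rightarrow> nat set" where
  "limits Skip = {}"
| "limits (Assign x e) = {}"
| "limits (Put a e1 e2) = {}"
| "limits (c1 ;; c2) = limits c1 \<union> limits c2"
| "limits (Cond e c1 c2) = limits c1 \<union> limits c2"
| "limits (For x l c) = insert l (limits c)"

primrec time_bound :: "(nat \<Rightarrow> nat) \<Rightarrow> stmt \<Rightarrow> nat" where
  "time_bound \<rho> Skip = 0"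
| "time_bound \<rho> (Assign x e) = expr_cost e + 2"
| "time_bound \<rho> (Put a e1 e2) = expr_cost e1 + expr_cost e2 + 7"
| "time_bound \<rho> (c1 ;; c2) = time_bound \<rho> c1 + time_bound \<rho> c2"
| "time_bound \<rho> (Cond e c1 c2) = expr_cost e + 2 + time_bound \<rho> c1 + time_bound \<rho> c2"
| "time_bound \<rho> (For x l c) = 4 + \<rho> l * (5 + time_bound \<rho> c)"

text \<open>If no loop limit is assigned inside \<open>c\<close>, bounds that hold on entry hold in
  every nested loop. Programs that compute their own limits are therefore treated phase by
  phase.\<close>

lemma time_le_time_bound:
  assumes "limits c \<inter> scalars c = {}" "\<And>l. l \<in> limits c \<Longrightarrow> cell s 0 l \<le> int (\<rho> l)"
  shows "time xs c s \<le> time_bound \<rho> c"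
  using assms
proof (induction c arbitrary: s)
  case (Seq c1 c2)
  have "time xs c1 s \<le> time_bound \<rho> c1" by (rule Seq.IH(1)) (use Seq.prems in auto)
  moreover have "time xs c2 (sem xs c1 s) \<le> time_bound \<rho> c2"
  proof (rule Seq.IH(2))
    fix l assume "l \<in> limits c2"
    then show "cell (sem xs c1 s) 0 l \<le> int (\<rho> l)"
      using Seq.prems(1) Seq.prems(2)[of l] sem_scalar_frame[of l c1 xs s] by fastforce
  qed (use Seq.prems in auto)
  ultimately show ?case by simp
next
  case (Cond e c1 c2)
  have "time xs c1 s \<le> time_bound \<rho> c1" "time xs c2 s \<le> time_bound \<rho> c2"
    by (rule Cond.IH; use Cond.prems in auto)+
  then show ?case by simp
next
  case (For x l c)
  let ?L = "loop (\<lambda>j t. sem xs c (upd t 0 x (int j)))"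
  have "time xs c (upd (?L j s) 0 x (int j)) \<le> time_bound \<rho> c" for j
  proof (rule For.IH)
    fix l' assume l': "l' \<in> limits c"
    then have "l' \<notin> scalars c" "l' \<noteq> x" using For.prems(1) by auto
    then have "cell (?L j s) 0 l' = cell s 0 l'"
      by (intro loop_scalar_frame) (auto simp: sem_scalar_frame)
    then show "cell (upd (?L j s) 0 x (int j)) 0 l' \<le> int (\<rho> l')" using For.prems l' by auto
  qed (use For.prems in auto)
  then have "(\<Sum>j<nat (cell s 0 l). 5 + time xs c (upd (?L j s) 0 x (int j))) \<le> (\<Sum>j<nat (cell s 0 l). 5 + time_bound \<rho> c)"
    by (intro sum_mono add_left_mono)
  also have "\<dots> = nat (cell s 0 l) * (5 + time_bound \<rho> c)" by simp
  also have "\<dots> \<le> \<rho> l * (5 + time_bound \<rho> c)"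
    by (rule mult_right_mono) (use For.prems(2)[of l] in auto)
  finally show ?case by simp
qed auto

subsection \<open>Loop rule\<close>

text \<open>The step receives the frame conditions relative to the initial state for free, so an
  invariant has to mention only what the body changes.\<close>

lemma sem_For:
  assumes lim: "cell s 0 l = int m"
    and init: "I 0 s"
    and step: "\<And>j t. j < m \<Longrightarrow> I j t \<Longrightarrow> \<forall>y. y \<notin> insert x (scalars c) \<longrightarrow> cell t 0 y = cell s 0 y \<Longrightarrow>
       \<forall>a. a \<noteq> 0 \<and> a \<notin> arrays c \<longrightarrow> cell t a = cell s a \<Longrightarrow> I (Suc j) (sem xs c (upd t 0 x (int j)))"
    and final: "\<And>t. I m t \<Longrightarrow> I' (upd t 0 x (int m))"
  shows "I' (sem xs (For x l c) s)"
proof -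
  let ?L = "loop (\<lambda>j t. sem xs c (upd t 0 x (int j)))"
  have fs: "cell (?L j s) 0 y = cell s 0 y" if "y \<notin> insert x (scalars c)" for y j
    by (rule loop_scalar_frame) (use that sem_scalar_frame in auto)
  have fa: "cell (?L j s) a = cell s a" if "a \<noteq> 0" "a \<notin> arrays c" for a j
    by (rule loop_array_frame) (use that sem_array_frame in auto)
  have "j \<le> m \<Longrightarrow> I j (?L j s)" for j
  proof (induction j)
    case (Suc j)
    then show ?case unfolding loop.simps by (intro step) (auto simp: fs fa)
  qed (simp add: init)
  from final[OF this[of m]] show ?thesis by (simp add: lim)
qed

section \<open>Exterior multiplication\<close>

text \<open>An element of the exterior algebra of rank \<open>p\<close> is given by its coordinates \<open>w S\<close> for
  \<open>S < 2 ^ p\<close>, the binary digits of \<open>S\<close> being the basis vectors that occur. \<open>ext p x w\<close> is the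
  product of \<open>w\<close> with the vector \<open>(1, x, \<dots>, x ^ (p - 1))\<close> of the moment curve.\<close>

fun ext :: "nat \<Rightarrow> int \<Rightarrow> (nat \<Rightarrow> int) \<Rightarrow> nat \<Rightarrow> int" where
  "ext 0 x w S = 0"
| "ext (Suc p) x w S =
     (if 2 ^ p \<le> S then x ^ p * w (S - 2 ^ p) - ext p x (\<lambda>i. w (i + 2 ^ p)) (S - 2 ^ p)
      else ext p x w S)"

lemma ext_cong:
  assumes "\<And>i. i < 2 ^ p \<Longrightarrow> w i = w' i" "S < 2 ^ p"
  shows "ext p x w S = ext p x w' S"
  using assms
proof (induction p arbitrary: w w' S)
  case (Suc p)
  show ?case
  proof (cases "2 ^ p \<le> S")
    case True
    have "ext p x (\<lambda>i. w (i + 2 ^ p)) (S - 2 ^ p) = ext p x (\<lambda>i. w' (i + 2 ^ p)) (S - 2 ^ p)"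
      by (rule Suc.IH) (use Suc.prems True in auto)
    moreover have "w (S - 2 ^ p) = w' (S - 2 ^ p)" by (rule Suc.prems) (use Suc.prems in auto)
    ultimately show ?thesis using True by simp
  next
    case False
    then have "ext p x w S = ext p x w' S" by (intro Suc.IH) (use Suc.prems in auto)
    then show ?thesis using False by simp
  qed
qed simp

lemma ext_lin: "ext p x (\<lambda>i. a * w i + b * w' i) S = a * ext p x w S + b * ext p x w' S"
  by (induction p arbitrary: w w' S) (auto simp: algebra_simps)

text \<open>The highest basis vector is written in front of the others, so moving the lower part of
  a factor past it produces the minus sign in \<open>ext\<close>. Splitting off that vector reduces
  the claim to rank \<open>p\<close>.\<close>

lemma ext_anticommute: "S < 2 ^ p \<Longrightarrow> ext p x (ext p y w) S = - ext p y (ext p x w) S"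
proof (induction p arbitrary: w S)
  case (Suc p)
  have low: "ext p x (ext (Suc p) y w) T = ext p x (ext p y w) T" if "T < 2 ^ p" for T x y
    by (rule ext_cong) (use that in auto)
  show ?case
  proof (cases "2 ^ p \<le> S")
    case True
    define T where "T = S - 2 ^ p"
    have T: "T < 2 ^ p" using True Suc.prems by (auto simp: T_def)
    \<comment> \<open>Exchanging \<open>x\<close> and \<open>y\<close> negates the difference of the
      first two terms; only the third needs the induction hypothesis.\<close>
    have *: "ext (Suc p) x (ext (Suc p) y w) S =
       x ^ p * ext p y w T - y ^ p * ext p x w T + ext p x (ext p y (\<lambda>i. w (i + 2 ^ p))) T" for x y
    proof -
      have "ext p x (\<lambda>i. ext (Suc p) y w (i + 2 ^ p)) T
          = ext p x (\<lambda>i. y ^ p * w i + (-1) * ext p y (\<lambda>i. w (i + 2 ^ p)) i) T"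
        by (rule ext_cong) (use T in auto)
      also have "\<dots> = y ^ p * ext p x w T + (-1) * ext p x (ext p y (\<lambda>i. w (i + 2 ^ p))) T"
        by (rule ext_lin)
      finally show ?thesis using True T by (simp add: T_def)
    qed
    show ?thesis unfolding * using Suc.IH[OF T, of "\<lambda>i. w (i + 2 ^ p)"] by simp
  next
    case False
    have "ext (Suc p) x (ext (Suc p) y w) S = ext p x (ext p y w) S" for x y
      using low[of S x y] False by (simp only: ext.simps if_False)
    moreover have "ext p x (ext p y w) S = - ext p y (ext p x w) S"
      using Suc.IH[of S w] False by simp
    ultimately show ?thesis by metis
  qed
qed simp

text \<open>Coordinates from \<open>2 ^ p\<close> on are cut off so that identities between products
  become equations of functions.\<close>

definition wedge :: "nat \<Rightarrow> int \<Rightarrow> (nat \<Rightarrow> int) \<Rightarrow> nat \<Rightarrow> int" where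
  "wedge p x w = (\<lambda>S. if S < 2 ^ p then ext p x w S else 0)"

definition wedges :: "nat \<Rightarrow> nat list \<Rightarrow> (nat \<Rightarrow> int) \<Rightarrow> nat \<Rightarrow> int" where
  "wedges p ys = fold (\<lambda>y. wedge p (int y)) ys"

definition unit_vec :: "nat \<Rightarrow> int" where
  "unit_vec = (\<lambda>S. if S = 0 then 1 else 0)"

lemma wedges_Nil [simp]: "wedges p [] w = w"
  and wedges_Cons: "wedges p (y # ys) w = wedges p ys (wedge p (int y) w)"
  and wedges_append: "wedges p (ys @ zs) w = wedges p zs (wedges p ys w)"
  by (simp_all add: wedges_def)

lemma wedge_lin: "wedge p x (\<lambda>i. a * w i + b * w' i) = (\<lambda>S. a * wedge p x w S + b * wedge p x w' S)"
  by (auto simp: wedge_def ext_lin)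

lemma wedges_lin: "wedges p ys (\<lambda>i. a * w i + b * w' i) = (\<lambda>S. a * wedges p ys w S + b * wedges p ys w' S)"
proof (induction ys arbitrary: w w')
  case (Cons y ys)
  show ?case unfolding wedges_Cons wedge_lin by (rule Cons.IH)
qed simp

lemma wedges_scale: "wedges p ys (\<lambda>i. a * w i) = (\<lambda>S. a * wedges p ys w S)"
  using wedges_lin[of p ys a w 0 w] by simp

lemma wedge_cut: "2 ^ p \<le> S \<Longrightarrow> wedge p x w S = 0"
  by (simp add: wedge_def)

lemma wedges_cut: "(\<And>S. 2 ^ p \<le> S \<Longrightarrow> w S = 0) \<Longrightarrow> 2 ^ p \<le> S \<Longrightarrow> wedges p ys w S = 0"
proof (induction ys arbitrary: w)
  case (Cons y ys)
  show ?case unfolding wedges_Cons by (rule Cons.IH) (use wedge_cut Cons.prems in auto)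
qed simp

lemma wedge_cong: "(\<And>i. i < 2 ^ p \<Longrightarrow> w i = w' i) \<Longrightarrow> wedge p x w = wedge p x w'"
  unfolding wedge_def using ext_cong[of p w w'] by auto

lemma wedge_anticommute: "wedge p x (wedge p y w) = (\<lambda>S. - wedge p y (wedge p x w) S)"
proof
  fix S
  have *: "wedge p x (wedge p y w) S = (if S < 2 ^ p then ext p x (ext p y w) S else 0)" for x y
    using ext_cong[of p "wedge p y w" "ext p y w" S x] by (auto simp: wedge_def)
  show "wedge p x (wedge p y w) S = - wedge p y (wedge p x w) S"
    unfolding * using ext_anticommute[of S p x y w] by auto
qed

lemma wedges_neg: "wedges p ys (\<lambda>S. - w S) = (\<lambda>S. - wedges p ys w S)"
  using wedges_scale[of p ys "-1" w] by simp

lemma wedges_zero: "wedges p ys (\<lambda>S. 0) = (\<lambda>S. 0)"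
  using wedges_scale[of p ys 0 "\<lambda>S. 0"] by simp

text \<open>By anticommutativity the value equals its own negative, and the integers have no
  2-torsion.\<close>

lemma wedge_square: "wedge p x (wedge p x w) = (\<lambda>S. 0)"
proof
  fix S
  show "wedge p x (wedge p x w) S = 0" using fun_cong[OF wedge_anticommute[of p x x w], of S] by simp
qed

text \<open>The factor is moved, at the cost of signs, until it meets its second occurrence.\<close>

lemma wedges_repeated: "y \<in> set ys \<Longrightarrow> wedges p ys (wedge p (int y) w) = (\<lambda>S. 0)"
proof (induction ys arbitrary: w)
  case (Cons z ys)
  show ?case
  proof (cases "y = z")
    case True
    then show ?thesis by (simp add: wedges_Cons wedge_square wedges_zero)
  next
    case False
    then have "wedges p ys (wedge p (int y) (wedge p (int z) w)) = (\<lambda>S. 0)"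
      using Cons by auto
    then show ?thesis
      using wedge_anticommute[of p "int z" "int y" w] by (simp add: wedges_Cons wedges_neg)
  qed
qed simp

lemma wedges_not_distinct: "\<not> distinct ys \<Longrightarrow> wedges p ys w = (\<lambda>S. 0)"
proof (induction ys arbitrary: w)
  case (Cons y ys)
  then show ?case using wedges_repeated[of y ys p w] by (cases "y \<in> set ys") (auto simp: wedges_Cons)
qed simp

text \<open>The number of binary digits 1 of \<open>S\<close>, that is, the degree of the basis
  element \<open>S\<close> in the grading of the exterior algebra.\<close>

fun weight :: "nat \<Rightarrow> nat \<Rightarrow> nat" where
  "weight 0 S = 0"
| "weight (Suc p) S = (if 2 ^ p \<le> S then Suc (weight p (S - 2 ^ p)) else weight p S)"

lemma weight_top: "weight p (2 ^ p - 1) = p"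
proof (induction p)
  case (Suc p)
  have "2 ^ Suc p - 1 - 2 ^ p = (2 ^ p - 1 :: nat)" "2 ^ p \<le> (2 ^ Suc p - 1 :: nat)" by auto
  then show ?case using Suc by (simp only: weight.simps if_True)
qed simp

lemma weight_le: "weight p S \<le> p"
  by (induction p arbitrary: S) (auto simp: le_SucI)

lemma weight_eq_top: "S < 2 ^ p \<Longrightarrow> weight p S = p \<Longrightarrow> S = 2 ^ p - 1"
proof (induction p arbitrary: S)
  case (Suc p)
  show ?case
  proof (cases "2 ^ p \<le> S")
    case True
    then have "S - 2 ^ p = 2 ^ p - 1" using Suc.IH[of "S - 2 ^ p"] Suc.prems by simp
    then show ?thesis using True Suc.prems by simp
  next
    case False
    then show ?thesis using Suc.prems weight_le[of p S] by simp
  qed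
qed simp

text \<open>A product with a vector raises the degree by one. The target degree \<open>d\<close> is
  a variable because the high half of \<open>w\<close> has its degrees shifted by one in the
  induction.\<close>

lemma ext_weight:
  assumes "\<And>i. i < 2 ^ p \<Longrightarrow> w i \<noteq> 0 \<Longrightarrow> Suc (weight p i) = d" "S < 2 ^ p" "ext p x w S \<noteq> 0"
  shows "weight p S = d"
  using assms
proof (induction p arbitrary: w S d)
  case (Suc p)
  show ?case
  proof (cases "2 ^ p \<le> S")
    case True
    define T where "T = S - 2 ^ p"
    have T: "T < 2 ^ p" using True Suc.prems by (auto simp: T_def)
    consider "w T \<noteq> 0" | "ext p x (\<lambda>i. w (i + 2 ^ p)) T \<noteq> 0"
      using Suc.prems(3) True by (fastforce simp: T_def)
    then have "Suc (weight p T) = d"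
    proof cases
      case 1
      then show ?thesis using Suc.prems(1)[of T] T by auto
    next
      case 2
      have "weight p T = d - 1"
      proof (rule Suc.IH[OF _ T 2])
        fix i :: nat assume "i < 2 ^ p" "w (i + 2 ^ p) \<noteq> 0"
        then show "Suc (weight p i) = d - 1" using Suc.prems(1)[of "i + 2 ^ p"] by auto
      qed
      \<comment> \<open>The degree \<open>d - 1\<close> obtained above is a truncated difference. If
        \<open>d\<close> were 0, all relevant coordinates of \<open>w\<close> would vanish, and the
        product with them.\<close>
      moreover have "d \<noteq> 0"
      proof
        assume "d = 0"
        then have "w i = 0" if "i < 2 ^ Suc p" for i using Suc.prems(1)[of i] that by auto
        then have "ext p x (\<lambda>i. w (i + 2 ^ p)) T = ext p x (\<lambda>i. 0 * w i + 0 * w i) T"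
          by (intro ext_cong) (use T in auto)
        then show False using 2 ext_lin[of p x 0 w 0 w T] by simp
      qed
      ultimately show ?thesis by simp
    qed
    then show ?thesis using True by (simp add: T_def)
  next
    case False
    have "weight p S = d"
    proof (rule Suc.IH)
      fix i :: nat assume "i < 2 ^ p" "w i \<noteq> 0"
      then show "Suc (weight p i) = d" using Suc.prems(1)[of i] by auto
    qed (use False Suc.prems in auto)
    then show ?thesis using False by simp
  qed
qed simp

lemma weight_zero [simp]: "weight p 0 = 0"
  by (induction p) auto

lemma wedges_weight:
  assumes "S < 2 ^ p" "wedges p ys unit_vec S \<noteq> 0"
  shows "weight p S = length ys"
  using assms
proof (induction ys arbitrary: S rule: rev_induct)
  case Nil
  then show ?case by (auto simp: unit_vec_def split: if_splits)
next
  case (snoc y ys)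
  have "weight p S = Suc (length ys)"
    by (rule ext_weight[where w = "wedges p ys unit_vec" and x = "int y"])
       (use snoc in \<open>auto simp: wedges_append wedges_Cons wedge_def\<close>)
  then show ?case by simp
qed

text \<open>The top coordinate has degree \<open>p\<close>, so it is nonzero only for products of
  exactly \<open>p\<close> factors, and repeated factors give 0.\<close>

lemma wedges_top_zero:
  assumes "card (set ys) < p"
  shows "wedges p ys unit_vec (2 ^ p - 1) = 0"
proof (cases "distinct ys")
  case True
  show ?thesis
  proof (rule ccontr)
    assume "\<not> ?thesis"
    then have "length ys = p" using wedges_weight[of "2 ^ p - 1" p ys] weight_top by simp
    then show False using assms True distinct_card by fastforce
  qed
qed (simp add: wedges_not_distinct)

text \<open>A coordinate is a signed sum of \<open>x ^ i * w T\<close> over exponents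
  \<open>i < p\<close>. The disjunct \<open>q = 0\<close> covers rank 0.\<close>

lemma ext_poly: "\<exists>q. (\<forall>x. ext p x w S = poly q x) \<and> (q = 0 \<or> degree q < p)"
proof (induction p arbitrary: w S)
  case 0
  show ?case by (intro exI[of _ 0]) simp
next
  case (Suc p)
  show ?case
  proof (cases "2 ^ p \<le> S")
    case True
    obtain q where q: "\<And>x. ext p x (\<lambda>i. w (i + 2 ^ p)) (S - 2 ^ p) = poly q x" "q = 0 \<or> degree q < p"
      using Suc.IH by blast
    have "degree (monom (w (S - 2 ^ p)) p - q) < Suc p"
      using q(2) degree_monom_le[of "w (S - 2 ^ p)" p] by (intro degree_diff_less) auto
    then show ?thesis
      using q True by (intro exI[of _ "monom (w (S - 2 ^ p)) p - q"]) (auto simp: poly_monom)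
  next
    case False
    then show ?thesis using Suc.IH[of w S] less_SucI by auto
  qed
qed

text \<open>Setting the highest basis vector to 0 maps the moment curve of rank \<open>Suc p\<close>
  to that of rank \<open>p\<close>.\<close>

lemma wedges_Suc_low: "S < 2 ^ p \<Longrightarrow> wedges (Suc p) ys unit_vec S = wedges p ys unit_vec S"
proof (induction ys arbitrary: S rule: rev_induct)
  case (snoc y ys)
  have "ext p (int y) (wedges (Suc p) ys unit_vec) S = ext p (int y) (wedges p ys unit_vec) S"
    by (rule ext_cong) (use snoc in auto)
  then show ?case using snoc.prems by (simp add: wedges_append wedges_Cons wedge_def)
qed simp

text \<open>As a function of the last element \<open>x\<close> the top coordinate is a polynomial of degree at most
  \<open>p\<close>, with nonzero leading coefficient by induction, that vanishes at the \<open>p\<close> other elements.\<close>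

lemma wedges_top_nonzero:
  assumes "distinct ys" "length ys = p"
  shows "wedges p ys unit_vec (2 ^ p - 1) \<noteq> 0"
  using assms
proof (induction p arbitrary: ys)
  case 0
  then show ?case by (simp add: unit_vec_def)
next
  case (Suc p)
  then obtain zs x where ys: "ys = zs @ [x]" by (metis length_Suc_conv_rev)
  let ?top = "2 ^ Suc p - 1 :: nat"
  let ?w = "wedges (Suc p) zs unit_vec"
  obtain q where q: "\<And>x. ext p x (\<lambda>i. ?w (i + 2 ^ p)) (?top - 2 ^ p) = poly q x" "q = 0 \<or> degree q < p"
    using ext_poly by blast
  \<comment> \<open>The coefficient of \<open>x ^ p\<close> is the top coordinate of the remaining
    factors in rank \<open>p\<close>, nonzero by induction.\<close>
  have lead: "?w (2 ^ p - 1) \<noteq> 0"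
    using Suc.IH[of zs] Suc.prems wedges_Suc_low[of "2 ^ p - 1" p zs] by (simp add: ys)
  define F where "F = monom (?w (2 ^ p - 1)) p - q"
  have top: "2 ^ p \<le> ?top" "?top - 2 ^ p = 2 ^ p - 1" "?top < 2 ^ Suc p" by auto
  have F: "wedges (Suc p) (zs @ [y]) unit_vec ?top = poly F (int y)" for y
    using q(1)[of "int y"] top by (simp add: wedges_append wedges_Cons wedge_def F_def poly_monom)
  have "coeff F p = ?w (2 ^ p - 1)" using q(2) by (auto simp: F_def coeff_eq_0)
  then have "F \<noteq> 0" using lead by auto
  have deg: "degree F \<le> p"
    using q(2) unfolding F_def by (intro degree_diff_le degree_monom_le) auto
  show ?case
  proof
    assume "wedges (Suc p) ys unit_vec ?top = 0"
    \<comment> \<open>An element of \<open>zs\<close> is a root because it would be a repeated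
      factor, and \<open>x\<close> is one by assumption: \<open>p + 1\<close> roots for degree at
      most \<open>p\<close>.\<close>
    then have "poly F (int y) = 0" if "y \<in> set ys" for y
      using that F[of y] wedges_not_distinct[of "zs @ [y]" "Suc p" unit_vec] by (auto simp: ys)
    then have "int ` set ys \<subseteq> {x. poly F x = 0}" by auto
    then have "card (int ` set ys) \<le> card {x. poly F x = 0}"
      by (intro card_mono poly_roots_finite \<open>F \<noteq> 0\<close>)
    also have "\<dots> \<le> degree F" by (rule card_poly_roots_bound[OF \<open>F \<noteq> 0\<close>])
    also have "card (int ` set ys) = Suc p"
      using Suc.prems by (simp add: card_image distinct_card)
    finally show False using deg by simp
  qed
qed

text \<open>A coordinate is a signed sum of distinct powers \<open>x ^ i\<close>,
  \<open>i < p\<close>, times entries of \<open>w\<close>, and the sum of these powers is at most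
  \<open>(x + 1) ^ p\<close>.\<close>

lemma ext_bound:
  assumes "\<And>i. i < 2 ^ p \<Longrightarrow> \<bar>w i\<bar> \<le> M" "S < 2 ^ p"
  shows "\<bar>ext p (int x) w S\<bar> \<le> int (Suc x) ^ p * M"
  using assms
proof (induction p arbitrary: w S)
  case 0
  have "0 \<le> M" using 0(1)[of 0] abs_ge_zero[of "w 0"] by simp
  then show ?case by simp
next
  case (Suc p)
  have M: "0 \<le> M" using Suc.prems(1)[of 0] abs_ge_zero[of "w 0"] by (simp del: abs_ge_zero)
  have mono: "int (Suc x) ^ p * M \<le> int (Suc x) ^ Suc p * M"
    using M by (intro mult_right_mono power_increasing) auto
  show ?case
  proof (cases "2 ^ p \<le> S")
    case True
    define T where "T = S - 2 ^ p"
    have T: "T < 2 ^ p" using True Suc.prems by (auto simp: T_def)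
    have a: "\<bar>ext p (int x) (\<lambda>i. w (i + 2 ^ p)) T\<bar> \<le> int (Suc x) ^ p * M"
      by (rule Suc.IH[OF _ T]) (use Suc.prems in auto)
    have b: "\<bar>int x ^ p * w T\<bar> \<le> int x ^ p * M"
      using Suc.prems(1)[of T] T by (simp add: abs_mult mult_left_mono)
    show ?thesis
    \<comment> \<open>The estimate of \<open>x ^ p\<close> by \<open>x * (x + 1) ^ p\<close> fails
      for \<open>p = 0\<close> and \<open>x = 0\<close>, where the left side is 1.\<close>
    proof (cases "p = 0")
      case True
      then have "ext (Suc p) (int x) w S = w T" using \<open>2 ^ p \<le> S\<close> by (simp add: T_def)
      moreover have "\<bar>w T\<bar> \<le> M" using Suc.prems(1)[of T] T by simp
      moreover have "M \<le> int (Suc x) ^ Suc p * M" using mono True by simp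
      ultimately show ?thesis by linarith
    next
      case False
      have "int x ^ p \<le> int x * int (Suc x) ^ p"
      proof (cases "x = 0")
        case False
        have "int x ^ p \<le> 1 * int (Suc x) ^ p" by (simp add: power_mono)
        also have "\<dots> \<le> int x * int (Suc x) ^ p" using False by (intro mult_right_mono) auto
        finally show ?thesis .
      qed (use \<open>p \<noteq> 0\<close> in \<open>simp add: zero_power\<close>)
      then have "int x ^ p * M + int (Suc x) ^ p * M \<le> (int x * int (Suc x) ^ p) * M + int (Suc x) ^ p * M"
        using M by (intro add_right_mono mult_right_mono)
      also have "\<dots> = int (Suc x) ^ Suc p * M" by (simp add: algebra_simps)
      finally have "\<bar>int x ^ p * w T - ext p (int x) (\<lambda>i. w (i + 2 ^ p)) T\<bar> \<le> int (Suc x) ^ Suc p * M"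
        using a b by linarith
      then show ?thesis using True by (simp add: T_def)
    qed
  next
    case False
    then have "\<bar>ext p (int x) w S\<bar> \<le> int (Suc x) ^ p * M"
      by (intro Suc.IH) (use Suc.prems in auto)
    then have "\<bar>ext p (int x) w S\<bar> \<le> int (Suc x) ^ Suc p * M" using mono by (rule order_trans)
    then show ?thesis using False by simp
  qed
qed

text \<open>Each factor contributes at most \<open>n ^ p\<close>, as \<open>y + 1 \<le> n\<close>.
  For \<open>p\<close> factors this is the bound \<open>n ^ (p * p)\<close> that determines the
  number of levels.\<close>

lemma wedges_bound:
  assumes "\<forall>y\<in>set ys. y < n"
  shows "\<bar>wedges p ys unit_vec S\<bar> \<le> (int n ^ p) ^ length ys"
  using assms
proof (induction ys arbitrary: S rule: rev_induct)
  case Nil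
  then show ?case by (simp add: unit_vec_def)
next
  case (snoc y ys)
  show ?case
  proof (cases "S < 2 ^ p")
    case True
    have "\<bar>ext p (int y) (wedges p ys unit_vec) S\<bar> \<le> int (Suc y) ^ p * (int n ^ p) ^ length ys"
      by (rule ext_bound) (use snoc True in auto)
    also have "\<dots> \<le> int n ^ p * (int n ^ p) ^ length ys"
      using snoc.prems by (intro mult_right_mono power_mono) auto
    finally show ?thesis using True by (simp add: wedges_append wedges_Cons wedge_def)
  qed (simp add: wedges_append wedges_Cons wedge_cut)
qed

section \<open>Echelon bases over the 2-adic integers\<close>

text \<open>A basis \<open>B\<close> is indexed by a level \<open>e\<close> and a coordinate \<open>c\<close>: the row \<open>B e c\<close> is either
  empty, i.e. 0, or odd at \<open>c\<close> and even before \<open>c\<close>, and it stands for the vector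
  \<open>2 ^ e * B e c\<close>. Everything is meant modulo \<open>2 ^ k\<close>, so that levels stop at \<open>k\<close>.\<close>

type_synonym basis = "nat \<Rightarrow> nat \<Rightarrow> nat \<Rightarrow> int"

text \<open>Only parities matter, so a pivot row is always subtracted with coefficient 1. If all
  coordinates become even, the half of the vector is returned for the next level. If the vector is
  stored as a new row, it is returned unhalved, and so stands for its double at the next
  level.\<close>

fun scan :: "nat \<Rightarrow> nat \<Rightarrow> nat \<Rightarrow> (nat \<Rightarrow> int) \<Rightarrow> basis \<Rightarrow> (nat \<Rightarrow> int) \<times> basis" where
  "scan e 0 c v B = ((\<lambda>d. v d div 2), B)"
| "scan e (Suc r) c v B =
     (if odd (v c)
      then if odd (B e c c) then scan e r (Suc c) (\<lambda>d. v d - B e c d) B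
           else (v, B(e := (B e)(c := v)))
      else scan e r (Suc c) v B)"

text \<open>The work goes on after a row has been stored: its double is sifted into the higher
  levels, which keeps the basis saturated.\<close>

fun sift :: "nat \<Rightarrow> nat \<Rightarrow> nat \<Rightarrow> (nat \<Rightarrow> int) \<Rightarrow> basis \<Rightarrow> basis" where
  "sift N 0 e v B = B"
| "sift N (Suc r) e v B = sift N r (Suc e) (fst (scan e N 0 v B)) (snd (scan e N 0 v B))"

text \<open>\<open>lspan N B r e\<close> consists of the vectors \<open>v\<close> for which \<open>2 ^ e * v\<close> is a combination of the
  rows of levels \<open>e, \<dots>, e + r - 1\<close> modulo \<open>2 ^ (e + r)\<close>.\<close>

fun lspan :: "nat \<Rightarrow> basis \<Rightarrow> nat \<Rightarrow> nat \<Rightarrow> (nat \<Rightarrow> int) set" where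
  "lspan N B 0 e = UNIV"
| "lspan N B (Suc r) e =
     {v. \<exists>a u. u \<in> lspan N B r (Suc e) \<and> (\<forall>d<N. v d = (\<Sum>c<N. a c * B e c d) + 2 * u d)}"

lemma lspanI:
  assumes "u \<in> lspan N B r (Suc e)" "\<And>d. d < N \<Longrightarrow> v d = (\<Sum>c<N. a c * B e c d) + 2 * u d"
  shows "v \<in> lspan N B (Suc r) e"
  unfolding lspan.simps mem_Collect_eq using assms by blast

lemma lspan_cong: "v \<in> lspan N B r e \<Longrightarrow> (\<And>d. d < N \<Longrightarrow> w d = v d) \<Longrightarrow> w \<in> lspan N B r e"
  by (cases r) auto

lemma lspan_lin:
  "v \<in> lspan N B r e \<Longrightarrow> w \<in> lspan N B r e \<Longrightarrow> (\<lambda>d. x * v d + y * w d) \<in> lspan N B r e"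
proof (induction r arbitrary: e v w)
  case (Suc r)
  obtain a u where v: "u \<in> lspan N B r (Suc e)" "\<And>d. d < N \<Longrightarrow> v d = (\<Sum>c<N. a c * B e c d) + 2 * u d"
    using Suc.prems(1) by auto
  obtain a' u' where w: "u' \<in> lspan N B r (Suc e)" "\<And>d. d < N \<Longrightarrow> w d = (\<Sum>c<N. a' c * B e c d) + 2 * u' d"
    using Suc.prems(2) by auto
  have "x * v d + y * w d = (\<Sum>c<N. (x * a c + y * a' c) * B e c d) + 2 * (x * u d + y * u' d)"
    if "d < N" for d
    using v(2)[OF that] w(2)[OF that]
    by (simp add: algebra_simps sum.distrib sum_distrib_left)
  then show ?case by (rule lspanI[OF Suc.IH[OF v(1) w(1)]])
qed simp

lemma lspan_zero: "(\<lambda>d. 0) \<in> lspan N B r e"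
proof (induction r arbitrary: e)
  case (Suc r)
  show ?case by (rule lspanI[OF Suc, where a = "\<lambda>_. 0"]) simp
qed simp

lemma lspan_sum:
  "finite A \<Longrightarrow> (\<And>c. c \<in> A \<Longrightarrow> f c \<in> lspan N B r e) \<Longrightarrow> (\<lambda>d. \<Sum>c\<in>A. a c * f c d) \<in> lspan N B r e"
proof (induction rule: finite_induct)
  case (insert c A)
  then show ?case using lspan_lin[of "f c" N B r e "\<lambda>d. \<Sum>c\<in>A. a c * f c d" "a c" 1] by simp
qed (simp add: lspan_zero)

lemma lspan_double: "u \<in> lspan N B r (Suc e) \<Longrightarrow> (\<lambda>d. 2 * u d) \<in> lspan N B (Suc r) e"
  by (rule lspanI[where a = "\<lambda>_. 0"]) auto

definition extends :: "basis \<Rightarrow> basis \<Rightarrow> bool" where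
  "extends B B' \<longleftrightarrow> (\<forall>e c. B e c \<noteq> (\<lambda>_. 0) \<longrightarrow> B' e c = B e c)"

lemma extends_refl [simp]: "extends B B"
  by (simp add: extends_def)

lemma extends_trans:
  assumes "extends B B'" "extends B' B''"
  shows "extends B B''"
  unfolding extends_def
proof (intro allI impI)
  fix e c assume *: "B e c \<noteq> (\<lambda>_. 0)"
  then have "B' e c = B e c" using assms(1) unfolding extends_def by blast
  moreover from this * have "B'' e c = B' e c" using assms(2) unfolding extends_def by metis
  ultimately show "B'' e c = B e c" by (rule trans[rotated])
qed

text \<open>An old combination may have arbitrary coefficients at empty rows. They are set to 0
  before those rows are filled.\<close>

lemma lspan_mono: "extends B B' \<Longrightarrow> v \<in> lspan N B r e \<Longrightarrow> v \<in> lspan N B' r e"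
proof (induction r arbitrary: e v)
  case (Suc r)
  obtain a u where v: "u \<in> lspan N B r (Suc e)" "\<And>d. d < N \<Longrightarrow> v d = (\<Sum>c<N. a c * B e c d) + 2 * u d"
    using Suc.prems(2) by auto
  define a' where "a' = (\<lambda>c. if B e c = (\<lambda>_. 0) then 0 else a c)"
  have *: "a c * B e c d = a' c * B' e c d" for c d
  proof (cases "B e c = (\<lambda>_. 0)")
    case True
    then show ?thesis by (simp add: a'_def)
  next
    case False
    moreover from this have "B' e c = B e c" using Suc.prems(1) unfolding extends_def by blast
    ultimately show ?thesis by (simp add: a'_def)
  qed
  show ?case
    by (rule lspanI[OF Suc.IH[OF Suc.prems(1) v(1)], where a = a']) (simp only: v(2) *)
qed simp

definition echelon :: "basis \<Rightarrow> bool" where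
  "echelon B \<longleftrightarrow> (\<forall>e c. B e c = (\<lambda>_. 0) \<or> odd (B e c c) \<and> (\<forall>d<c. even (B e c d)))"

text \<open>Read with the scaling by levels, the double of each row of level \<open>f\<close> is a
  combination of rows of higher levels. Without this, an even vector in the span of a level could
  need that level and would not survive halving.\<close>

definition saturated :: "nat \<Rightarrow> nat \<Rightarrow> basis \<Rightarrow> nat \<Rightarrow> bool" where
  "saturated N k B e \<longleftrightarrow> (\<forall>f c. e \<le> f \<and> f < k \<and> c < N \<longrightarrow> B f c \<in> lspan N B (k - Suc f) (Suc f))"

lemma echelon_even: "echelon B \<Longrightarrow> d < c \<Longrightarrow> even (B e c d)"
  unfolding echelon_def by (drule spec[of _ e], drule spec[of _ c]) auto

lemma echelon_empty: "echelon B \<Longrightarrow> even (B e c c) \<Longrightarrow> B e c = (\<lambda>_. 0)"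
  unfolding echelon_def by blast

lemma echelon_upd:
  assumes "echelon B" "odd (v c)" "\<forall>d<c. even (v d)"
  shows "echelon (B(e := (B e)(c := v)))"
  unfolding echelon_def
proof (intro allI)
  fix f i
  have old: "B f i = (\<lambda>_. 0) \<or> odd (B f i i) \<and> (\<forall>d<i. even (B f i d))"
    using assms(1) unfolding echelon_def by blast
  show "(B(e := (B e)(c := v))) f i = (\<lambda>_. 0) \<or>
     odd ((B(e := (B e)(c := v))) f i i) \<and> (\<forall>d<i. even ((B(e := (B e)(c := v))) f i d))"
  proof (cases "f = e \<and> i = c")
    case True
    then show ?thesis using assms(2,3) by simp
  next
    case False
    then have "(B(e := (B e)(c := v))) f i = B f i" by auto
    then show ?thesis using old by (simp only:)
  qed
qed

text \<open>The alternatives are the two ways for a scan to end: a remainder \<open>2 * v'\<close>,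
  or a new row at an empty position \<open>c0\<close>.\<close>

lemma scan_correct:
  assumes "scan e r c v B = (v', B')" "c + r = N" "echelon B" "\<forall>d<c. even (v d)"
  shows "(B' = B \<and> (\<exists>a. \<forall>d<N. v d = (\<Sum>i<N. a i * B e i d) + 2 * v' d)) \<or>
    (\<exists>c0<N. B e c0 = (\<lambda>_. 0) \<and> odd (v' c0) \<and> (\<forall>d<c0. even (v' d)) \<and> B' = B(e := (B e)(c0 := v')) \<and>
       (\<exists>a. \<forall>d<N. v d = (\<Sum>i<N. a i * B e i d) + v' d))"
  using assms
proof (induction r arbitrary: c v)
  case 0
  then have "B' = B" "v' = (\<lambda>d. v d div 2)" "\<forall>d<N. even (v d)" by auto
  then show ?case by (intro disjI1 conjI exI[of _ "\<lambda>_. 0"]) auto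
next
  case (Suc r)
  consider "even (v c)" | "odd (v c)" "odd (B e c c)" | "odd (v c)" "even (B e c c)" by blast
  then show ?case
  proof cases
    case 1
    then have "\<forall>d<Suc c. even (v d)" using Suc.prems(4) by (simp add: less_Suc_eq)
    then show ?thesis by (intro Suc.IH) (use Suc.prems 1 in simp_all)
  next
    case 2
    have c: "c < N" using Suc.prems by simp
    have row: "\<forall>d<c. even (B e c d)" using echelon_even[OF Suc.prems(3)] by blast
    let ?v = "\<lambda>d. v d - B e c d"
    \<comment> \<open>Undoing the subtraction of row \<open>c\<close> raises its coefficient by
      one.\<close>
    have add: "v d = (\<Sum>i<N. (a i + (if i = c then 1 else 0)) * B e i d) + z"
      if "?v d = (\<Sum>i<N. a i * B e i d) + z" for a d z
    proof -
      have "(\<Sum>i<N. (a i + (if i = c then 1 else 0)) * B e i d) = (\<Sum>i<N. a i * B e i d + (if i = c then B e c d else 0))"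
        by (rule sum.cong) (auto simp: algebra_simps)
      then show ?thesis using that c by (simp add: sum.distrib)
    qed
    have "scan e r (Suc c) ?v B = (v', B')" using Suc.prems(1) 2 by simp
    from Suc.IH[OF this] have
      "(B' = B \<and> (\<exists>a. \<forall>d<N. ?v d = (\<Sum>i<N. a i * B e i d) + 2 * v' d)) \<or>
       (\<exists>c0<N. B e c0 = (\<lambda>_. 0) \<and> odd (v' c0) \<and> (\<forall>d<c0. even (v' d)) \<and> B' = B(e := (B e)(c0 := v')) \<and>
       (\<exists>a. \<forall>d<N. ?v d = (\<Sum>i<N. a i * B e i d) + v' d))"
      using Suc.prems(2-4) row 2 by (simp add: less_Suc_eq del: fun_upd_apply)
    then show ?thesis
    proof (elim disjE conjE exE)
      fix a assume "B' = B" "\<forall>d<N. ?v d = (\<Sum>i<N. a i * B e i d) + 2 * v' d"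
      then show ?thesis
        by (intro disjI1 conjI exI[of _ "\<lambda>i. a i + (if i = c then 1 else 0)"]) (auto intro!: add)
    next
      fix c0 a assume "c0 < N" "B e c0 = (\<lambda>_. 0)" "odd (v' c0)" "\<forall>d<c0. even (v' d)"
        "B' = B(e := (B e)(c0 := v'))" "\<forall>d<N. ?v d = (\<Sum>i<N. a i * B e i d) + v' d"
      then show ?thesis
        by (intro disjI2 exI[of _ c0] conjI exI[of _ "\<lambda>i. a i + (if i = c then 1 else 0)"])
          (auto intro!: add simp del: fun_upd_apply)
    qed
  next
    case 3
    have c: "c < N" using Suc.prems by simp
    have "B e c = (\<lambda>_. 0)" using echelon_empty[OF Suc.prems(3) 3(2)] .
    moreover have "v' = v" "B' = B(e := (B e)(c := v))" using Suc.prems(1) 3 by auto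
    moreover have "\<forall>d<N. v d = (\<Sum>i<N. 0 * B e i d) + v d" by simp
    ultimately show ?thesis using c 3(1) Suc.prems(4)
      by (intro disjI2 exI[of _ c] conjI exI[of _ "\<lambda>_. 0"]) (auto simp del: fun_upd_apply)
  qed
qed

lemma sift_correct:
  assumes "echelon B" "e + r = k" "saturated N k B e"
  shows "echelon (sift N r e v B) \<and> extends B (sift N r e v B) \<and> (\<forall>f<e. sift N r e v B f = B f) \<and>
    v \<in> lspan N (sift N r e v B) r e \<and> saturated N k (sift N r e v B) e"
  using assms
proof (induction r arbitrary: e v B)
  case (Suc r)
  obtain v' B1 where scan: "scan e N 0 v B = (v', B1)" by fastforce
  define B2 where "B2 = sift N r (Suc e) v' B1"
  have B2: "sift N (Suc r) e v B = B2" by (simp add: B2_def scan)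
  note cases = scan_correct[OF scan _ Suc.prems(1), of N, simplified]
  have ech1: "echelon B1"
    using cases Suc.prems(1) echelon_upd by auto
  have ext1: "extends B B1"
    using cases by (auto simp: extends_def)
  have other: "B1 f = B f" if "f \<noteq> e" for f using cases that by auto
  have "saturated N k B1 (Suc e)"
    using Suc.prems(3) lspan_mono[OF ext1] other unfolding saturated_def
    by (metis Suc_leD not_less_eq_eq order_refl)
  from Suc.IH[OF ech1 _ this, of v'] Suc.prems(2)
  have ech2: "echelon B2" and ext2: "extends B1 B2" and low: "\<And>f. f < Suc e \<Longrightarrow> B2 f = B1 f"
    and v': "v' \<in> lspan N B2 r (Suc e)" and sat2: "saturated N k B2 (Suc e)"
    by (auto simp: B2_def)
  have ext: "extends B B2" using extends_trans[OF ext1 ext2] .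
  have k: "k - Suc e = r" using Suc.prems(2) by simp
  \<comment> \<open>An old row is covered by the old saturation, and a new row is the vector
    \<open>v'\<close> that the next level has just absorbed.\<close>
  have rows: "B2 e c \<in> lspan N B2 r (Suc e)" if "c < N" for c
  proof -
    have "B e c \<in> lspan N B2 r (Suc e)"
      using Suc.prems(3) that lspan_mono[OF ext] k Suc.prems(2) by (auto simp: saturated_def)
    moreover have "B2 e c = B e c \<or> B2 e c = v'" using cases low[of e] by auto
    ultimately show ?thesis using v' by auto
  qed
  have sat: "saturated N k B2 e"
    using sat2 rows k unfolding saturated_def by (metis le_eq_less_or_eq Suc_leI)
  have "v \<in> lspan N B2 (Suc r) e"
    using cases
  proof (elim disjE conjE exE)
    fix a assume "B1 = B" "\<forall>d<N. v d = (\<Sum>i<N. a i * B e i d) + 2 * v' d"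
    then have "\<forall>d<N. v d = (\<Sum>i<N. a i * B2 e i d) + 2 * v' d" using low[of e] by simp
    then show ?thesis using v' by auto
  next
    fix c0 a assume c0: "c0 < N" "B e c0 = (\<lambda>_. 0)" "B1 = B(e := (B e)(c0 := v'))"
      and a: "\<forall>d<N. v d = (\<Sum>i<N. a i * B e i d) + v' d"
    \<comment> \<open>Row \<open>c0\<close> was empty, so its old coefficient had no effect and may
      be replaced by 1 for the new row.\<close>
    have "(\<Sum>i<N. (a(c0 := 1)) i * B2 e i d) = (\<Sum>i<N. a i * B e i d) + v' d" for d
    proof -
      have "(\<Sum>i<N. (a(c0 := 1)) i * B2 e i d) = (\<Sum>i<N. a i * B e i d + (if i = c0 then v' d else 0))"
        by (rule sum.cong) (use c0 low[of e] in auto)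
      then show ?thesis using c0(1) by (simp add: sum.distrib)
    qed
    then have "\<forall>d<N. v d = (\<Sum>i<N. (a(c0 := 1)) i * B2 e i d) + 2 * 0" using a by simp
    then show ?thesis using lspan_zero[of N B2 r "Suc e"] unfolding lspan.simps mem_Collect_eq
      by (intro exI[of _ "a(c0 := 1)"] exI[of _ "\<lambda>d. 0"]) blast
  qed
  then show ?case using ech2 ext sat low other unfolding B2 by auto
qed (simp add: saturated_def)

text \<open>Soundness of a scan for any property closed under differences, to be used with
  \<open>generated\<close>. It concerns exact integers, so halving is compensated by the scaling
  \<open>2 ^ Suc e\<close>; this needs all coordinates to be even, also those from \<open>N\<close>
  on, which are 0.\<close>

lemma scan_closed:
  assumes "\<And>u w. P u \<Longrightarrow> P w \<Longrightarrow> P (\<lambda>d. u d - w d :: int)"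
    and "\<And>f c. P (\<lambda>d. 2 ^ f * B f c d)" "P (\<lambda>d. 2 ^ e * v d)"
    and "\<And>f c d. N \<le> d \<Longrightarrow> B f c d = 0" "\<And>d. N \<le> d \<Longrightarrow> v d = 0" "\<forall>d<c. even (v d)" "c + r = N"
    and "echelon B"
  shows "P (\<lambda>d. 2 ^ Suc e * fst (scan e r c v B) d) \<and> (\<forall>f i. P (\<lambda>d. 2 ^ f * snd (scan e r c v B) f i d))
    \<and> (\<forall>d\<ge>N. fst (scan e r c v B) d = 0) \<and> (\<forall>f i. \<forall>d\<ge>N. snd (scan e r c v B) f i d = 0)"
  using assms(3-)
proof (induction r arbitrary: c v)
  case 0
  have "even (v d)" for d using 0 by (cases "d < N") auto
  then have "(\<lambda>d. 2 ^ Suc e * (v d div 2)) = (\<lambda>d. 2 ^ e * v d)" by (auto simp: fun_eq_iff)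
  then show ?case using 0 assms(2) by auto
next
  case (Suc r)
  consider "even (v c)" | "odd (v c)" "odd (B e c c)" | "odd (v c)" "even (B e c c)" by blast
  then show ?case
  proof cases
    case 1
    then show ?thesis using Suc.IH[of v "Suc c"] Suc.prems by (auto simp: less_Suc_eq)
  next
    case 2
    have row: "\<forall>d<c. even (B e c d)" using echelon_even[OF Suc.prems(6)] by blast
    have "P (\<lambda>d. 2 ^ e * (v d - B e c d))"
      using assms(1)[OF Suc.prems(1) assms(2)[of e c]] by (simp add: algebra_simps)
    then show ?thesis using 2 Suc.IH[of "\<lambda>d. v d - B e c d" "Suc c"] Suc.prems row
      by (auto simp: less_Suc_eq)
  next
    case 3
    \<comment> \<open>Doubling is expressed by differences alone: \<open>2 w = w - (0 - w)\<close>,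
      where 0 is itself a difference.\<close>
    have "P (\<lambda>d. 0 - 2 ^ e * v d)"
      using assms(1)[OF assms(1)[OF Suc.prems(1) Suc.prems(1)] Suc.prems(1)] by simp
    from assms(1)[OF Suc.prems(1) this] have "P (\<lambda>d. 2 ^ Suc e * v d)" by (simp add: algebra_simps)
    then show ?thesis using 3 Suc.prems assms(2) by auto
  qed
qed

lemma sift_closed:
  assumes "\<And>u w. P u \<Longrightarrow> P w \<Longrightarrow> P (\<lambda>d. u d - w d :: int)"
    and "\<And>f c. P (\<lambda>d. 2 ^ f * B f c d)" "P (\<lambda>d. 2 ^ e * v d)"
    and "\<And>f c d. N \<le> d \<Longrightarrow> B f c d = 0" "\<And>d. N \<le> d \<Longrightarrow> v d = 0" "echelon B"
  shows "(\<forall>f i. P (\<lambda>d. 2 ^ f * sift N r e v B f i d)) \<and> (\<forall>f i. \<forall>d\<ge>N. sift N r e v B f i d = 0)"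
  using assms(2-)
proof (induction r arbitrary: e v B)
  case (Suc r)
  obtain v' B1 where scan: "scan e N 0 v B = (v', B1)" by fastforce
  have ech: "echelon B1"
    using scan_correct[OF scan _ Suc.prems(5), of N] Suc.prems(5) echelon_upd by auto
  have "\<forall>d<0. even (v d)" by simp
  note closed = scan_closed[where P = P and B = B and e = e and v = v and N = N and c = 0 and r = N, OF assms(1) Suc.prems(1,2,3,4) this add_0 Suc.prems(5), unfolded scan fst_conv snd_conv]
  have rows: "P (\<lambda>d. 2 ^ f * B1 f i d)" for f i
    by (rule closed[THEN conjunct2, THEN conjunct1, THEN spec, THEN spec])
  have cut: "B1 f i d = 0" if "N \<le> d" for f i d
    using closed[THEN conjunct2, THEN conjunct2, THEN conjunct2] that by blast
  have cut': "v' d = 0" if "N \<le> d" for d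
    using closed[THEN conjunct2, THEN conjunct2, THEN conjunct1] that by blast
  show ?case unfolding sift.simps scan fst_conv snd_conv
    by (rule Suc.IH[OF rows closed[THEN conjunct1] cut cut' ech])
qed simp

text \<open>Reading the coordinates in increasing order modulo 2 shows that the coefficient of a row
  before the first odd coordinate is even.\<close>

lemma combination_parity:
  assumes "echelon B" "\<And>d. d < N \<Longrightarrow> v d = (\<Sum>i<N. a i * B e i d) + 2 * u d"
    and "c < N" "\<forall>d<c. even (v d)"
  shows "(even (v c) \<longleftrightarrow> even (a c * B e c c)) \<and> (\<forall>i<c. even (a i) \<or> B e i = (\<lambda>_. 0))"
  using assms(3,4)
proof (induction c rule: less_induct)
  case (less c)
  have before: "even (a i) \<or> B e i = (\<lambda>_. 0)" if "i < c" for i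
  proof (cases "B e i = (\<lambda>_. 0)")
    case False
    then have "odd (B e i i)" using assms(1) by (auto simp: echelon_def)
    moreover have "even (a i * B e i i)" using less.IH[OF that] less.prems that by auto
    ultimately show ?thesis by simp
  qed simp
  have "even (\<Sum>i\<in>{..<N} - {c}. a i * B e i c)"
  proof (rule dvd_sum)
    fix i assume i: "i \<in> {..<N} - {c}"
    show "even (a i * B e i c)"
    proof (cases "i < c")
      case True
      then show ?thesis using before[OF True] by auto
    next
      case False
      then have "even (B e i c)" using i echelon_even[OF assms(1), of c i] by auto
      then show ?thesis by simp
    qed
  qed
  moreover have "v c = a c * B e c c + (\<Sum>i\<in>{..<N} - {c}. a i * B e i c) + 2 * u c"
    using assms(2)[OF less.prems(1)] sum.remove[of "{..<N}" c "\<lambda>i. a i * B e i c"] less.prems(1) by simp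
  ultimately show ?case using before by simp
qed

text \<open>At the first odd coordinate the parity comes from the row with that pivot alone, so the
  row cannot be empty.\<close>

lemma lspan_pivot:
  assumes "echelon B" "v \<in> lspan N B (Suc r) e" "c < N" "\<forall>d<c. even (v d)" "odd (v c)"
  shows "odd (B e c c)"
proof -
  obtain a u where "\<And>d. d < N \<Longrightarrow> v d = (\<Sum>i<N. a i * B e i d) + 2 * u d" using assms(2) by auto
  from combination_parity[OF assms(1) this assms(3,4)] assms(5) show ?thesis by auto
qed

text \<open>For an even vector all coefficients of nonempty rows are even. Halving them leaves a
  combination of rows of level \<open>e\<close>, and saturation moves these rows into the span of
  level \<open>Suc e\<close>.\<close>

lemma lspan_half:
  assumes "echelon B" "v \<in> lspan N B (Suc r) e" "\<forall>d<N. even (v d)"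
    and rows: "\<And>c. c < N \<Longrightarrow> B e c \<in> lspan N B r (Suc e)"
  shows "(\<lambda>d. v d div 2) \<in> lspan N B r (Suc e)"
proof -
  obtain a u where u: "u \<in> lspan N B r (Suc e)" and v: "\<And>d. d < N \<Longrightarrow> v d = (\<Sum>i<N. a i * B e i d) + 2 * u d"
    using assms(2) by auto
  have "even (a c) \<or> B e c = (\<lambda>_. 0)" if "c < N" for c
  proof (cases "B e c = (\<lambda>_. 0)")
    case False
    then have "odd (B e c c)" using assms(1) by (auto simp: echelon_def)
    then show ?thesis using combination_parity[OF assms(1) v that] assms(3) that by auto
  qed simp
  then have *: "a c * B e c d = 2 * ((a c div 2) * B e c d)" if "c < N" for c d
    using that by fastforce
  have "(\<Sum>c<N. a c * B e c d) = 2 * (\<Sum>c<N. (a c div 2) * B e c d)" for d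
    unfolding sum_distrib_left by (rule sum.cong) (use * in auto)
  then have "v d = 2 * (\<Sum>c<N. (a c div 2) * B e c d) + 2 * u d" if "d < N" for d
    using v[OF that] by simp
  then have "v d div 2 = 1 * (\<Sum>c<N. (a c div 2) * B e c d) + 1 * u d" if "d < N" for d
    using that by simp
  moreover have "(\<lambda>d. \<Sum>c<N. (a c div 2) * B e c d) \<in> lspan N B r (Suc e)"
    by (rule lspan_sum) (use rows in auto)
  ultimately show ?thesis using lspan_cong[OF lspan_lin[OF _ u, of _ 1 1]] by simp
qed

text \<open>An even entry is halved and the vector moves one level up, which halves the size bound
  too. A nonzero entry below \<open>2 ^ r\<close> becomes odd before the \<open>r\<close> levels are
  exhausted, and then it shows a pivot.\<close>

lemma lspan_top_slot:
  assumes "echelon B" "saturated N k B 0" "w \<in> lspan N B r e" "e + r = k" "0 < N"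
    and "\<And>d. d < N - 1 \<Longrightarrow> w d = 0" "w (N - 1) \<noteq> 0" "\<bar>w (N - 1)\<bar> < 2 ^ r"
  shows "\<exists>e<k. odd (B e (N - 1) (N - 1))"
  using assms(3-)
proof (induction r arbitrary: e w)
  case (Suc r)
  show ?case
  proof (cases "even (w (N - 1))")
    case False
    then have "odd (B e (N - 1) (N - 1))"
      by (intro lspan_pivot[OF assms(1) Suc.prems(1)]) (use Suc.prems in auto)
    then show ?thesis using Suc.prems(2) by (intro exI[of _ e]) auto
  next
    case True
    have even: "even (w d)" if "d < N" for d
      using that Suc.prems(4)[of d] True by (cases "d = N - 1") auto
    have "B e c \<in> lspan N B r (Suc e)" if "c < N" for c
    proof -
      have "k - Suc e = r" "e < k" using Suc.prems(2) by auto
      then show ?thesis using assms(2) that unfolding saturated_def by fastforce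
    qed
    then have "(\<lambda>d. w d div 2) \<in> lspan N B r (Suc e)"
      by (intro lspan_half[OF assms(1) Suc.prems(1)]) (use even in auto)
    then show ?thesis
      by (rule Suc.IH) (use Suc.prems True in auto)
  qed
qed simp

section \<open>Covering by few sets\<close>

text \<open>The binary digits of \<open>m\<close> select a sublist, the lowest digit deciding about
  the head; so all sublists are run through by a counter.\<close>

fun sel :: "nat \<Rightarrow> 'a list \<Rightarrow> 'a list" where
  "sel m [] = []"
| "sel m (y # ys) = (if odd m then y # sel (m div 2) ys else sel (m div 2) ys)"

lemma set_sel: "set (sel m ys) \<subseteq> set ys"
proof (induction ys arbitrary: m)
  case (Cons y ys)
  then show ?case using Cons[of "m div 2"] by auto
qed simp

lemma filter_is_sel: "\<exists>m<2 ^ length ys. sel m ys = filter P ys"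
proof (induction ys)
  case (Cons y ys)
  then obtain m where "m < 2 ^ length ys" "sel m ys = filter P ys" by auto
  then show ?case by (intro exI[of _ "2 * m + (if P y then 1 else 0)"]) auto
qed simp

lemma wedges_sum:
  "finite A \<Longrightarrow> wedges p ys (\<lambda>d. \<Sum>c\<in>A. a c * f c d) = (\<lambda>d. \<Sum>c\<in>A. a c * wedges p ys (f c) d)"
proof (induction rule: finite_induct)
  case (insert c A)
  then show ?case using wedges_lin[of p ys "a c" "f c" 1 "\<lambda>d. \<Sum>c\<in>A. a c * f c d"] by simp
qed (simp add: wedges_zero)

lemma wedges_cong:
  "(\<And>i. i < 2 ^ p \<Longrightarrow> w i = w' i) \<Longrightarrow> S < 2 ^ p \<Longrightarrow> wedges p ys w S = wedges p ys w' S"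
proof (cases ys)
  case (Cons y zs)
  assume "\<And>i. i < 2 ^ p \<Longrightarrow> w i = w' i"
  then have "wedge p (int y) w = wedge p (int y) w'" by (rule wedge_cong)
  then show ?thesis by (simp add: Cons wedges_Cons)
qed simp

text \<open>Multiplication is linear and commutes with the doubling between levels, so it suffices
  to know the products of the rows.\<close>

lemma lspan_wedges:
  assumes "\<And>f c. f < k \<Longrightarrow> c < 2 ^ p \<Longrightarrow> wedges p ys (B f c) \<in> lspan (2 ^ p) B' (k - f) f"
  shows "w \<in> lspan (2 ^ p) B r e \<Longrightarrow> e + r = k \<Longrightarrow> wedges p ys w \<in> lspan (2 ^ p) B' r e"
proof (induction r arbitrary: e w)
  case (Suc r)
  obtain a u where u: "u \<in> lspan (2 ^ p) B r (Suc e)"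
    and w: "\<And>d. d < 2 ^ p \<Longrightarrow> w d = (\<Sum>c<2 ^ p. a c * B e c d) + 2 * u d"
    using Suc.prems(1) by auto
  have "(\<lambda>d. \<Sum>c<2 ^ p. a c * wedges p ys (B e c) d) \<in> lspan (2 ^ p) B' (Suc r) e"
  proof (rule lspan_sum)
    fix c :: nat assume "c \<in> {..<2 ^ p}"
    then show "wedges p ys (B e c) \<in> lspan (2 ^ p) B' (Suc r) e"
      using assms[of e c] Suc.prems(2) by (simp del: lspan.simps) (metis add_Suc_right diff_add_inverse)
  qed simp
  from lspan_lin[OF this lspan_double[OF Suc.IH[OF u]], of 1 1] Suc.prems(2)
  have "(\<lambda>d. (\<Sum>c<2 ^ p. a c * wedges p ys (B e c) d) + 2 * wedges p ys u d) \<in> lspan (2 ^ p) B' (Suc r) e"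
    by (simp del: lspan.simps)
  then show ?case
  proof (rule lspan_cong)
    fix d :: nat assume d: "d < 2 ^ p"
    have "wedges p ys w d = wedges p ys (\<lambda>d. 1 * (\<Sum>c<2 ^ p. a c * B e c d) + 2 * u d) d"
      by (rule wedges_cong) (use w d in auto)
    then show "wedges p ys w d = (\<Sum>c<2 ^ p. a c * wedges p ys (B e c) d) + 2 * wedges p ys u d"
      by (simp only: wedges_lin wedges_sum finite_lessThan)
  qed
qed simp

text \<open>The exact lattice of products from unions of \<open>i\<close> sets, as a subgroup closed
  under differences. The rule \<open>zero\<close> keeps it nonempty when \<open>n = 0\<close> and
  \<open>i > 0\<close>, where no list \<open>vs\<close> exists.\<close>

inductive generated :: "nat \<Rightarrow> (nat \<Rightarrow> nat set) \<Rightarrow> nat \<Rightarrow> nat \<Rightarrow> (nat \<Rightarrow> int) \<Rightarrow> bool"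
  for p U n i where
  gen: "length vs = i \<Longrightarrow> set vs \<subseteq> {..<n} \<Longrightarrow> set ys \<subseteq> \<Union> (U ` set vs) \<Longrightarrow> generated p U n i (wedges p ys unit_vec)"
| zero: "generated p U n i (\<lambda>d. 0)"
| diff: "generated p U n i w \<Longrightarrow> generated p U n i w' \<Longrightarrow> generated p U n i (\<lambda>d. w d - w' d)"

lemma generated_wedges:
  assumes "generated p U n i w" "v < n" "set zs \<subseteq> U v"
  shows "generated p U n (Suc i) (wedges p zs w)"
  using assms(1)
proof induction
  case (gen vs ys)
  have "set (ys @ zs) \<subseteq> \<Union> (U ` set (v # vs))" using gen assms by auto
  then have "generated p U n (Suc i) (wedges p (ys @ zs) unit_vec)"
    by (intro generated.gen[of "v # vs"]) (use gen assms in auto)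
  then show ?case by (simp add: wedges_append)
next
  case zero
  show ?case unfolding wedges_zero by (rule generated.zero)
next
  case (diff w w')
  have "wedges p zs (\<lambda>d. 1 * w d + (-1) * w' d) = (\<lambda>d. 1 * wedges p zs w d + (-1) * wedges p zs w' d)"
    by (rule wedges_lin)
  then show ?case using generated.diff[OF diff(3,4)] by simp
qed

lemma generated_scale:
  assumes "generated p U n i w"
  shows "generated p U n i (\<lambda>d. 2 ^ e * w d)"
proof (induction e)
  case (Suc e)
  have "generated p U n i (\<lambda>d. 2 ^ e * w d - (2 ^ e * w d - 2 ^ e * w d - 2 ^ e * w d))"
    by (intro generated.diff Suc)
  then show ?case by (simp add: algebra_simps)
qed (simp add: assms)

text \<open>If all unions of \<open>i\<close> sets were smaller than \<open>p\<close>, the top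
  coordinate would vanish on the generators and hence on the whole lattice.\<close>

lemma generated_top:
  assumes "generated p U n i w" "w (2 ^ p - 1) \<noteq> 0" "\<And>v. v < n \<Longrightarrow> finite (U v)"
  shows "\<exists>vs. length vs = i \<and> set vs \<subseteq> {..<n} \<and> p \<le> card (\<Union> (U ` set vs))"
proof (rule ccontr)
  assume none: "\<not> ?thesis"
  have "w (2 ^ p - 1) = 0"
    using assms(1)
  proof induction
    case (gen vs ys)
    have "finite (\<Union> (U ` set vs))" using gen(2) assms(3) by auto
    then have "card (set ys) \<le> card (\<Union> (U ` set vs))" using gen(3) by (intro card_mono)
    also have "\<dots> < p" using none gen by (auto simp: not_le)
    finally show ?case by (rule wedges_top_zero)
  qed simp_all
  then show False using assms(2) by simp
qed

text \<open>Each element of \<open>Z\<close> is taken from the first set in the list that contains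
  it. The selected pieces are then disjoint, which makes the concatenation distinct.\<close>

lemma covered_list:
  assumes "\<And>v. v \<in> set vs \<Longrightarrow> distinct (Q v)" "Z \<subseteq> \<Union> ((\<lambda>v. set (Q v)) ` set vs)"
  shows "\<exists>ms. length ms = length vs \<and> (\<forall>i<length vs. ms ! i < 2 ^ length (Q (vs ! i))) \<and>
    distinct (concat (map2 (\<lambda>m v. sel m (Q v)) ms vs)) \<and> set (concat (map2 (\<lambda>m v. sel m (Q v)) ms vs)) = Z"
  using assms
proof (induction vs arbitrary: Z)
  case Nil
  then show ?case by (intro exI[of _ "[]"]) auto
next
  case (Cons v vs)
  have sub: "Z - set (Q v) \<subseteq> \<Union> ((\<lambda>v. set (Q v)) ` set vs)" using Cons.prems(2) by auto
  obtain ms where ms: "length ms = length vs" "\<forall>i<length vs. ms ! i < 2 ^ length (Q (vs ! i))"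
    "distinct (concat (map2 (\<lambda>m v. sel m (Q v)) ms vs))"
    "set (concat (map2 (\<lambda>m v. sel m (Q v)) ms vs)) = Z - set (Q v)"
    using Cons.IH[OF _ sub] Cons.prems(1) by (meson list.set_intros(2))
  obtain m where m: "m < 2 ^ length (Q v)" "sel m (Q v) = filter (\<lambda>y. y \<in> Z) (Q v)"
    using filter_is_sel[of "Q v" "\<lambda>y. y \<in> Z"] by blast
  have "\<forall>i<length (v # vs). (m # ms) ! i < 2 ^ length (Q ((v # vs) ! i))"
    using ms(2) m(1) by (auto simp: nth_Cons split: nat.split)
  moreover have "distinct (concat (map2 (\<lambda>m v. sel m (Q v)) (m # ms) (v # vs)))"
    using ms(3,4) m(2) Cons.prems(1)[of v] by auto
  moreover have "set (concat (map2 (\<lambda>m v. sel m (Q v)) (m # ms) (v # vs))) = Z"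
    using ms(4) m(2) by auto
  ultimately show ?case using ms(1) by (intro exI[of _ "m # ms"]) auto
qed

text \<open>The enumeration \<open>Q i v\<close> may depend on the round \<open>i\<close>, since
  each round searches anew and only the set found is known to be the same. Pairing the sets with
  \<open>[i..<R]\<close> records the round.\<close>

lemma lspan_chain:
  assumes full: "\<And>i v m e c. i < R \<Longrightarrow> v < n \<Longrightarrow> m < 2 ^ p \<Longrightarrow> e < k \<Longrightarrow> c < 2 ^ p \<Longrightarrow>
      wedges p (sel m (Q i v)) (B i e c) \<in> lspan (2 ^ p) (B (Suc i)) (k - e) e"
  shows "length ms = length vs \<Longrightarrow> set vs \<subseteq> {..<n} \<Longrightarrow> (\<And>j. j < length vs \<Longrightarrow> ms ! j < 2 ^ p) \<Longrightarrow>
    i + length vs = R \<Longrightarrow> w \<in> lspan (2 ^ p) (B i) k 0 \<Longrightarrow>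
    wedges p (concat (map2 (\<lambda>m x. sel m (Q (fst x) (snd x))) ms (zip [i..<R] vs))) w \<in> lspan (2 ^ p) (B R) k 0"
proof (induction ms vs arbitrary: i w rule: list_induct2)
  case (Cons m ms v vs)
  have "wedges p (sel m (Q i v)) w \<in> lspan (2 ^ p) (B (Suc i)) k 0"
    by (rule lspan_wedges[of k p _ "B i"])
       (use Cons.prems(1,3,4) Cons.prems(2)[of 0] in \<open>auto intro!: full\<close>)
  then have "wedges p (concat (map2 (\<lambda>m x. sel m (Q (fst x) (snd x))) ms (zip [Suc i..<R] vs)))
      (wedges p (sel m (Q i v)) w) \<in> lspan (2 ^ p) (B R) k 0"
    by (intro Cons.IH[of "Suc i"]) (use Cons.prems Cons.prems(2)[of "Suc _"] in auto)
  moreover have "[i..<R] = i # [Suc i..<R]" using Cons.prems(3) by (simp add: upt_conv_Cons)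
  ultimately show ?case by (simp add: wedges_append)
qed simp

text \<open>Completeness: from a cover, exactly \<open>p\<close> vertices are chosen and their
  product is followed through the rounds. It is concentrated in the top coordinate, nonzero there,
  and too small to be 0 modulo \<open>2 ^ k\<close>.\<close>

lemma cover_found:
  assumes full: "\<And>i v m e c. i < R \<Longrightarrow> v < n \<Longrightarrow> m < 2 ^ p \<Longrightarrow> e < k \<Longrightarrow> c < 2 ^ p \<Longrightarrow>
      wedges p (sel m (Q i v)) (B i e c) \<in> lspan (2 ^ p) (B (Suc i)) (k - e) e"
    and start: "unit_vec \<in> lspan (2 ^ p) (B 0) k 0"
    and B: "echelon (B R)" "saturated (2 ^ p) k (B R) 0"
    and Q: "\<And>i v. i < R \<Longrightarrow> v < n \<Longrightarrow> distinct (Q i v) \<and> length (Q i v) \<le> p \<and> set (Q i v) = U v"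
    and U: "\<And>v. v < n \<Longrightarrow> U v \<subseteq> {..<n}"
    and vs: "length vs = R" "set vs \<subseteq> {..<n}" "p \<le> card (\<Union> (U ` set vs))"
    and k: "int n ^ (p * p) < 2 ^ k"
  shows "\<exists>e<k. odd (B R e (2 ^ p - 1) (2 ^ p - 1))"
proof -
  define ws where "ws = zip [0..<R] vs"
  define Q' where "Q' = (\<lambda>x. Q (fst x) (snd x))"
  have ws: "length ws = R" "\<And>x. x \<in> set ws \<Longrightarrow> fst x < R \<and> snd x < n"
    using vs(1,2) by (auto simp: ws_def dest: set_zip_leftD set_zip_rightD)
  obtain Z where Z: "Z \<subseteq> \<Union> (U ` set vs)" "card Z = p"
    using obtain_subset_with_card_n[OF vs(3)] by blast
  have "snd ` set ws = set vs"
    unfolding ws_def set_map[symmetric] using vs(1) by simp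
  moreover have "(\<lambda>x. set (Q' x)) ` set ws = (\<lambda>x. U (snd x)) ` set ws"
    by (rule image_cong) (use Q ws(2) in \<open>auto simp: Q'_def\<close>)
  ultimately have "\<Union> (U ` set vs) = \<Union> ((\<lambda>x. set (Q' x)) ` set ws)"
    by (simp only: image_image[symmetric, of U snd])
  then have "Z \<subseteq> \<Union> ((\<lambda>x. set (Q' x)) ` set ws)" using Z(1) by simp
  moreover have "distinct (Q' x)" if "x \<in> set ws" for x using Q ws(2)[OF that] by (simp add: Q'_def)
  ultimately obtain ms where ms: "length ms = length ws" "\<forall>i<length ws. ms ! i < 2 ^ length (Q' (ws ! i))"
    "distinct (concat (map2 (\<lambda>m x. sel m (Q' x)) ms ws))"
    "set (concat (map2 (\<lambda>m x. sel m (Q' x)) ms ws)) = Z"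
    using covered_list[of ws Q' Z] by blast
  define ys where "ys = concat (map2 (\<lambda>m x. sel m (Q' x)) ms ws)"
  have ys: "distinct ys" "set ys = Z" "length ys = p"
    using ms(3,4) Z(2) distinct_card[of ys] by (auto simp: ys_def)
  let ?w = "wedges p ys unit_vec"
  have small: "ms ! j < 2 ^ p" if "j < length vs" for j
  proof -
    have j: "j < length ws" using that vs(1) ws(1) by simp
    have "length (Q' (ws ! j)) \<le> p" using Q ws(2)[OF nth_mem[OF j]] by (simp add: Q'_def)
    then have "(2::nat) ^ length (Q' (ws ! j)) \<le> 2 ^ p" by (intro power_increasing) auto
    then show ?thesis using ms(2) j order_less_le_trans by blast
  qed
  note chain = lspan_chain[of R n p k Q B ms vs 0 unit_vec]
  have w: "?w \<in> lspan (2 ^ p) (B R) k 0"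
    unfolding ys_def Q'_def ws_def by (rule chain) (use full ms(1) ws(1) vs start small in auto)
  have zero: "?w d = 0" if "d < 2 ^ p - 1" for d
  proof (rule ccontr)
    assume "?w d \<noteq> 0"
    moreover have "d < 2 ^ p" using that by linarith
    ultimately show False using that weight_eq_top[of d p] wedges_weight[of d p ys] ys by simp
  qed
  have "\<Union> (U ` set vs) \<subseteq> {..<n}"
  proof (rule UN_least)
    fix v assume "v \<in> set vs"
    then show "U v \<subseteq> {..<n}" using U[of v] vs(2) by auto
  qed
  with Z(1) have "set ys \<subseteq> {..<n}" unfolding ys(2) by (rule order_trans)
  then have "\<forall>y\<in>set ys. y < n" by blast
  from wedges_bound[OF this, of p "2 ^ p - 1"] have "\<bar>?w (2 ^ p - 1)\<bar> < 2 ^ k"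
    using k ys(3) by (simp add: power_mult)
  then show ?thesis
    by (intro lspan_top_slot[OF B w]) (use zero wedges_top_nonzero[OF ys(1,3)] in auto)
qed

section \<open>Anchored 1-cores\<close>

definition supported :: "nat \<Rightarrow> (nat \<Rightarrow> nat \<Rightarrow> bool) \<Rightarrow> nat set \<Rightarrow> bool" where
  "supported n E C \<longleftrightarrow> C \<subseteq> {..<n} \<and> (\<forall>v\<in>C. \<exists>u\<in>C. E u v)"

text \<open>Supported sets are closed under unions, so this is the largest one.\<close>

definition one_core :: "nat \<Rightarrow> (nat \<Rightarrow> nat \<Rightarrow> bool) \<Rightarrow> nat set" where
  "one_core n E = \<Union> {C. supported n E C}"

definition reached :: "nat \<Rightarrow> (nat \<Rightarrow> nat \<Rightarrow> bool) \<Rightarrow> nat \<Rightarrow> nat set" where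
  "reached n E v = {w. (v, w) \<in> {(u, w). u < n \<and> w < n \<and> E u w}\<^sup>*}"

definition covered :: "nat \<Rightarrow> (nat \<Rightarrow> nat \<Rightarrow> bool) \<Rightarrow> nat \<Rightarrow> nat set" where
  "covered n E v = one_core n E \<union> reached n E v"

definition indexed_core :: "nat \<Rightarrow> (nat \<Rightarrow> nat \<Rightarrow> bool) \<Rightarrow> int \<Rightarrow> int \<Rightarrow> bool" where
  "indexed_core n E b p \<longleftrightarrow> (\<exists>A H. A \<subseteq> H \<and> H \<subseteq> {..<n} \<and> int (card A) \<le> b \<and> p \<le> int (card H) \<and>
     (\<forall>v\<in>H - A. \<exists>u\<in>H. E u v))"

lemma supported_one_core: "supported n E (one_core n E)"
  unfolding one_core_def supported_def by blast

lemma one_core_greatest: "supported n E C \<Longrightarrow> C \<subseteq> one_core n E"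
  unfolding one_core_def by blast

lemma one_core_subset: "one_core n E \<subseteq> {..<n}"
  using supported_one_core unfolding supported_def by blast

lemma reached_refl: "v \<in> reached n E v"
  by (simp add: reached_def)

lemma reached_step: "u \<in> reached n E v \<Longrightarrow> u < n \<Longrightarrow> w < n \<Longrightarrow> E u w \<Longrightarrow> w \<in> reached n E v"
  unfolding reached_def by (auto intro: rtrancl_into_rtrancl)

lemma reached_pred:
  assumes "w \<in> reached n E v" "w \<noteq> v"
  shows "\<exists>u\<in>reached n E v. E u w"
proof -
  have "(v, w) \<in> {(u, w). u < n \<and> w < n \<and> E u w}\<^sup>*" using assms by (simp add: reached_def)
  then obtain u where "(v, u) \<in> {(u, w). u < n \<and> w < n \<and> E u w}\<^sup>*" "E u w"
    using assms(2) by (cases rule: rtranclE) auto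
  then show ?thesis by (auto simp: reached_def)
qed

lemma reached_subset: "v < n \<Longrightarrow> reached n E v \<subseteq> {..<n}"
proof
  fix w assume "v < n" "w \<in> reached n E v"
  then have "(v, w) \<in> {(u, w). u < n \<and> w < n \<and> E u w}\<^sup>*" by (simp add: reached_def)
  then show "w \<in> {..<n}" by (cases rule: rtranclE) (use \<open>v < n\<close> in auto)
qed

lemma reached_least:
  assumes "v \<in> S" "\<And>u w. u \<in> S \<Longrightarrow> u < n \<Longrightarrow> w < n \<Longrightarrow> E u w \<Longrightarrow> w \<in> S"
  shows "reached n E v \<subseteq> S"
proof
  fix w assume "w \<in> reached n E v"
  then have "(v, w) \<in> {(u, w). u < n \<and> w < n \<and> E u w}\<^sup>*" by (simp add: reached_def)
  then show "w \<in> S" by (induction rule: rtrancl_induct) (use assms in auto)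
qed

text \<open>Adding an out-neighbour to a supported set leaves it supported. Hence expanding core
  vertices in a search never leads out of \<open>covered\<close>.\<close>

lemma one_core_step:
  assumes "u \<in> one_core n E" "w < n" "E u w"
  shows "w \<in> one_core n E"
proof -
  have "supported n E (insert w (one_core n E))"
    using supported_one_core[of n E] assms unfolding supported_def by blast
  then show ?thesis using one_core_greatest by blast
qed

lemma covered_subset: "v < n \<Longrightarrow> covered n E v \<subseteq> {..<n}"
  using one_core_subset reached_subset unfolding covered_def by blast

text \<open>A vertex of \<open>H\<close> that is not reached from the anchors has an in-neighbour in \<open>H\<close> with the
  same property, so all these vertices belong to the 1-core.\<close>

lemma anchored_subset:
  assumes "A \<subseteq> H" "H \<subseteq> {..<n}" "\<forall>v\<in>H - A. \<exists>u\<in>H. E u v"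
  shows "H \<subseteq> one_core n E \<union> (\<Union>a\<in>A. reached n E a)"
proof -
  let ?D = "H - (\<Union>a\<in>A. reached n E a)"
  have "\<exists>u\<in>?D. E u v" if v: "v \<in> ?D" for v
  proof -
    have "v \<notin> A" using v reached_refl by blast
    then obtain u where u: "u \<in> H" "E u v" using v assms(3) by blast
    have "u < n" "v < n" using u v assms(2) by auto
    then have "u \<notin> (\<Union>a\<in>A. reached n E a)" using reached_step[of u n E _ v] u(2) v by blast
    then show ?thesis using u by blast
  qed
  then have "supported n E ?D" using assms(2) unfolding supported_def by blast
  then show ?thesis using one_core_greatest by blast
qed

text \<open>One anchor for each of \<open>q\<close> covered vertices is enough, so no more than
  \<open>q\<close> sets are ever required; this is why \<open>p\<close> rounds suffice for any
  \<open>b\<close>.\<close>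

lemma covering_list:
  assumes "A \<subseteq> {..<n}" "finite A" "A \<noteq> {}" "card A \<le> b" "0 < q" "q \<le> card (\<Union> (U ` A))"
    and fin: "\<And>v. v < n \<Longrightarrow> finite (U v)"
  shows "\<exists>vs. length vs = min b q \<and> set vs \<subseteq> {..<n} \<and> q \<le> card (\<Union> (U ` set vs))"
proof -
  obtain Z where Z: "Z \<subseteq> \<Union> (U ` A)" "card Z = q" "finite Z"
    using obtain_subset_with_card_n[OF assms(6)] by blast
  then have "\<forall>z\<in>Z. \<exists>a\<in>A. z \<in> U a" by blast
  then obtain h where h: "\<And>z. z \<in> Z \<Longrightarrow> h z \<in> A \<and> z \<in> U (h z)" by metis
  have sub: "h ` Z \<subseteq> A" using h by blast
  have "card (h ` Z) \<le> q" using card_image_le[OF Z(3), of h] Z(2) by simp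
  moreover have "card (h ` Z) \<le> b" using card_mono[OF assms(2) sub] assms(4) by simp
  ultimately have small: "card (h ` Z) \<le> min b q" by simp
  obtain ws where ws: "set ws = h ` Z" "distinct ws"
    using finite_distinct_list[of "h ` Z"] Z(3) by auto
  have len: "length ws = card (h ` Z)" using ws distinct_card[of ws] by simp
  have "Z \<noteq> {}" using Z(2) assms(5) by auto
  then have ne: "ws \<noteq> []" using ws(1) by auto
  \<comment> \<open>The list is padded with repetitions, since the number of rounds is prescribed
    exactly.\<close>
  define vs where "vs = ws @ replicate (min b q - length ws) (hd ws)"
  have set: "set vs = h ` Z" using ws(1) ne hd_in_set[OF ne] by (auto simp: vs_def)
  have "set vs \<subseteq> {..<n}" using set sub assms(1) by blast
  moreover have "finite (\<Union> (U ` set vs))" using calculation fin by auto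
  moreover have "Z \<subseteq> \<Union> (U ` set vs)" using h unfolding set by blast
  ultimately have "q \<le> card (\<Union> (U ` set vs))" using Z(2) card_mono by blast
  moreover have "length vs = min b q" using small len by (simp add: vs_def)
  ultimately show ?thesis using \<open>set vs \<subseteq> {..<n}\<close> by blast
qed

lemma indexed_core_iff:
  "indexed_core n E b p \<longleftrightarrow> 0 \<le> b \<and> (p \<le> 0 \<or> p \<le> int (card (one_core n E)) \<or>
     (\<exists>vs. length vs = nat (min b p) \<and> set vs \<subseteq> {..<n} \<and> nat p \<le> card (\<Union> (covered n E ` set vs))))"
  (is "_ \<longleftrightarrow> 0 \<le> b \<and> (p \<le> 0 \<or> ?core \<or> ?list)")
proof (intro iffI conjI)
  assume "indexed_core n E b p"
  then obtain A H where AH: "A \<subseteq> H" "H \<subseteq> {..<n}" "int (card A) \<le> b" "p \<le> int (card H)"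
      "\<forall>v\<in>H - A. \<exists>u\<in>H. E u v"
    unfolding indexed_core_def by blast
  show "0 \<le> b" using AH(3) by linarith
  have A: "A \<subseteq> {..<n}" "finite A" using AH(1,2) finite_subset[of A "{..<n}"] by auto
  note sub = anchored_subset[OF AH(1,2,5)]
  show "p \<le> 0 \<or> ?core \<or> ?list"
  proof (cases "p \<le> 0")
    case False
    show ?thesis
    \<comment> \<open>Without anchors the union of the sets \<open>covered n E a\<close> is empty
      although the core remains, hence the separate alternative for the core.\<close>
    proof (cases "A = {}")
      case True
      then have "card H \<le> card (one_core n E)"
        using sub finite_subset[OF one_core_subset[of n E]] by (intro card_mono) auto
      then show ?thesis using AH(4) by linarith
    next
      case ne: False
      have fin: "finite (covered n E v)" if "v < n" for v
        using covered_subset[OF that] finite_subset by blast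
      have "H \<subseteq> \<Union> (covered n E ` A)" using sub ne unfolding covered_def by blast
      moreover have "finite (\<Union> (covered n E ` A))" using A fin by auto
      ultimately have "nat p \<le> card (\<Union> (covered n E ` A))"
        using AH(4) card_mono by (metis nat_le_iff order_trans nat_mono)
      moreover have "card A \<le> nat b" "0 < nat p" using AH(3) False by linarith+
      ultimately obtain vs where "length vs = min (nat b) (nat p)" "set vs \<subseteq> {..<n}"
          "nat p \<le> card (\<Union> (covered n E ` set vs))"
        using covering_list[where A = A and b = "nat b" and q = "nat p" and U = "covered n E", OF A ne] fin by blast
      moreover have "min (nat b) (nat p) = nat (min b p)" by auto
      ultimately show ?thesis by metis
    qed
  qed simp
next
  assume *: "0 \<le> b \<and> (p \<le> 0 \<or> ?core \<or> ?list)"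
  then consider "p \<le> 0" | ?core | "0 < p" ?list by (meson not_le)
  then show "indexed_core n E b p"
  proof cases
    case 1
    then show ?thesis using * unfolding indexed_core_def by (intro exI[of _ "{}"]) auto
  next
    case 2
    then show ?thesis
      using * supported_one_core[of n E] unfolding indexed_core_def supported_def
      by (intro exI[of _ "{}"] exI[of _ "one_core n E"]) auto
  next
    case 3
    then obtain vs where vs: "length vs = nat (min b p)" "set vs \<subseteq> {..<n}"
        "nat p \<le> card (\<Union> (covered n E ` set vs))" by blast
    let ?H = "\<Union> (covered n E ` set vs)"
    have "\<exists>u\<in>?H. E u w" if w: "w \<in> ?H - set vs" for w
    proof -
      obtain v where v: "v \<in> set vs" "w \<in> covered n E v" "w \<noteq> v" using w by blast
      then have "\<exists>u\<in>covered n E v. E u w"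
        using reached_pred[of w n E v] supported_one_core[of n E]
        unfolding covered_def supported_def by blast
      then show ?thesis using v(1) by blast
    qed
    moreover have "int (card (set vs)) \<le> b"
      using card_length[of vs] vs(1) * by linarith
    moreover have "set vs \<subseteq> ?H" unfolding covered_def using reached_refl by blast
    moreover have "?H \<subseteq> {..<n}"
    proof (rule UN_least)
      fix v assume "v \<in> set vs"
      then show "covered n E v \<subseteq> {..<n}" using covered_subset[of v n E] vs(2) by auto
    qed
    moreover have "p \<le> int (card ?H)" using vs(3) by linarith
    ultimately show ?thesis unfolding indexed_core_def by blast
  qed
qed

text \<open>Vertices are replaced by their positions in the sorted order in which
  \<open>encode\<close> lists the matrix.\<close>

definition arc_between :: "(nat, nat) pre_digraph \<Rightarrow> nat \<Rightarrow> nat \<Rightarrow> bool" where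
  "arc_between G u v \<longleftrightarrow>
     sorted_list_of_set (verts G) ! u \<rightarrow>\<^bsub>G\<^esub> sorted_list_of_set (verts G) ! v"

lemma core_inst_iff:
  assumes "digraph G"
  shows "core_inst 1 (G, b, p) \<longleftrightarrow> indexed_core (card (verts G)) (arc_between G) b p"
proof -
  interpret digraph G by fact
  define n where "n = card (verts G)"
  define f where "f = (!) (sorted_list_of_set (verts G))"
  have bij: "bij_betw f {..<n} (verts G)"
    using bij_betw_nth[of "sorted_list_of_set (verts G)" "{..<n}" "verts G"] by (simp add: f_def n_def)
  have E: "arc_between G u v \<longleftrightarrow> f u \<rightarrow>\<^bsub>G\<^esub> f v" for u v by (simp add: arc_between_def f_def)
  \<comment> \<open>In the induced subgraph only arcs with both ends in \<open>H\<close> remain, so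
    one entering arc is the same as an in-neighbour within \<open>H\<close>.\<close>
  have deg: "int (in_degree (G \<restriction> H) v) \<ge> 1 \<longleftrightarrow> (\<exists>u\<in>H. u \<rightarrow>\<^bsub>G\<^esub> v)" if "v \<in> H" for H v
  proof -
    have "finite (in_arcs (G \<restriction> H) v)"
      unfolding in_arcs_def by (rule finite_subset[OF _ finite_arcs]) auto
    then have "int (in_degree (G \<restriction> H) v) \<ge> 1 \<longleftrightarrow> in_arcs (G \<restriction> H) v \<noteq> {}"
      unfolding in_degree_def by (simp add: Suc_le_eq card_gt_0_iff)
    also have "\<dots> \<longleftrightarrow> (\<exists>u\<in>H. u \<rightarrow>\<^bsub>G\<^esub> v)"
      using that by (auto simp: in_arcs_def induce_subgraph_def arcs_ends_def arc_to_ends_def)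
    finally show ?thesis .
  qed
  have inj: "inj_on f H" if "H \<subseteq> {..<n}" for H
    using bij that inj_on_subset unfolding bij_betw_def by blast
  show ?thesis
  proof
    assume "core_inst 1 (G, b, p)"
    then obtain A H where AH: "A \<subseteq> H" "H \<subseteq> verts G" "int (card A) \<le> b" "p \<le> int (card H)"
        "\<forall>v\<in>H - A. int (in_degree (G \<restriction> H) v) \<ge> 1"
      by (auto simp: directed_anchored_core_def)
    define g where "g = the_inv_into {..<n} f"
    have g: "bij_betw g (verts G) {..<n}" "\<And>v. v \<in> verts G \<Longrightarrow> f (g v) = v"
      using bij_betw_the_inv_into[OF bij] f_the_inv_into_f_bij_betw[OF bij] by (auto simp: g_def)
    have injg: "inj_on g S" if "S \<subseteq> verts G" for S
      using g(1) that inj_on_subset unfolding bij_betw_def by blast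
    have "card (g ` A) = card A" "card (g ` H) = card H"
      using injg AH(1,2) by (auto intro!: card_image)
    moreover have "g ` H \<subseteq> {..<n}" using g(1) AH(2) by (auto simp: bij_betw_def)
    moreover have "\<exists>u\<in>g ` H. arc_between G u v" if v: "v \<in> g ` H - g ` A" for v
    proof -
      obtain w where w: "w \<in> H - A" "v = g w" using v by blast
      then obtain u where u: "u \<in> H" "u \<rightarrow>\<^bsub>G\<^esub> w" using AH(5) deg[of w H] by auto
      moreover have "f (g u) = u" "f (g w) = w" using g(2) u(1) w(1) AH(2) by auto
      ultimately have "arc_between G (g u) v" using w(2) by (simp add: E)
      then show ?thesis using u by blast
    qed
    ultimately show "indexed_core (card (verts G)) (arc_between G) b p"
      using AH unfolding indexed_core_def n_def[symmetric]
      by (intro exI[of _ "g ` A"] exI[of _ "g ` H"]) auto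
  next
    assume "indexed_core (card (verts G)) (arc_between G) b p"
    then obtain A H where AH: "A \<subseteq> H" "H \<subseteq> {..<n}" "int (card A) \<le> b" "p \<le> int (card H)"
        "\<forall>v\<in>H - A. \<exists>u\<in>H. arc_between G u v"
      by (auto simp: indexed_core_def n_def)
    have "card (f ` A) = card A" "card (f ` H) = card H"
      using inj AH(1,2) by (auto intro!: card_image)
    moreover have "f ` H \<subseteq> verts G" using bij AH(2) by (auto simp: bij_betw_def)
    moreover have "int (in_degree (G \<restriction> f ` H) v) \<ge> 1" if v: "v \<in> f ` H - f ` A" for v
    proof -
      obtain w where w: "w \<in> H - A" "v = f w" using v by blast
      then obtain u where "u \<in> H" "arc_between G u w" using AH(5) by blast
      then show ?thesis using deg[of v "f ` H"] w by (auto simp: E)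
    qed
    ultimately show "core_inst 1 (G, b, p)"
      using AH unfolding core_inst.simps directed_anchored_core_def
      by (intro exI[of _ "f ` A"] exI[of _ "f ` H"]) auto
  qed
qed

section \<open>The adjacency matrix as a flat input list\<close>

lemma nth_concat_uniform:
  "(\<And>ys. ys \<in> set yss \<Longrightarrow> length ys = m) \<Longrightarrow> i < length yss \<Longrightarrow> j < m \<Longrightarrow>
     concat yss ! (i * m + j) = yss ! i ! j"
proof (induction yss arbitrary: i)
  case (Cons ys yss)
  show ?case
  proof (cases i)
    case 0
    then show ?thesis using Cons.prems by (simp add: nth_append)
  next
    case (Suc i')
    have "length ys = m" using Cons.prems by simp
    then show ?thesis using Suc Cons.IH[of i'] Cons.prems by (simp add: nth_append)
  qed
qed simp

lemma length_concat_uniform: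
  "(\<And>ys. ys \<in> set yss \<Longrightarrow> length ys = m) \<Longrightarrow> length (concat yss) = length yss * m"
  by (induction yss) auto

definition encodes :: "int list \<Rightarrow> nat \<Rightarrow> (nat \<Rightarrow> nat \<Rightarrow> bool) \<Rightarrow> int \<Rightarrow> int \<Rightarrow> bool" where
  "encodes xs n E b p \<longleftrightarrow> input_at xs 0 = int n \<and> input_at xs 1 = b \<and> input_at xs 2 = p \<and>
     (\<forall>u<n. \<forall>v<n. input_at xs (int (u * n + 3 + v)) = (if E u v then 1 else 0))"

lemma encode_encodes:
  assumes "digraph G"
  shows "encodes (encode (G, b, p)) (card (verts G)) (arc_between G) b p"
    and "length (encode (G, b, p)) = 3 + card (verts G) * card (verts G)"
proof -
  interpret digraph G by fact
  define vs where "vs = sorted_list_of_set (verts G)"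
  define yss where "yss = map (\<lambda>u. map (\<lambda>v. if u \<rightarrow>\<^bsub>G\<^esub> v then 1 else 0 :: int) vs) vs"
  have len: "length vs = card (verts G)" by (simp add: vs_def)
  have enc: "encode (G, b, p) = [int (length vs), b, p] @ concat yss"
    by (simp add: vs_def yss_def Let_def)
  have uni: "length ys = length vs" if "ys \<in> set yss" for ys using that by (auto simp: yss_def)
  have tot: "length (concat yss) = length vs * length vs"
    using length_concat_uniform[of yss, OF uni] by (simp add: yss_def)
  show "length (encode (G, b, p)) = 3 + card (verts G) * card (verts G)"
    unfolding enc using tot len by simp
  have "input_at (encode (G, b, p)) (int (u * length vs + 3 + v)) = (if arc_between G u v then 1 else 0)"
    if "u < length vs" "v < length vs" for u v
  proof -
    have "u * length vs + v < length vs * length vs"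
    proof -
      have "u * length vs + v < Suc u * length vs" using that by simp
      also have "\<dots> \<le> length vs * length vs" using that by (intro mult_right_mono) auto
      finally show ?thesis .
    qed
    then have "input_at (encode (G, b, p)) (int (u * length vs + 3 + v)) = concat yss ! (u * length vs + v)"
      unfolding enc input_at_def nat_int using tot by (simp add: numeral_3_eq_3)
    also have "\<dots> = yss ! u ! v"
      by (rule nth_concat_uniform) (use uni that in \<open>auto simp: yss_def\<close>)
    also have "\<dots> = (if arc_between G u v then 1 else 0)"
      using that by (simp add: yss_def arc_between_def vs_def)
    finally show ?thesis .
  qed
  moreover have "input_at (encode (G, b, p)) 0 = int (length vs)" "input_at (encode (G, b, p)) 1 = b"
      "input_at (encode (G, b, p)) 2 = p"
    unfolding enc input_at_def by (auto simp: eval_nat_numeral)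
  ultimately show "encodes (encode (G, b, p)) (card (verts G)) (arc_between G) b p"
    unfolding encodes_def len by simp
qed

section \<open>The algorithm\<close>

abbreviation (input) "xans \<equiv> 0::nat"
abbreviation (input) "xn \<equiv> 1::nat"
abbreviation (input) "xb \<equiv> 2::nat"
abbreviation (input) "xp \<equiv> 3::nat"
abbreviation (input) "xq \<equiv> 4::nat"
abbreviation (input) "xrounds \<equiv> 5::nat"
abbreviation (input) "xN \<equiv> 6::nat"
abbreviation (input) "xk \<equiv> 7::nat"
abbreviation (input) "xlog \<equiv> 8::nat"
abbreviation (input) "xq1 \<equiv> 9::nat"
abbreviation (input) "xlevels \<equiv> 10::nat"
abbreviation (input) "xslots \<equiv> 11::nat"
abbreviation (input) "xi \<equiv> 12::nat"
abbreviation (input) "xj \<equiv> 13::nat"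
abbreviation (input) "xacc \<equiv> 14::nat"
abbreviation (input) "xpow \<equiv> 15::nat"
abbreviation (input) "xx \<equiv> 16::nat"
abbreviation (input) "xu \<equiv> 17::nat"
abbreviation (input) "xw \<equiv> 18::nat"
abbreviation (input) "xt \<equiv> 19::nat"
abbreviation (input) "xcore \<equiv> 20::nat"
abbreviation (input) "xcur \<equiv> 21::nat"
abbreviation (input) "xnext \<equiv> 22::nat"
abbreviation (input) "xbig \<equiv> 23::nat"
abbreviation (input) "xr \<equiv> 24::nat"
abbreviation (input) "xv \<equiv> 25::nat"
abbreviation (input) "xm \<equiv> 26::nat"
abbreviation (input) "xe \<equiv> 27::nat"
abbreviation (input) "xc \<equiv> 28::nat"
abbreviation (input) "xd \<equiv> 29::nat"
abbreviation (input) "xrow \<equiv> 30::nat"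
abbreviation (input) "xlen \<equiv> 31::nat"
abbreviation (input) "xmask \<equiv> 32::nat"
abbreviation (input) "xy \<equiv> 33::nat"
abbreviation (input) "xS \<equiv> 34::nat"
abbreviation (input) "xrest \<equiv> 35::nat"
abbreviation (input) "xsign \<equiv> 36::nat"
abbreviation (input) "xhalf \<equiv> 37::nat"
abbreviation (input) "xprod \<equiv> 38::nat"
abbreviation (input) "xz \<equiv> 39::nat"
abbreviation (input) "xf \<equiv> 40::nat"
abbreviation (input) "xhit \<equiv> 41::nat"
abbreviation (input) "xbase \<equiv> 42::nat"
abbreviation (input) "xtop \<equiv> 43::nat"

abbreviation (input) "aLine \<equiv> 1::nat"
abbreviation (input) "aMul \<equiv> 2::nat"
abbreviation (input) "aDeg \<equiv> 3::nat"
abbreviation (input) "aAlive \<equiv> 4::nat"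
abbreviation (input) "aSeen \<equiv> 5::nat"
abbreviation (input) "aQueue \<equiv> 6::nat"
abbreviation (input) "aVec \<equiv> 7::nat"
abbreviation (input) "aOut \<equiv> 8::nat"
abbreviation (input) "aRow \<equiv> 9::nat"

text \<open>There is no multiplication: cell \<open>i\<close> of \<open>aMul\<close> holds \<open>i * 2 ^ p\<close>, and cell \<open>u\<close> of \<open>aLine\<close> the input
  position of row \<open>u\<close> of the adjacency matrix. The row of level \<open>e\<close> and coordinate \<open>c\<close> starts at cell
  \<open>(e * 2 ^ p + c) * 2 ^ p\<close> of \<open>aRow\<close>; the levels of the successive bases are stacked.\<close>

definition odd_expr :: "expr \<Rightarrow> expr" where
  "odd_expr e = Minus e (Plus (Halve e) (Halve e))"

definition arc_expr :: expr where
  "arc_expr = Inp (Plus (Arr aLine (Var xu)) (Var xw))"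

definition load_row :: stmt where
  "load_row = For xd xN (Put aVec (Var xd) (Arr aRow (Plus (Var xrow) (Var xd))))"

definition sub_row :: stmt where
  "sub_row = For xd xN (Put aVec (Var xd)
     (Minus (Arr aVec (Var xd)) (Arr aRow (Plus (Var xrow) (Var xd)))))"

definition store_row :: stmt where
  "store_row = For xd xN (Put aRow (Plus (Var xrow) (Var xd)) (Arr aVec (Var xd)))"

definition halve_vec :: stmt where
  "halve_vec = For xd xN (Put aVec (Var xd) (Halve (Arr aVec (Var xd))))"

text \<open>A loop cannot be left early; after a row has been stored, \<open>xhit\<close> makes the
  remaining coordinates pass without effect.\<close>

definition scan_step :: stmt where
  "scan_step = Cond (Minus (Num 1) (Var xhit))
     (Cond (odd_expr (Arr aVec (Var xi)))
       (Assign xrow (Arr aMul (Plus (Var xbase) (Var xi))) ;;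
        Cond (odd_expr (Arr aRow (Plus (Var xrow) (Var xi))))
          sub_row
          (store_row ;; Assign xhit (Num 1)))
       Skip)
     Skip"

definition scan_level :: stmt where
  "scan_level = Assign xhit (Num 0) ;; Assign xbase (Arr aMul (Plus (Var xnext) (Var xf))) ;;
     For xi xN scan_step ;;
     Cond (Minus (Num 1) (Var xhit)) halve_vec Skip"

definition sift_vec :: stmt where
  "sift_vec = For xf xk (Cond (Plus (Minus (Var xf) (Var xe)) (Num 1)) scan_level Skip)"

text \<open>\<open>xy\<close> changes within the phase and cannot be a limit in the static time
  analysis, so the loop runs up to \<open>xn\<close> and adds while the counter is below
  \<open>xy\<close>.\<close>

definition times_y :: stmt where
  "times_y = Assign xprod (Num 0) ;;
     For xz xn (Cond (Minus (Var xy) (Var xz)) (Assign xprod (Plus (Var xprod) (Var xacc))) Skip) ;;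
     Assign xacc (Var xprod)"

text \<open>One step of Horner's rule in \<open>y\<close>. The digits of \<open>S\<close> are read
  from the highest down; a digit 1 contributes the coordinate of \<open>S\<close> without that
  digit, with a sign alternating over the digits met.\<close>

definition wedge_digit :: stmt where
  "wedge_digit = times_y ;;
     Cond (Plus (Minus (Var xrest) (Var xpow)) (Num 1))
       (Assign xrest (Minus (Var xrest) (Var xpow)) ;;
        Assign xprod (Arr aVec (Minus (Var xS) (Var xpow))) ;;
        Cond (Var xsign) (Assign xacc (Plus (Var xacc) (Var xprod)))
          (Assign xacc (Minus (Var xacc) (Var xprod))) ;;
        Assign xsign (Minus (Num 0) (Var xsign)))
       Skip ;;
     Assign xpow (Halve (Var xpow))"

definition wedge_coordinate :: stmt where
  "wedge_coordinate = Assign xacc (Num 0) ;; Assign xrest (Var xS) ;; Assign xpow (Var xhalf) ;;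
     Assign xsign (Num 1) ;; For xi xq wedge_digit ;; Put aOut (Var xS) (Var xacc)"

definition wedge_vec :: stmt where
  "wedge_vec = Assign xhalf (Halve (Var xN)) ;; For xS xN wedge_coordinate ;;
     For xd xN (Put aVec (Var xd) (Arr aOut (Var xd)))"

definition wedge_selected :: stmt where
  "wedge_selected = Assign xmask (Var xm) ;;
     For xj xq
       (Cond (odd_expr (Var xmask))
          (Cond (Minus (Var xlen) (Var xj)) (Assign xy (Arr aQueue (Var xj)) ;; wedge_vec) Skip) Skip ;;
        Assign xmask (Halve (Var xmask)))"

definition insert_product :: stmt where
  "insert_product =
     Assign xrow (Arr aMul (Plus (Arr aMul (Plus (Var xcur) (Var xe))) (Var xc))) ;;
     load_row ;; wedge_selected ;; sift_vec"

definition insert_products :: stmt where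
  "insert_products = For xm xN (For xe xk (For xc xN insert_product))"

definition start_search :: stmt where
  "start_search = Assign xlen (Num 0) ;;
     For xx xn
       (Assign xt (Arr aAlive (Var xx)) ;;
        Cond (Minus (Var xx) (Var xv)) Skip (Cond (Minus (Var xv) (Var xx)) Skip (Assign xt (Num 1))) ;;
        Put aSeen (Var xx) (Var xt) ;;
        Cond (Var xt) (Put aQueue (Var xlen) (Var xx) ;; Assign xlen (Plus (Var xlen) (Num 1))) Skip)"

definition visit :: stmt where
  "visit = Cond arc_expr
     (Cond (Minus (Num 1) (Arr aSeen (Var xw)))
        (Put aSeen (Var xw) (Num 1) ;; Put aQueue (Var xlen) (Var xw) ;;
         Assign xlen (Plus (Var xlen) (Num 1))) Skip)
     Skip"

text \<open>Expanding the first \<open>p\<close> entries of the queue is enough: fewer than \<open>p\<close> entries are then all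
  expanded, and otherwise the set is large.\<close>

definition search :: stmt where
  "search = start_search ;;
     For xj xq (Cond (Minus (Var xlen) (Var xj))
       (Assign xu (Arr aQueue (Var xj)) ;; For xw xn visit) Skip)"

text \<open>Insertion is carried out even after a large set has been found. It then uses the first
  \<open>p\<close> queue entries only, which still belong to the set, so soundness is not
  affected.\<close>

definition one_round :: stmt where
  "one_round = Assign xnext (Plus (Var xcur) (Var xk)) ;;
     For xv xn
       (search ;; Cond (Plus (Minus (Var xlen) (Var xq)) (Num 1)) (Assign xbig (Num 1)) Skip ;;
        insert_products) ;;
     Assign xcur (Var xnext)"

definition rounds :: stmt where
  "rounds = Assign xcur (Num 0) ;; Assign xbig (Num 0) ;; For xr xrounds one_round"

text \<open>The unit vector is entered at every level, since saturation requires its doubles at the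
  higher ones.\<close>

definition start_basis :: stmt where
  "start_basis = For xe xk (Put aRow (Arr aMul (Arr aMul (Var xe))) (Num 1))"

definition find_top :: stmt where
  "find_top = Assign xtop (Num 0) ;;
     For xz xlevels
       (Cond (odd_expr (Arr aRow (Minus (Plus (Arr aMul (Minus (Plus (Arr aMul (Var xz)) (Var xN)) (Num 1))) (Var xN)) (Num 1))))
          (Assign xtop (Num 1)) Skip)"

definition in_degrees :: stmt where
  "in_degrees = For xx xn (Put aAlive (Var xx) (Num 1) ;; Put aDeg (Var xx) (Num 0)) ;;
     For xu xn (For xw xn (Put aDeg (Var xw) (Plus (Arr aDeg (Var xw)) arc_expr)))"

text \<open>The value -1 of \<open>xu\<close> means that no vertex can be deleted. One deletion
  reads a single row of the matrix, so \<open>n\<close> passes take quadratic time.\<close>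

definition peel_one :: stmt where
  "peel_one = Assign xu (Num (-1)) ;;
     For xx xn (Cond (Arr aAlive (Var xx)) (Cond (Minus (Num 1) (Arr aDeg (Var xx))) (Assign xu (Var xx)) Skip) Skip) ;;
     Cond (Plus (Var xu) (Num 1))
       (Put aAlive (Var xu) (Num 0) ;; For xw xn (Put aDeg (Var xw) (Minus (Arr aDeg (Var xw)) arc_expr)))
       Skip"

definition peel :: stmt where
  "peel = in_degrees ;; For xt xn peel_one ;; Assign xcore (Num 0) ;;
     For xx xn (Assign xcore (Plus (Var xcore) (Arr aAlive (Var xx))))"

definition read_input :: stmt where
  "read_input = Assign xn (Inp (Num 0)) ;; Assign xb (Inp (Num 1)) ;; Assign xp (Inp (Num 2)) ;;
     Cond (Var xp) (Assign xq (Var xp)) (Assign xq (Num 0)) ;;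
     Cond (Minus (Var xb) (Var xq)) (Assign xrounds (Var xq))
       (Cond (Var xb) (Assign xrounds (Var xb)) (Assign xrounds (Num 0))) ;;
     Assign xq1 (Plus (Var xq) (Num 1))"

text \<open>\<open>xlog\<close> becomes the least \<open>l\<close> with
  \<open>n \<le> 2 ^ l\<close>, and \<open>xk\<close> becomes \<open>p * p * l + 1\<close>, with the
  product formed by nested additions.\<close>

definition sizes :: stmt where
  "sizes = Assign xN (Num 1) ;; For xi xq (Assign xN (Plus (Var xN) (Var xN))) ;;
     Assign xpow (Num 1) ;; Assign xlog (Num 0) ;;
     For xi xn (Cond (Minus (Var xn) (Var xpow))
       (Assign xpow (Plus (Var xpow) (Var xpow)) ;; Assign xlog (Plus (Var xlog) (Num 1))) Skip) ;;
     Assign xk (Num 1) ;; For xi xq (For xj xq (Assign xk (Plus (Var xk) (Var xlog))))"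

definition count_levels :: stmt where
  "count_levels = Assign xlevels (Num 0) ;; For xi xq1 (Assign xlevels (Plus (Var xlevels) (Var xk)))"

definition count_slots :: stmt where
  "count_slots = Assign xslots (Num 0) ;; For xi xlevels (Assign xslots (Plus (Var xslots) (Var xN)))"

definition tables :: stmt where
  "tables = Assign xacc (Num 0) ;;
     For xi xslots (Put aMul (Var xi) (Var xacc) ;; Assign xacc (Plus (Var xacc) (Var xN))) ;;
     Assign xacc (Num 3) ;;
     For xi xn (Put aLine (Var xi) (Var xacc) ;; Assign xacc (Plus (Var xacc) (Var xn)))"

definition answer :: stmt where
  "answer = Assign xans (Num 0) ;;
     Cond (Plus (Var xb) (Num 1))
       (Cond (Var xp)
          (Cond (Plus (Minus (Var xcore) (Var xp)) (Num 1)) (Assign xans (Num 1)) Skip ;;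
           Cond (Var xbig) (Assign xans (Num 1)) Skip ;;
           Cond (Var xtop) (Assign xans (Num 1)) Skip)
          (Assign xans (Num 1)))
       Skip"

definition anchored_core :: stmt where
  "anchored_core = read_input ;; sizes ;; count_levels ;; count_slots ;; tables ;;
     peel ;; start_basis ;; rounds ;; find_top ;; answer"

lemmas prog_defs = odd_expr_def arc_expr_def load_row_def sub_row_def store_row_def halve_vec_def
  scan_step_def scan_level_def sift_vec_def times_y_def wedge_digit_def wedge_coordinate_def
  wedge_vec_def wedge_selected_def insert_product_def insert_products_def start_search_def visit_def search_def
  one_round_def rounds_def start_basis_def find_top_def in_degrees_def peel_one_def peel_def
  read_input_def sizes_def count_levels_def count_slots_def tables_def answer_def

lemma wf_anchored_core: "wf_stmt anchored_core"
  unfolding anchored_core_def prog_defs by simp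

section \<open>Row operations on the stored bases\<close>

lemma frame_simps [simp]:
  "scalars load_row = {xd, 0}" "arrays load_row = {aVec}"
  "scalars sub_row = {xd, 0}" "arrays sub_row = {aVec}"
  "scalars store_row = {xd, 0}" "arrays store_row = {aRow}"
  "scalars halve_vec = {xd, 0}" "arrays halve_vec = {aVec}"
  "scalars scan_step = {xd, 0, xrow, xhit}" "arrays scan_step = {aVec, aRow}"
  "scalars scan_level = {xd, 0, xrow, xhit, xbase, xi}" "arrays scan_level = {aVec, aRow}"
  "scalars sift_vec = {xd, 0, xrow, xhit, xbase, xi, xf}" "arrays sift_vec = {aVec, aRow}"
  unfolding prog_defs by auto

lemma rd_int [simp]: "rd s a (int i) = cell s a i"
  and rd_add [simp]: "rd s a (int i + int j) = cell s a (i + j)"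
  and wr_int [simp]: "wr s a (int i) v = upd s a i v"
  and wr_add [simp]: "wr s a (int i + int j) v = upd s a (i + j) v"
  by (simp_all add: rd_def wr_def nat_add_distrib)

lemma rd_diff [simp]: "j \<le> i \<Longrightarrow> rd s a (int i - int j) = cell s a (i - j)"
  by (simp add: rd_def nat_diff_distrib)

lemma odd_expr_pos [simp]: "0 < eval_expr xs (odd_expr e) s \<longleftrightarrow> odd (eval_expr xs e s)"
  unfolding odd_expr_def by (simp add: mult_2[symmetric] minus_mult_div_eq_mod odd_iff_mod_2_eq_one) presburger

definition vec :: "nat \<Rightarrow> state \<Rightarrow> nat \<Rightarrow> int" where
  "vec N s = (\<lambda>d. if d < N then cell s aVec d else 0)"

definition row :: "nat \<Rightarrow> state \<Rightarrow> nat \<Rightarrow> nat \<Rightarrow> int" where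
  "row N s j = (\<lambda>d. if d < N then cell s aRow (j * N + d) else 0)"

text \<open>\<open>q\<close> is the first level of a basis within the stack of bases. Everything
  outside the \<open>k\<close> levels and \<open>N\<close> coordinates reads as empty, whatever the
  memory contains.\<close>

definition basis_at :: "nat \<Rightarrow> nat \<Rightarrow> state \<Rightarrow> nat \<Rightarrow> basis" where
  "basis_at N k s q = (\<lambda>e c. if e < k \<and> c < N then row N s ((q + e) * N + c) else (\<lambda>_. 0))"

lemma slot_eq_iff:
  fixes i j c d N :: nat
  assumes "c < N" "d < N"
  shows "i * N + c = j * N + d \<longleftrightarrow> i = j \<and> c = d"
proof
  assume eq: "i * N + c = j * N + d"
  have "(i * N + c) div N = i" "(j * N + d) div N = j" using assms by auto
  with eq show "i = j \<and> c = d" by auto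
qed simp

lemma load_row:
  assumes "cell s 0 xN = int N" "cell s 0 xrow = int (j * N)"
  shows "vec N (sem xs load_row s) = row N s j"
  unfolding load_row_def
proof (rule sem_For[where m = N and I = "\<lambda>i t. \<forall>d<i. cell t aVec d = cell s aRow (j * N + d)"])
  fix i t
  assume *: "\<forall>y. y \<notin> insert xd (scalars (Put aVec (Var xd) (Arr aRow (Plus (Var xrow) (Var xd))))) \<longrightarrow>
      cell t 0 y = cell s 0 y"
    "\<forall>a. a \<noteq> 0 \<and> a \<notin> arrays (Put aVec (Var xd) (Arr aRow (Plus (Var xrow) (Var xd)))) \<longrightarrow> cell t a = cell s a"
    "\<forall>d<i. cell t aVec d = cell s aRow (j * N + d)"
  have "cell t 0 xrow = int (j * N)" using * assms by simp
  moreover have "cell t aRow = cell s aRow" using * by simp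
  ultimately show "\<forall>d<Suc i. cell (sem xs (Put aVec (Var xd) (Arr aRow (Plus (Var xrow) (Var xd)))) (upd t 0 xd (int i))) aVec d =
     cell s aRow (j * N + d)"
    using *(3) by (simp add: less_Suc_eq del: of_nat_mult)
qed (auto simp: assms vec_def row_def)

lemma sub_row:
  assumes "cell s 0 xN = int N" "cell s 0 xrow = int (j * N)"
  shows "vec N (sem xs sub_row s) = (\<lambda>d. vec N s d - row N s j d)"
  unfolding sub_row_def
proof (rule sem_For[where m = N and I = "\<lambda>i t. \<forall>d. cell t aVec d = cell s aVec d - (if d < i then cell s aRow (j * N + d) else 0)"])
  fix i t
  let ?c = "Put aVec (Var xd) (Minus (Arr aVec (Var xd)) (Arr aRow (Plus (Var xrow) (Var xd))))"
  assume *: "\<forall>y. y \<notin> insert xd (scalars ?c) \<longrightarrow> cell t 0 y = cell s 0 y"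
    "\<forall>a. a \<noteq> 0 \<and> a \<notin> arrays ?c \<longrightarrow> cell t a = cell s a"
    "\<forall>d. cell t aVec d = cell s aVec d - (if d < i then cell s aRow (j * N + d) else 0)"
  have "cell t 0 xrow = int (j * N)" using * assms by simp
  moreover have "cell t aRow = cell s aRow" using * by simp
  ultimately show "\<forall>d. cell (sem xs ?c (upd t 0 xd (int i))) aVec d =
     cell s aVec d - (if d < Suc i then cell s aRow (j * N + d) else 0)"
    using *(3) by (simp add: less_Suc_eq del: of_nat_mult)
qed (auto simp: assms vec_def row_def)

lemma store_row:
  assumes "cell s 0 xN = int N" "cell s 0 xrow = int (j * N)"
  shows "row N (sem xs store_row s) = (row N s)(j := vec N s)"
  unfolding store_row_def
proof (rule sem_For[where m = N and I = "\<lambda>i t. \<forall>z. cell t aRow z =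
     (if j * N \<le> z \<and> z < j * N + i then cell s aVec (z - j * N) else cell s aRow z)"])
  fix i t
  let ?c = "Put aRow (Plus (Var xrow) (Var xd)) (Arr aVec (Var xd))"
  assume *: "\<forall>y. y \<notin> insert xd (scalars ?c) \<longrightarrow> cell t 0 y = cell s 0 y"
    "\<forall>a. a \<noteq> 0 \<and> a \<notin> arrays ?c \<longrightarrow> cell t a = cell s a"
    "\<forall>z. cell t aRow z = (if j * N \<le> z \<and> z < j * N + i then cell s aVec (z - j * N) else cell s aRow z)"
  have "cell t 0 xrow = int (j * N)" using * assms by simp
  moreover have "cell t aVec = cell s aVec" using * by simp
  ultimately show "\<forall>z. cell (sem xs ?c (upd t 0 xd (int i))) aRow z =
     (if j * N \<le> z \<and> z < j * N + Suc i then cell s aVec (z - j * N) else cell s aRow z)"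
    using *(3) by (auto simp: less_Suc_eq simp del: of_nat_mult)
next
  fix t
  assume *: "\<forall>z. cell t aRow z = (if j * N \<le> z \<and> z < j * N + N then cell s aVec (z - j * N) else cell s aRow z)"
  have "row N t i d = ((row N s)(j := vec N s)) i d" for i d
  proof (cases "d < N")
    case True
    have "j * N \<le> i * N + d \<and> i * N + d < j * N + N \<longleftrightarrow> i = j"
    proof
      assume "j * N \<le> i * N + d \<and> i * N + d < j * N + N"
      then have "i * N + d = j * N + (i * N + d - j * N)" "i * N + d - j * N < N" by auto
      then show "i = j" using slot_eq_iff[OF True, of "i * N + d - j * N" i j] by blast
    qed (use True in simp)
    then show ?thesis using * True by (simp add: row_def vec_def)
  qed (simp add: row_def vec_def)
  then have "row N t = (row N s)(j := vec N s)" by (intro ext)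
  moreover have "row N (upd t 0 xd (int N)) = row N t" by (simp add: row_def fun_eq_iff)
  ultimately show "row N (upd t 0 xd (int N)) = (row N s)(j := vec N s)" by simp
qed (auto simp: assms)

lemma halve_vec:
  assumes "cell s 0 xN = int N"
  shows "vec N (sem xs halve_vec s) = (\<lambda>d. vec N s d div 2)"
  unfolding halve_vec_def
proof (rule sem_For[where m = N and I = "\<lambda>i t. \<forall>d. cell t aVec d = (if d < i then cell s aVec d div 2 else cell s aVec d)"])
  fix i t
  let ?c = "Put aVec (Var xd) (Halve (Arr aVec (Var xd)))"
  assume "\<forall>d. cell t aVec d = (if d < i then cell s aVec d div 2 else cell s aVec d)"
  then show "\<forall>d. cell (sem xs ?c (upd t 0 xd (int i))) aVec d =
     (if d < Suc i then cell s aVec d div 2 else cell s aVec d)"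
    by (simp add: less_Suc_eq)
qed (auto simp: assms vec_def)


definition multiples :: "nat \<Rightarrow> nat \<Rightarrow> state \<Rightarrow> bool" where
  "multiples N T s \<longleftrightarrow> (\<forall>z<T. cell s aMul z = int (z * N))"

lemma vec_cong: "cell s aVec = cell t aVec \<Longrightarrow> vec N s = vec N t"
  by (simp add: vec_def fun_eq_iff)

lemma row_cong: "cell s aRow = cell t aRow \<Longrightarrow> row N s = row N t"
  by (simp add: row_def fun_eq_iff)

lemma basis_at_cong: "row N s = row N t \<Longrightarrow> basis_at N k s = basis_at N k t"
  by (simp add: basis_at_def fun_eq_iff)

lemma multiples_cong: "cell s aMul = cell t aMul \<Longrightarrow> multiples N T s \<longleftrightarrow> multiples N T t"
  by (simp add: multiples_def)

lemma basis_at_store: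
  assumes "row N t = (row N s)((q + f) * N + c := v)" "c < N" "f < k"
  shows "basis_at N k t q = (basis_at N k s q)(f := (basis_at N k s q f)(c := v))"
proof (intro ext)
  fix e i d
  have "i < N \<Longrightarrow> (q + e) * N + i = (q + f) * N + c \<longleftrightarrow> e = f \<and> i = c"
    using slot_eq_iff[of i N c "q + e" "q + f"] assms(2) by simp
  then show "basis_at N k t q e i d = ((basis_at N k s q)(f := (basis_at N k s q f)(c := v))) e i d"
    using assms by (simp add: basis_at_def)
qed

lemma slot_bound: "f < k \<Longrightarrow> c < N \<Longrightarrow> (q + f) * N + c < (q + k) * (N :: nat)"
proof -
  assume "f < k" "c < N"
  then have "(q + f) * N + c < (q + f) * N + N" by simp
  also have "\<dots> = Suc (q + f) * N" by simp
  also have "\<dots> \<le> (q + k) * N" using \<open>f < k\<close> by (intro mult_right_mono) auto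
  finally show ?thesis .
qed

lemma scan_step:
  assumes "cell t 0 xN = int N" "cell t 0 xbase = int ((q + f) * N)" "cell t 0 xi = int c"
    and "multiples N T t" "c < N" "f < k" "(q + k) * N \<le> T"
    and hit: "cell t 0 xhit = 0 \<or> cell t 0 xhit = 1"
  shows "cell t 0 xhit = 1 \<or> even (vec N t c) \<Longrightarrow> sem xs scan_step t = t"
    and "cell t 0 xhit = 0 \<Longrightarrow> odd (vec N t c) \<Longrightarrow> odd (basis_at N k t q f c c) \<Longrightarrow>
      vec N (sem xs scan_step t) = (\<lambda>d. vec N t d - basis_at N k t q f c d) \<and>
      row N (sem xs scan_step t) = row N t \<and> cell (sem xs scan_step t) 0 xhit = 0"
    and "cell t 0 xhit = 0 \<Longrightarrow> odd (vec N t c) \<Longrightarrow> even (basis_at N k t q f c c) \<Longrightarrow>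
      vec N (sem xs scan_step t) = vec N t \<and>
      row N (sem xs scan_step t) = (row N t)((q + f) * N + c := vec N t) \<and>
      cell (sem xs scan_step t) 0 xhit = 1"
proof -
  let ?j = "(q + f) * N + c"
  have v: "eval_expr xs (Arr aVec (Var xi)) t = vec N t c" using assms by (simp add: vec_def)
  define t1 where "t1 = sem xs (Assign xrow (Arr aMul (Plus (Var xbase) (Var xi)))) t"
  have "?j < T" using slot_bound[of f k c N q] assms by linarith
  then have "rd t aMul (int ((q + f) * N) + int c) = int (?j * N)"
    using assms(4) unfolding rd_add multiples_def by blast
  then have row: "cell t1 0 xrow = int (?j * N)" using assms(2,3) by (simp add: t1_def)
  have t1: "cell t1 0 xN = int N" "cell t1 0 xi = int c" "cell t1 aRow = cell t aRow"
     "cell t1 aVec = cell t aVec" "cell t1 0 xhit = cell t 0 xhit"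
    using assms by (auto simp: t1_def)
  have rows: "basis_at N k t q f c = row N t1 ?j" "row N t1 = row N t" "vec N t1 = vec N t"
    using assms row_cong[OF t1(3)] vec_cong[OF t1(4)] by (auto simp: basis_at_def)
  have "eval_expr xs (Arr aRow (Plus (Var xrow) (Var xi))) t1 = rd t1 aRow (int (?j * N) + int c)"
    using row t1(2) by (simp del: rd_add)
  also have "\<dots> = basis_at N k t q f c c" unfolding rd_add rows(1) using assms(5) by (simp add: row_def)
  finally have b: "eval_expr xs (Arr aRow (Plus (Var xrow) (Var xi))) t1 = basis_at N k t q f c c" .
  have step: "sem xs scan_step t = (if 0 < 1 - cell t 0 xhit then
      if odd (vec N t c) then if odd (basis_at N k t q f c c) then sem xs sub_row t1
        else upd (sem xs store_row t1) 0 xhit 1 else t else t)"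
    unfolding scan_step_def sem.simps(4-5) t1_def[symmetric] odd_expr_pos v b by simp
  show "cell t 0 xhit = 1 \<or> even (vec N t c) \<Longrightarrow> sem xs scan_step t = t"
    unfolding step by auto
  show "cell t 0 xhit = 0 \<Longrightarrow> odd (vec N t c) \<Longrightarrow> odd (basis_at N k t q f c c) \<Longrightarrow>
      vec N (sem xs scan_step t) = (\<lambda>d. vec N t d - basis_at N k t q f c d) \<and>
      row N (sem xs scan_step t) = row N t \<and> cell (sem xs scan_step t) 0 xhit = 0"
    unfolding step using sub_row[OF t1(1) row, of xs] rows t1(5)
      row_cong[of "sem xs sub_row t1" t1 N]
    by (simp add: sem_scalar_frame sem_array_frame)
  show "cell t 0 xhit = 0 \<Longrightarrow> odd (vec N t c) \<Longrightarrow> even (basis_at N k t q f c c) \<Longrightarrow>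
      vec N (sem xs scan_step t) = vec N t \<and>
      row N (sem xs scan_step t) = (row N t)((q + f) * N + c := vec N t) \<and>
      cell (sem xs scan_step t) 0 xhit = 1"
    unfolding step using store_row[OF t1(1) row, of xs] rows
      vec_cong[of "upd (sem xs store_row t1) 0 xhit 1" t1 N]
      row_cong[of "upd (sem xs store_row t1) 0 xhit 1" "sem xs store_row t1" N]
    by (simp add: sem_array_frame)
qed

lemma scan_level:
  assumes "cell s 0 xN = int N" "cell s 0 xnext = int q" "cell s 0 xf = int f"
    and "multiples N T s" "0 < N" "f < k" "(q + k) * N \<le> T"
  shows "scan f N 0 (vec N s) (basis_at N k s q) =
      (vec N (sem xs scan_level s), basis_at N k (sem xs scan_level s) q) \<and>
    (\<forall>j. j < q * N \<or> (q + k) * N \<le> j \<longrightarrow> row N (sem xs scan_level s) j = row N s j)"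
proof -
  let ?scan = "scan f N 0 (vec N s) (basis_at N k s q)"
  define s1 where "s1 = sem xs (Assign xbase (Arr aMul (Plus (Var xnext) (Var xf)))) (sem xs (Assign xhit (Num 0)) s)"
  \<comment> \<open>Either the rest of the scan, started from the current memory, still gives the
    final result, or the flag is up and the memory is the result.\<close>
  define I where "I = (\<lambda>c t. (cell t 0 xhit = 0 \<and> scan f (N - c) c (vec N t) (basis_at N k t q) = ?scan \<or>
      cell t 0 xhit = 1 \<and> (vec N t, basis_at N k t q) = ?scan) \<and>
      (\<forall>j. j < q * N \<or> (q + k) * N \<le> j \<longrightarrow> row N t j = row N s j))"
  have "q + f < q + k" "q + k \<le> (q + k) * N" using assms by auto
  then have "q + f < T" using assms(7) by linarith
  then have "rd s aMul (int q + int f) = int ((q + f) * N)"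
    using assms(4) unfolding rd_add multiples_def by blast
  then have s1: "cell s1 0 xbase = int ((q + f) * N)" "cell s1 0 xN = int N" "cell s1 0 xhit = 0"
      "cell s1 aVec = cell s aVec" "cell s1 aRow = cell s aRow" "cell s1 aMul = cell s aMul"
    using assms by (auto simp: s1_def rd_def)
  have eq1: "vec N s1 = vec N s" "row N s1 = row N s" "basis_at N k s1 = basis_at N k s"
    by (rule vec_cong[OF s1(4)] row_cong[OF s1(5)] basis_at_cong[OF row_cong[OF s1(5)]])+
  have upd_eq: "vec N (upd t 0 x y) = vec N t" "row N (upd t 0 x y) = row N t"
      "basis_at N k (upd t 0 x y) = basis_at N k t" for t x y
    by (auto intro!: vec_cong row_cong basis_at_cong)
  define s2 where "s2 = sem xs (For xi xN scan_step) s1"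
  have "cell s2 0 xN = int N \<and> I N s2"
    unfolding s2_def
  proof (rule sem_For[where m = N and I = "\<lambda>c t. cell t 0 xN = int N \<and> I c t"])
    show "cell s1 0 xN = int N" by (rule s1)
    show "cell s1 0 xN = int N \<and> I 0 s1" using s1(2,3) eq1 by (simp add: I_def)
  next
    fix c t
    assume c: "c < N" and I: "cell t 0 xN = int N \<and> I c t"
      and fr: "\<forall>y. y \<notin> insert xi (scalars scan_step) \<longrightarrow> cell t 0 y = cell s1 0 y"
        "\<forall>a. a \<noteq> 0 \<and> a \<notin> arrays scan_step \<longrightarrow> cell t a = cell s1 a"
    let ?t = "upd t 0 xi (int c)"
    let ?t' = "sem xs scan_step ?t"
    have pre: "cell ?t 0 xN = int N" "cell ?t 0 xbase = int ((q + f) * N)" "cell ?t 0 xi = int c"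
        "multiples N T ?t"
      using I fr s1 multiples_cong[of ?t s N T] assms(4) by auto
    have hit: "cell ?t 0 xhit = 0 \<or> cell ?t 0 xhit = 1" using I by (auto simp: I_def)
    note step = scan_step[OF pre c assms(6,7) hit, of xs]
    have N: "N - c = Suc (N - Suc c)" using c by simp
    have other: "j \<noteq> (q + f) * N + c" if "j < q * N \<or> (q + k) * N \<le> j" for j
      using that slot_bound[OF assms(6) c, of q] by (auto simp: algebra_simps)
    have xN: "cell ?t' 0 xN = int N" using I by (simp add: sem_scalar_frame)
    have "I (Suc c) ?t'"
    proof (cases "cell t 0 xhit = 1")
      case True
      then have "?t' = ?t" using step(1) by simp
      then show ?thesis using I True by (simp add: I_def upd_eq)
    next
      case False
      then have h: "cell ?t 0 xhit = 0" using hit by simp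
      have sc: "scan f (Suc (N - Suc c)) c (vec N t) (basis_at N k t q) = ?scan"
        and rows: "\<forall>j. j < q * N \<or> (q + k) * N \<le> j \<longrightarrow> row N t j = row N s j"
        using I False N by (auto simp: I_def)
      consider "even (vec N t c)" | "odd (vec N t c)" "odd (basis_at N k t q f c c)"
        | "odd (vec N t c)" "even (basis_at N k t q f c c)" by blast
      then show ?thesis
      proof cases
        case 1
        then have "?t' = ?t" using step(1) by (simp add: upd_eq)
        then show ?thesis using 1 sc rows h by (simp add: I_def upd_eq)
      next
        case 2
        then have t': "vec N ?t' = (\<lambda>d. vec N t d - basis_at N k t q f c d)" "row N ?t' = row N t"
            "cell ?t' 0 xhit = 0"
          using step(2) h by (auto simp: upd_eq)
        have "basis_at N k ?t' = basis_at N k t" using basis_at_cong[OF t'(2)] .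
        then show ?thesis using 2 sc rows t' by (simp add: I_def)
      next
        case 3
        then have t': "vec N ?t' = vec N t" "row N ?t' = (row N t)((q + f) * N + c := vec N t)"
            "cell ?t' 0 xhit = 1"
          using step(3) h by (auto simp: upd_eq)
        have "basis_at N k ?t' q = (basis_at N k t q)(f := (basis_at N k t q f)(c := vec N t))"
          by (rule basis_at_store[OF t'(2) c assms(6)])
        then show ?thesis using 3 sc rows t' other by (simp add: I_def)
      qed
    qed
    then show "cell ?t' 0 xN = int N \<and> I (Suc c) ?t'" using xN by blast
  next
    fix t assume "cell t 0 xN = int N \<and> I N t"
    then show "cell (upd t 0 xi (int N)) 0 xN = int N \<and> I N (upd t 0 xi (int N))"
      by (simp add: I_def upd_eq)
  qed
  then have s2: "cell s2 0 xN = int N" "I N s2" by auto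
  have fin: "sem xs scan_level s = (if 0 < 1 - cell s2 0 xhit then sem xs halve_vec s2 else s2)"
    unfolding scan_level_def s2_def s1_def by simp
  show ?thesis
  proof (cases "cell s2 0 xhit = 1")
    case True
    then show ?thesis using s2(2) by (auto simp: fin I_def)
  next
    case False
    then have h: "cell s2 0 xhit = 0" and "((\<lambda>d. vec N s2 d div 2), basis_at N k s2 q) = ?scan"
      and r: "\<forall>j. j < q * N \<or> (q + k) * N \<le> j \<longrightarrow> row N s2 j = row N s j"
      using s2(2) by (auto simp: I_def)
    moreover have "row N (sem xs halve_vec s2) = row N s2"
      by (rule row_cong) (simp add: sem_array_frame)
    ultimately show ?thesis using halve_vec[OF s2(1), of xs] basis_at_cong[of N "sem xs halve_vec s2" s2 k]
      by (simp add: fin)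
  qed
qed

lemma sift_vec:
  assumes "cell s 0 xN = int N" "cell s 0 xk = int k" "cell s 0 xnext = int q" "cell s 0 xe = int e"
    and "multiples N T s" "0 < N" "e < k" "(q + k) * N \<le> T"
  shows "basis_at N k (sem xs sift_vec s) q = sift N (k - e) e (vec N s) (basis_at N k s q) \<and>
    (\<forall>j. j < q * N \<or> (q + k) * N \<le> j \<longrightarrow> row N (sem xs sift_vec s) j = row N s j)"
  unfolding sift_vec_def
\<comment> \<open>The loop starts at level 0, but nothing happens below \<open>e\<close>;
  \<open>max e f\<close> is the level at which the sifting really stands.\<close>
proof (rule sem_For[where m = k and I = "\<lambda>f t. sift N (k - max e f) (max e f) (vec N t) (basis_at N k t q) =
      sift N (k - e) e (vec N s) (basis_at N k s q) \<and>
    (\<forall>j. j < q * N \<or> (q + k) * N \<le> j \<longrightarrow> row N t j = row N s j)"])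
  fix f t
  let ?c = "Cond (Plus (Minus (Var xf) (Var xe)) (Num 1)) scan_level Skip"
  let ?t = "upd t 0 xf (int f)"
  assume f: "f < k"
    and I: "sift N (k - max e f) (max e f) (vec N t) (basis_at N k t q) =
      sift N (k - e) e (vec N s) (basis_at N k s q) \<and>
      (\<forall>j. j < q * N \<or> (q + k) * N \<le> j \<longrightarrow> row N t j = row N s j)"
    and fr: "\<forall>y. y \<notin> insert xf (scalars ?c) \<longrightarrow> cell t 0 y = cell s 0 y"
      "\<forall>a. a \<noteq> 0 \<and> a \<notin> arrays ?c \<longrightarrow> cell t a = cell s a"
  have eq: "vec N ?t = vec N t" "row N ?t = row N t" "basis_at N k ?t = basis_at N k t"
    by (auto intro!: vec_cong row_cong basis_at_cong)
  have pre: "cell ?t 0 xN = int N" "cell ?t 0 xnext = int q" "cell ?t 0 xf = int f" "multiples N T ?t"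
      "cell ?t 0 xe = int e"
    using fr assms multiples_cong[of ?t s N T] by auto
  show "sift N (k - max e (Suc f)) (max e (Suc f)) (vec N (sem xs ?c ?t)) (basis_at N k (sem xs ?c ?t) q) =
      sift N (k - e) e (vec N s) (basis_at N k s q) \<and>
      (\<forall>j. j < q * N \<or> (q + k) * N \<le> j \<longrightarrow> row N (sem xs ?c ?t) j = row N s j)"
  proof (cases "e \<le> f")
    case False
    then have "sem xs ?c ?t = ?t" "max e (Suc f) = max e f" using pre by auto
    then show ?thesis using I eq by simp
  next
    case True
    then have "sem xs ?c ?t = sem xs scan_level ?t" "max e (Suc f) = Suc f" "max e f = f" using pre by auto
    moreover have "k - f = Suc (k - Suc f)" using f by simp
    ultimately show ?thesis
      using scan_level[OF pre(1-4) assms(6) f assms(8), of xs] I eq by simp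
  qed
next
  fix t
  have eq: "row N (upd t 0 xf (int k)) = row N t" "basis_at N k (upd t 0 xf (int k)) = basis_at N k t"
    by (auto intro!: row_cong basis_at_cong)
  assume "sift N (k - max e k) (max e k) (vec N t) (basis_at N k t q) =
      sift N (k - e) e (vec N s) (basis_at N k s q) \<and>
      (\<forall>j. j < q * N \<or> (q + k) * N \<le> j \<longrightarrow> row N t j = row N s j)"
  then show "basis_at N k (upd t 0 xf (int k)) q = sift N (k - e) e (vec N s) (basis_at N k s q) \<and>
      (\<forall>j. j < q * N \<or> (q + k) * N \<le> j \<longrightarrow> row N (upd t 0 xf (int k)) j = row N s j)"
    using assms(7) eq by (simp add: max_def)
qed (use assms in auto)

section \<open>Exterior products computed with additions only\<close>

lemma frame_simps_wedge [simp]: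
  "scalars times_y = {xprod, xz, xacc}" "arrays times_y = {}"
  "scalars wedge_digit = {xprod, xz, xacc, xrest, xsign, xpow}" "arrays wedge_digit = {}"
  "scalars wedge_coordinate = {xprod, xz, xacc, xrest, xsign, xpow, xi, 0}"
  "arrays wedge_coordinate = {aOut}"
  "scalars wedge_vec = {xprod, xz, xacc, xrest, xsign, xpow, xi, 0, xhalf, xS, xd}"
  "arrays wedge_vec = {aOut, aVec}"
  "scalars wedge_selected = {xprod, xz, xacc, xrest, xsign, xpow, xi, 0, xhalf, xS, xd, xmask, xj, xy}"
  "arrays wedge_selected = {aOut, aVec}"
  unfolding times_y_def wedge_digit_def wedge_coordinate_def wedge_vec_def wedge_selected_def
    by auto

lemma times_y:
  assumes "cell s 0 xn = int n" "cell s 0 xy = int y" "y < n"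
  shows "cell (sem xs times_y s) 0 xacc = cell s 0 xacc * int y"
proof -
  let ?c = "Cond (Minus (Var xy) (Var xz)) (Assign xprod (Plus (Var xprod) (Var xacc))) Skip"
  define s1 where "s1 = upd s 0 xprod 0"
  have "cell (sem xs (For xz xn ?c) s1) 0 xprod = cell s 0 xacc * int y"
  proof (rule sem_For[where m = n and I = "\<lambda>z t. cell t 0 xprod = cell s 0 xacc * int (min z y)"])
    fix z t
    assume *: "\<forall>v. v \<notin> insert xz (scalars ?c) \<longrightarrow> cell t 0 v = cell s1 0 v"
      "cell t 0 xprod = cell s 0 xacc * int (min z y)"
    then have "cell t 0 xy = int y" "cell t 0 xacc = cell s 0 xacc" using assms by (auto simp: s1_def)
    then show "cell (sem xs ?c (upd t 0 xz (int z))) 0 xprod = cell s 0 xacc * int (min (Suc z) y)"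
      using *(2) by (auto simp: min_def algebra_simps)
  next
    fix t
    assume "cell t 0 xprod = cell s 0 xacc * int (min n y)"
    then show "cell (upd t 0 xz (int n)) 0 xprod = cell s 0 xacc * int y"
      using assms(3) by (simp add: min_def)
  qed (use assms in \<open>auto simp: s1_def\<close>)
  then show ?thesis by (simp add: times_y_def s1_def del: sem.simps(6))
qed

lemma wedge_digit:
  assumes "cell s 0 xn = int n" "cell s 0 xy = int y" "y < n"
    and "cell s 0 xS = int S" "cell s 0 xrest = int m" "cell s 0 xpow = int P" "m \<le> S"
  shows "cell (sem xs wedge_digit s) 0 xacc = cell s 0 xacc * int y +
      (if P \<le> m then if 0 < cell s 0 xsign then cell s aVec (S - P) else - cell s aVec (S - P) else 0)"
    and "cell (sem xs wedge_digit s) 0 xrest = int (if P \<le> m then m - P else m)"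
    and "cell (sem xs wedge_digit s) 0 xsign = (if P \<le> m then - cell s 0 xsign else cell s 0 xsign)"
    and "cell (sem xs wedge_digit s) 0 xpow = int (P div 2)"
proof -
  define t where "t = sem xs times_y s"
  have t: "cell t 0 xacc = cell s 0 xacc * int y" "cell t 0 xS = int S" "cell t 0 xrest = int m"
    "cell t 0 xpow = int P" "cell t 0 xsign = cell s 0 xsign" "cell t aVec = cell s aVec"
    using times_y[OF assms(1-3)] assms by (auto simp: t_def sem_scalar_frame sem_array_frame)
  have "P \<le> m \<Longrightarrow> P \<le> S" using assms(7) by simp
  then show "cell (sem xs wedge_digit s) 0 xacc = cell s 0 xacc * int y +
      (if P \<le> m then if 0 < cell s 0 xsign then cell s aVec (S - P) else - cell s aVec (S - P) else 0)"
    "cell (sem xs wedge_digit s) 0 xrest = int (if P \<le> m then m - P else m)"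
    "cell (sem xs wedge_digit s) 0 xsign = (if P \<le> m then - cell s 0 xsign else cell s 0 xsign)"
    "cell (sem xs wedge_digit s) 0 xpow = int (P div 2)"
    unfolding wedge_digit_def sem.simps(4) t_def[symmetric] using t by (auto simp: zdiv_int)
qed

lemma wedge_coordinate:
  assumes "cell s 0 xn = int n" "cell s 0 xy = int y" "y < n" "cell s 0 xq = int p"
    and "cell s 0 xS = int S" "S < 2 ^ p" "cell s 0 xhalf = int (2 ^ p div 2)"
  shows "cell (sem xs wedge_coordinate s) aOut = (cell s aOut)(S := ext p (int y) (vec (2 ^ p) s) S)"
proof -
  let ?w = "vec (2 ^ p) s"
  define s1 where "s1 = upd (upd (upd (upd s 0 xacc 0) 0 xrest (int S)) 0 xpow (int (2 ^ p div 2))) 0 xsign 1"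
  \<comment> \<open>\<open>m\<close> consists of the digits of \<open>S\<close> not yet read and
    \<open>S - m\<close> of those read. The accumulator is the Horner value so far, and the rest is
    a product in the smaller rank \<open>p - i\<close> on coordinates shifted by
    \<open>S - m\<close>.\<close>
  define I where "I = (\<lambda>i t. \<exists>m. m \<le> S \<and> m < 2 ^ (p - i) \<and> cell t 0 xrest = int m \<and>
     (cell t 0 xsign = 1 \<or> cell t 0 xsign = -1) \<and> cell t 0 xpow = int (2 ^ (p - i) div 2) \<and>
     ext p (int y) ?w S = cell t 0 xacc * int y ^ (p - i) +
       cell t 0 xsign * ext (p - i) (int y) (\<lambda>d. ?w (d + (S - m))) m)"
  define s2 where "s2 = sem xs (For xi xq wedge_digit) s1"
  have "cell s2 0 xacc = ext p (int y) ?w S"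
    unfolding s2_def
  proof (rule sem_For[where m = p and I = I])
    show "cell s1 0 xq = int p" using assms by (simp add: s1_def)
    show "I 0 s1" using assms unfolding I_def by (intro exI[of _ S]) (simp add: s1_def)
  next
    fix i t
    assume i: "i < p" and "I i t"
      and fr: "\<forall>v. v \<notin> insert xi (scalars wedge_digit) \<longrightarrow> cell t 0 v = cell s1 0 v"
        "\<forall>a. a \<noteq> 0 \<and> a \<notin> arrays wedge_digit \<longrightarrow> cell t a = cell s1 a"
    define r where "r = p - Suc i"
    have r: "p - i = Suc r" "p - Suc i = r" using i by (auto simp: r_def)
    let ?t = "upd t 0 xi (int i)"
    obtain m where m: "m \<le> S" "m < 2 ^ Suc r" "cell ?t 0 xrest = int m"
      "cell ?t 0 xsign = 1 \<or> cell ?t 0 xsign = -1" "cell ?t 0 xpow = int (2 ^ r)"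
      and eq: "ext p (int y) ?w S = cell ?t 0 xacc * int y ^ Suc r +
       cell ?t 0 xsign * ext (Suc r) (int y) (\<lambda>d. ?w (d + (S - m))) m"
      using \<open>I i t\<close> unfolding I_def r by auto
    have pre: "cell ?t 0 xn = int n" "cell ?t 0 xy = int y" "cell ?t 0 xS = int S"
      "cell ?t aVec = cell s aVec"
      using fr assms by (auto simp: s1_def)
    note digit = wedge_digit[OF pre(1,2) assms(3) pre(3) m(3,5,1), of xs]
    show "I (Suc i) (sem xs wedge_digit ?t)"
    proof (cases "2 ^ r \<le> m")
      case True
      define m' where "m' = m - 2 ^ r"
      have shift: "(\<lambda>d. ?w (d + 2 ^ r + (S - m))) = (\<lambda>d. ?w (d + (S - m')))"
        using True m(1) by (auto simp: m'_def algebra_simps)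
      have "?w (m' + (S - m)) = cell s aVec (S - 2 ^ r)"
        using True m(1) assms(6) by (simp add: m'_def vec_def)
      then have e: "ext (Suc r) (int y) (\<lambda>d. ?w (d + (S - m))) m =
          int y ^ r * cell s aVec (S - 2 ^ r) - ext r (int y) (\<lambda>d. ?w (d + (S - m'))) m'"
        using True shift by (simp add: m'_def)
      have "cell (sem xs wedge_digit ?t) 0 xacc = cell ?t 0 xacc * int y + cell ?t 0 xsign * cell s aVec (S - 2 ^ r)"
        using digit(1) True m(4) pre(4) by auto
      then have "ext p (int y) ?w S = cell (sem xs wedge_digit ?t) 0 xacc * int y ^ r +
          cell (sem xs wedge_digit ?t) 0 xsign * ext r (int y) (\<lambda>d. ?w (d + (S - m'))) m'"
        using eq digit(3) True unfolding e by (simp add: algebra_simps)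
      moreover have "m' \<le> S" "m' < 2 ^ r" using m True by (auto simp: m'_def)
      moreover have "cell (sem xs wedge_digit ?t) 0 xrest = int m'" using digit(2) True by (simp add: m'_def)
      moreover have "cell (sem xs wedge_digit ?t) 0 xsign = 1 \<or> cell (sem xs wedge_digit ?t) 0 xsign = -1"
        using digit(3) True m(4) by auto
      ultimately show ?thesis using digit(4) unfolding I_def r by (intro exI[of _ m']) simp
    next
      case False
      then have "ext p (int y) ?w S = cell (sem xs wedge_digit ?t) 0 xacc * int y ^ r +
          cell (sem xs wedge_digit ?t) 0 xsign * ext r (int y) (\<lambda>d. ?w (d + (S - m))) m"
        using eq digit(1,3) by (simp add: algebra_simps)
      then show ?thesis using False digit(2-4) m unfolding I_def r by (intro exI[of _ m]) simp
    qed
  next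
    fix t assume "I p t"
    then show "cell (upd t 0 xi (int p)) 0 xacc = ext p (int y) ?w S" unfolding I_def by auto
  qed
  moreover have "cell s2 0 xS = int S" "cell s2 aOut = cell s aOut"
    unfolding s2_def using assms(5) by (auto simp: sem_scalar_frame sem_array_frame s1_def simp del: sem.simps(6))
  moreover have "sem xs wedge_coordinate s = sem xs (Put aOut (Var xS) (Var xacc)) s2"
    unfolding wedge_coordinate_def s2_def s1_def using assms by simp
  ultimately show ?thesis by (simp add: fun_eq_iff)
qed

lemma wedge_vec:
  assumes "cell s 0 xn = int n" "cell s 0 xy = int y" "y < n" "cell s 0 xq = int p"
    and "cell s 0 xN = int (2 ^ p)"
  shows "vec (2 ^ p) (sem xs wedge_vec s) = wedge p (int y) (vec (2 ^ p) s)"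
proof -
  let ?w = "vec (2 ^ p) s" and ?copy = "Put aVec (Var xd) (Arr aOut (Var xd))"
  define s1 where "s1 = upd s 0 xhalf (int (2 ^ p div 2))"
  define s2 where "s2 = sem xs (For xS xN wedge_coordinate) s1"
  have s2: "\<forall>S<2 ^ p. cell s2 aOut S = ext p (int y) ?w S"
    unfolding s2_def
  proof (rule sem_For[where m = "2 ^ p" and I = "\<lambda>i t. \<forall>S<i. cell t aOut S = ext p (int y) ?w S"])
    fix S t
    assume S: "S < 2 ^ p" and I: "\<forall>T<S. cell t aOut T = ext p (int y) ?w T"
      and fr: "\<forall>v. v \<notin> insert xS (scalars wedge_coordinate) \<longrightarrow> cell t 0 v = cell s1 0 v"
        "\<forall>a. a \<noteq> 0 \<and> a \<notin> arrays wedge_coordinate \<longrightarrow> cell t a = cell s1 a"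
    let ?t = "upd t 0 xS (int S)"
    have pre: "cell ?t 0 xn = int n" "cell ?t 0 xy = int y" "cell ?t 0 xq = int p" "cell ?t 0 xS = int S"
      "cell ?t 0 xhalf = int (2 ^ p div 2)"
      using fr assms by (auto simp: s1_def)
    have "vec (2 ^ p) ?t = ?w" by (rule vec_cong) (use fr in \<open>simp add: s1_def\<close>)
    then show "\<forall>T<Suc S. cell (sem xs wedge_coordinate ?t) aOut T = ext p (int y) ?w T"
      using wedge_coordinate[OF pre(1,2) assms(3) pre(3,4) S pre(5), of xs] I by (simp add: less_Suc_eq)
  qed (use assms in \<open>auto simp: s1_def\<close>)
  have xN: "cell s2 0 xN = int (2 ^ p)"
    unfolding s2_def using assms(5) by (simp add: sem_scalar_frame s1_def del: sem.simps(6))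
  have "vec (2 ^ p) (sem xs (For xd xN ?copy) s2) = wedge p (int y) ?w"
  proof (rule sem_For[where m = "2 ^ p" and I = "\<lambda>i t. \<forall>S<i. cell t aVec S = cell s2 aOut S"])
    fix i t
    assume "\<forall>S<i. cell t aVec S = cell s2 aOut S" "\<forall>a. a \<noteq> 0 \<and> a \<notin> arrays ?copy \<longrightarrow> cell t a = cell s2 a"
    then show "\<forall>S<Suc i. cell (sem xs ?copy (upd t 0 xd (int i))) aVec S = cell s2 aOut S"
      by (simp add: less_Suc_eq)
  next
    fix t
    assume "\<forall>S<2 ^ p. cell t aVec S = cell s2 aOut S"
    then show "vec (2 ^ p) (upd t 0 xd (int (2 ^ p))) = wedge p (int y) ?w"
      using s2 by (auto simp: vec_def wedge_def)
  qed (use xN in auto)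
  moreover have "sem xs wedge_vec s = sem xs (For xd xN ?copy) s2"
    unfolding wedge_vec_def s2_def s1_def using assms(5) by (simp add: zdiv_int)
  ultimately show ?thesis by simp
qed

definition is_queue :: "state \<Rightarrow> nat list \<Rightarrow> bool" where
  "is_queue s L \<longleftrightarrow> cell s 0 xlen = int (length L) \<and> (\<forall>j<length L. cell s aQueue j = int (L ! j))"

text \<open>Only \<open>p\<close> queue positions are visited, and digits of the mask beyond the end
  of the queue have no effect.\<close>

lemma wedge_selected:
  assumes "cell s 0 xn = int n" "cell s 0 xq = int p" "cell s 0 xN = int (2 ^ p)"
    and "cell s 0 xm = int m" "is_queue s L" "set L \<subseteq> {..<n}"
  shows "vec (2 ^ p) (sem xs wedge_selected s) = wedges p (sel m (take p L)) (vec (2 ^ p) s)"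
proof -
  let ?c = "Cond (odd_expr (Var xmask))
          (Cond (Minus (Var xlen) (Var xj)) (Assign xy (Arr aQueue (Var xj)) ;; wedge_vec) Skip) Skip ;;
        Assign xmask (Halve (Var xmask))"
  let ?Q = "take p L"
  define s1 where "s1 = upd s 0 xmask (int m)"
  have "vec (2 ^ p) (sem xs (For xj xq ?c) s1) = wedges p (sel m ?Q) (vec (2 ^ p) s)"
  proof (rule sem_For[where m = p and I = "\<lambda>j t. cell t 0 xmask = int (m div 2 ^ j) \<and>
      wedges p (sel (m div 2 ^ j) (drop j ?Q)) (vec (2 ^ p) t) = wedges p (sel m ?Q) (vec (2 ^ p) s)"])
    show "cell s1 0 xq = int p" using assms by (simp add: s1_def)
    have "vec (2 ^ p) s1 = vec (2 ^ p) s" by (rule vec_cong) (simp add: s1_def)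
    then show "cell s1 0 xmask = int (m div 2 ^ 0) \<and>
      wedges p (sel (m div 2 ^ 0) (drop 0 ?Q)) (vec (2 ^ p) s1) = wedges p (sel m ?Q) (vec (2 ^ p) s)"
      by (simp add: s1_def)
  next
    fix j t
    assume j: "j < p" and I: "cell t 0 xmask = int (m div 2 ^ j) \<and>
        wedges p (sel (m div 2 ^ j) (drop j ?Q)) (vec (2 ^ p) t) = wedges p (sel m ?Q) (vec (2 ^ p) s)"
      and fr: "\<forall>v. v \<notin> insert xj (scalars ?c) \<longrightarrow> cell t 0 v = cell s1 0 v"
        "\<forall>a. a \<noteq> 0 \<and> a \<notin> arrays ?c \<longrightarrow> cell t a = cell s1 a"
    let ?t = "upd t 0 xj (int j)"
    define M where "M = m div 2 ^ j"
    note I = I[folded M_def]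
    have pre: "cell ?t 0 xn = int n" "cell ?t 0 xq = int p" "cell ?t 0 xN = int (2 ^ p)"
       "cell ?t 0 xlen = int (length L)" "cell ?t aQueue = cell s aQueue" "cell ?t 0 xmask = int M"
       "cell ?t 0 xj = int j"
      using fr assms I by (auto simp: s1_def is_queue_def)
    have eq: "vec (2 ^ p) (upd t' 0 x z) = vec (2 ^ p) t'" for t' x z by (rule vec_cong) simp
    have half: "m div 2 ^ Suc j = M div 2" by (simp only: power_Suc2 div_mult2_eq M_def)
    show "cell (sem xs ?c ?t) 0 xmask = int (m div 2 ^ Suc j) \<and>
        wedges p (sel (m div 2 ^ Suc j) (drop (Suc j) ?Q)) (vec (2 ^ p) (sem xs ?c ?t)) = wedges p (sel m ?Q) (vec (2 ^ p) s)"
    proof (cases "j < length L")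
      case False
      then have "sem xs ?c ?t = upd ?t 0 xmask (int (m div 2 ^ Suc j))"
        using pre unfolding half by (simp add: zdiv_int)
      moreover have "drop j ?Q = []" "drop (Suc j) ?Q = []" using False by auto
      ultimately show ?thesis using I by (simp add: eq)
    next
      case True
      have drop: "drop j ?Q = L ! j # drop (Suc j) ?Q" using True j
        by (metis Cons_nth_drop_Suc length_take min_less_iff_conj nth_take)
      show ?thesis
      proof (cases "odd M")
        case False
        then have "sem xs ?c ?t = upd ?t 0 xmask (int (m div 2 ^ Suc j))"
          using pre unfolding half by (simp add: zdiv_int)
        then show ?thesis using I False unfolding drop half by (simp add: eq)
      next
        case odd: True
        define t1 where "t1 = upd ?t 0 xy (int (L ! j))"
        have "cell s aQueue j = int (L ! j)" using assms(5) True by (simp add: is_queue_def)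
        then have "sem xs ?c ?t = upd (sem xs wedge_vec t1) 0 xmask (int (m div 2 ^ Suc j))"
          using odd True pre unfolding half by (simp add: zdiv_int t1_def sem_scalar_frame)
        moreover have "L ! j < n" using assms(6) True nth_mem by blast
        then have "vec (2 ^ p) (sem xs wedge_vec t1) = wedge p (int (L ! j)) (vec (2 ^ p) t1)"
          by (rule wedge_vec[rotated 2]) (use pre in \<open>auto simp: t1_def\<close>)
        moreover have "vec (2 ^ p) t1 = vec (2 ^ p) t" by (simp add: t1_def eq)
        ultimately show ?thesis using I odd unfolding drop half by (simp add: eq wedges_Cons)
      qed
    qed
  next
    fix t assume "cell t 0 xmask = int (m div 2 ^ p) \<and>
        wedges p (sel (m div 2 ^ p) (drop p ?Q)) (vec (2 ^ p) t) = wedges p (sel m ?Q) (vec (2 ^ p) s)"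
    moreover have "vec (2 ^ p) (upd t 0 xj (int p)) = vec (2 ^ p) t" by (rule vec_cong) simp
    ultimately show "vec (2 ^ p) (upd t 0 xj (int p)) = wedges p (sel m ?Q) (vec (2 ^ p) s)" by simp
  qed
  then show ?thesis unfolding wedge_selected_def s1_def using assms(4) by (simp del: sem.simps(6))
qed

text \<open>What the rounds maintain for the basis of the products of \<open>i\<close> sets.\<close>

definition good :: "nat \<Rightarrow> nat \<Rightarrow> (nat \<Rightarrow> nat set) \<Rightarrow> nat \<Rightarrow> nat \<Rightarrow> basis \<Rightarrow> bool" where
  "good p k U n i B \<longleftrightarrow> echelon B \<and> saturated (2 ^ p) k B 0 \<and>
     (\<forall>f c. generated p U n i (\<lambda>d. 2 ^ f * B f c d)) \<and> (\<forall>f c. \<forall>d\<ge>2 ^ p. B f c d = 0)"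

text \<open>Levels below \<open>e\<close> keep their rows, and their saturation survives because
  spans only grow; soundness comes from \<open>sift_closed\<close>.\<close>

lemma good_sift:
  assumes "good p k U n i B" "e < k" "generated p U n i (\<lambda>d. 2 ^ e * v d)" "\<And>d. 2 ^ p \<le> d \<Longrightarrow> v d = 0"
  shows "good p k U n i (sift (2 ^ p) (k - e) e v B) \<and> extends B (sift (2 ^ p) (k - e) e v B) \<and>
     v \<in> lspan (2 ^ p) (sift (2 ^ p) (k - e) e v B) (k - e) e"
proof -
  let ?B = "sift (2 ^ p) (k - e) e v B"
  have B: "echelon B" "saturated (2 ^ p) k B 0" "\<And>f c. generated p U n i (\<lambda>d. 2 ^ f * B f c d)"
      "\<And>f c d. 2 ^ p \<le> d \<Longrightarrow> B f c d = 0"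
    using assms(1) by (auto simp: good_def)
  have "saturated (2 ^ p) k B e" using B(2) by (simp add: saturated_def)
  from sift_correct[OF B(1) _ this, of "k - e" v] assms(2)
  have s: "echelon ?B" "extends B ?B" "\<And>f. f < e \<Longrightarrow> ?B f = B f" "v \<in> lspan (2 ^ p) ?B (k - e) e"
      "saturated (2 ^ p) k ?B e"
    by auto
  have "saturated (2 ^ p) k ?B 0"
    unfolding saturated_def
  proof (intro allI impI)
    fix f c :: nat assume fc: "0 \<le> f \<and> f < k \<and> c < 2 ^ p"
    show "?B f c \<in> lspan (2 ^ p) ?B (k - Suc f) (Suc f)"
    proof (cases "e \<le> f")
      case True
      then show ?thesis using s(5) fc by (simp add: saturated_def)
    next
      case False
      then have "?B f c = B f c" using s(3)[of f] by simp
      moreover have "B f c \<in> lspan (2 ^ p) B (k - Suc f) (Suc f)" using B(2) fc by (simp add: saturated_def)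
      ultimately show ?thesis using lspan_mono[OF s(2)] by simp
    qed
  qed
  moreover have "(\<forall>f c. generated p U n i (\<lambda>d. 2 ^ f * ?B f c d)) \<and> (\<forall>f c. \<forall>d\<ge>2 ^ p. ?B f c d = 0)"
    by (rule sift_closed[where P = "generated p U n i"]) (use B assms generated.diff in auto)
  ultimately show ?thesis using s by (simp add: good_def)
qed

section \<open>Inserting the products with one set\<close>

lemma frame_simps_insert [simp]:
  "scalars insert_product = {xprod, xz, xacc, xrest, xsign, xpow, xi, 0, xhalf, xS, xd, xmask, xj, xy,
     xrow, xhit, xbase, xf}"
  "arrays insert_product = {aOut, aVec, aRow}"
  "scalars insert_products = {xprod, xz, xacc, xrest, xsign, xpow, xi, 0, xhalf, xS, xd, xmask, xj, xy,
     xrow, xhit, xbase, xf, xm, xe, xc}"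
  "arrays insert_products = {aOut, aVec, aRow}"
  unfolding insert_product_def insert_products_def by auto

definition same_setting :: "state \<Rightarrow> state \<Rightarrow> bool" where
  "same_setting s t \<longleftrightarrow> (\<forall>y\<in>{xN, xk, xq, xn, xcur, xnext, xlen}. cell t 0 y = cell s 0 y) \<and>
     cell t aMul = cell s aMul \<and> cell t aQueue = cell s aQueue"

lemma insert_products:
  assumes const: "cell s 0 xN = int (2 ^ p)" "cell s 0 xk = int k" "cell s 0 xq = int p" "cell s 0 xn = int n"
      "cell s 0 xcur = int q" "cell s 0 xnext = int (q + k)"
    and tab: "multiples (2 ^ p) T s" "(q + k + k) * 2 ^ p \<le> T"
    and queue: "is_queue s L" "set L \<subseteq> {..<n}" "set (take p L) \<subseteq> U v" "v < n"
    and good: "good p k U n i (basis_at (2 ^ p) k s q)" "good p k U n (Suc i) (basis_at (2 ^ p) k s (q + k))"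
  shows "good p k U n (Suc i) (basis_at (2 ^ p) k (sem xs insert_products s) (q + k)) \<and>
    extends (basis_at (2 ^ p) k s (q + k)) (basis_at (2 ^ p) k (sem xs insert_products s) (q + k)) \<and>
    (\<forall>j. j < (q + k) * 2 ^ p \<or> (q + k + k) * 2 ^ p \<le> j \<longrightarrow>
       row (2 ^ p) (sem xs insert_products s) j = row (2 ^ p) s j) \<and>
    (\<forall>m<2 ^ p. \<forall>e<k. \<forall>c<2 ^ p. wedges p (sel m (take p L)) (basis_at (2 ^ p) k s q e c) \<in>
       lspan (2 ^ p) (basis_at (2 ^ p) k (sem xs insert_products s) (q + k)) (k - e) e)"
proof -
  let ?N = "2 ^ p :: nat"
  let ?B0 = "basis_at ?N k s q"
  let ?w = "\<lambda>m e c. wedges p (sel m (take p L)) (?B0 e c)"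
  \<comment> \<open>\<open>D\<close> collects the triples of mask, level and coordinate treated so
    far. Since the new basis is only extended, products spanned once remain spanned, and the three
    nested loops simply enlarge \<open>D\<close>.\<close>
  define inv where "inv = (\<lambda>D t. same_setting s t \<and> good p k U n (Suc i) (basis_at ?N k t (q + k)) \<and>
    extends (basis_at ?N k s (q + k)) (basis_at ?N k t (q + k)) \<and>
    (\<forall>j. j < (q + k) * ?N \<or> (q + k + k) * ?N \<le> j \<longrightarrow> row ?N t j = row ?N s j) \<and>
    (\<forall>(m, e, c)\<in>D. ?w m e c \<in> lspan ?N (basis_at ?N k t (q + k)) (k - e) e))"
  have inv_upd: "inv D (upd t 0 x z) \<longleftrightarrow> inv D t" if "x \<notin> {xN, xk, xq, xn, xcur, xnext, xlen}" for D t x z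
  proof -
    have "row ?N (upd t 0 x z) = row ?N t" by (rule row_cong) simp
    moreover from this have "basis_at ?N k (upd t 0 x z) = basis_at ?N k t" by (rule basis_at_cong)
    moreover have "same_setting s (upd t 0 x z) \<longleftrightarrow> same_setting s t"
      using that by (auto simp: same_setting_def)
    ultimately show ?thesis by (simp add: inv_def)
  qed
  have one: "inv (insert (m, e, c) D) (sem xs insert_product t)"
    if inv: "inv D t" and vars: "cell t 0 xm = int m" "cell t 0 xe = int e" "cell t 0 xc = int c"
      and less: "e < k" "c < ?N" for D t m e c
  proof -
    have set: "same_setting s t" using inv by (simp add: inv_def)
    have t: "cell t 0 xN = int ?N" "cell t 0 xk = int k" "cell t 0 xq = int p" "cell t 0 xn = int n"
      "cell t 0 xcur = int q" "cell t 0 xnext = int (q + k)" "is_queue t L" "multiples ?N T t"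
      using set const queue(1) multiples_cong[of t s ?N T] tab(1) by (auto simp: same_setting_def is_queue_def)
    let ?j = "(q + e) * ?N + c"
    \<comment> \<open>The row that is read lies in the old basis, below everything that the sifting
      writes.\<close>
    have j: "?j < (q + k) * ?N" using slot_bound[OF less] by blast
    also have "\<dots> \<le> (q + k + k) * ?N" by (intro mult_right_mono) auto
    finally have jT: "?j < T" using tab(2) by linarith
    have "q + e \<le> (q + e) * ?N" by simp
    then have qT: "q + e < T" using jT by linarith
    define t1 where "t1 = sem xs (Assign xrow (Arr aMul (Plus (Arr aMul (Plus (Var xcur) (Var xe))) (Var xc)))) t"
    define t2 where "t2 = sem xs load_row t1"
    define t3 where "t3 = sem xs wedge_selected t2"
    define t4 where "t4 = sem xs sift_vec t3"
    have t4: "sem xs insert_product t = t4"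
      by (simp add: insert_product_def t1_def t2_def t3_def t4_def)
    have "rd t aMul (int q + int e) = int ((q + e) * ?N)" "rd t aMul (int ((q + e) * ?N) + int c) = int (?j * ?N)"
      using t(8) qT jT unfolding rd_add multiples_def by blast+
    then have row1: "cell t1 0 xrow = int (?j * ?N)" using t(5) vars by (simp add: t1_def)
    have fr1: "cell t1 0 y = cell t 0 y" if "y \<noteq> xrow" for y using that by (simp add: t1_def)
    have fa1: "cell t1 a = cell t a" if "a \<noteq> 0" for a using that by (simp add: t1_def)
    have "vec ?N t2 = row ?N t1 ?j"
      unfolding t2_def by (rule load_row) (use fr1 t(1) row1 in auto)
    also have "row ?N t1 = row ?N t" by (rule row_cong) (simp add: fa1)
    also have "row ?N t ?j = row ?N s ?j" using inv j by (simp add: inv_def)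
    also have "\<dots> = ?B0 e c" using less by (simp add: basis_at_def)
    finally have v2: "vec ?N t2 = ?B0 e c" .
    have fr2: "cell t2 0 y = cell t 0 y" if "y \<notin> {xd, 0, xrow}" for y
      using that fr1 by (simp add: t2_def sem_scalar_frame)
    have fa2: "cell t2 a = cell t a" if "a \<notin> {0, aVec}" for a
      using that fa1 by (simp add: t2_def sem_array_frame)
    have v3: "vec ?N t3 = ?w m e c"
      unfolding t3_def v2[symmetric]
      by (rule wedge_selected) (use fr2 fa2 t vars queue(2) in \<open>auto simp: is_queue_def\<close>)
    have fr3: "cell t3 0 y = cell t 0 y" if "y \<notin> insert xrow (scalars wedge_selected)" for y
      using that fr2 by (simp add: t3_def sem_scalar_frame)
    have fa3: "cell t3 a = cell t a" if "a \<notin> {0, aVec, aOut}" for a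
      using that fa2 by (simp add: t3_def sem_array_frame)
    have row3: "row ?N t3 = row ?N t" by (rule row_cong) (simp add: fa3)
    have B3: "basis_at ?N k t3 = basis_at ?N k t" by (rule basis_at_cong[OF row3])
    have pre: "cell t3 0 xN = int ?N" "cell t3 0 xk = int k" "cell t3 0 xnext = int (q + k)" "cell t3 0 xe = int e"
      "multiples ?N T t3"
      using fr3 t vars multiples_cong[of t3 t ?N T] fa3 by auto
    have sifted: "basis_at ?N k t4 (q + k) = sift ?N (k - e) e (?w m e c) (basis_at ?N k t (q + k))"
      and rows: "\<forall>j. j < (q + k) * ?N \<or> (q + k + k) * ?N \<le> j \<longrightarrow> row ?N t4 j = row ?N t j"
      using sift_vec[OF pre _ less(1) tab(2), of xs] unfolding t4_def[symmetric] v3 B3 row3 by auto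
    have cut: "?B0 e c d = 0" if "?N \<le> d" for d
      using that less by (simp add: basis_at_def row_def)
    have "generated p U n i (\<lambda>d. 2 ^ e * ?B0 e c d)" using good(1) by (simp add: good_def)
    from generated_wedges[OF this queue(4) order_trans[OF set_sel queue(3)]]
    have "generated p U n (Suc i) (\<lambda>d. 2 ^ e * ?w m e c d)" by (simp add: wedges_scale)
    from good_sift[OF _ less(1) this, of "basis_at ?N k t (q + k)"] wedges_cut[OF cut] inv
    have g: "good p k U n (Suc i) (basis_at ?N k t4 (q + k))"
      and ext: "extends (basis_at ?N k t (q + k)) (basis_at ?N k t4 (q + k))"
      and new: "?w m e c \<in> lspan ?N (basis_at ?N k t4 (q + k)) (k - e) e"
      unfolding sifted inv_def by auto
    have "same_setting s t4"
      using set fr3 fa3 unfolding t4_def same_setting_def by (simp add: sem_scalar_frame sem_array_frame)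
    moreover have "extends (basis_at ?N k s (q + k)) (basis_at ?N k t4 (q + k))"
      using extends_trans[OF _ ext] inv by (simp add: inv_def)
    moreover have "\<forall>(m, e, c)\<in>insert (m, e, c) D. ?w m e c \<in> lspan ?N (basis_at ?N k t4 (q + k)) (k - e) e"
      using inv new lspan_mono[OF ext] unfolding inv_def by blast
    ultimately show ?thesis using g rows inv unfolding t4 inv_def by simp
  qed
  have two: "inv (D \<union> {m} \<times> {e} \<times> {..<?N}) (sem xs (For xc xN insert_product) t)"
    if inv: "inv D t" and vars: "cell t 0 xm = int m" "cell t 0 xe = int e" and less: "e < k" for D t m e
  proof (rule sem_For[where m = ?N and I = "\<lambda>c. inv (D \<union> {m} \<times> {e} \<times> {..<c})"])
    show "cell t 0 xN = int ?N" using inv const by (simp add: inv_def same_setting_def)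
  next
    fix c t'
    assume c: "c < ?N" "inv (D \<union> {m} \<times> {e} \<times> {..<c}) t'"
      "\<forall>y. y \<notin> insert xc (scalars insert_product) \<longrightarrow> cell t' 0 y = cell t 0 y"
    have "inv (insert (m, e, c) (D \<union> {m} \<times> {e} \<times> {..<c})) (sem xs insert_product (upd t' 0 xc (int c)))"
      by (rule one) (use c vars less in \<open>auto simp: inv_upd\<close>)
    moreover have "insert (m, e, c) (D \<union> {m} \<times> {e} \<times> {..<c}) = D \<union> {m} \<times> {e} \<times> {..<Suc c}"
      by (auto simp: less_Suc_eq)
    ultimately show "inv (D \<union> {m} \<times> {e} \<times> {..<Suc c}) (sem xs insert_product (upd t' 0 xc (int c)))"
      by simp
  qed (use inv in \<open>auto simp: inv_upd\<close>)
  have three: "inv (D \<union> {m} \<times> {..<k} \<times> {..<?N}) (sem xs (For xe xk (For xc xN insert_product)) t)"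
    if inv: "inv D t" and vars: "cell t 0 xm = int m" for D t m
  proof (rule sem_For[where m = k and I = "\<lambda>e. inv (D \<union> {m} \<times> {..<e} \<times> {..<?N})"])
    show "cell t 0 xk = int k" using inv const by (simp add: inv_def same_setting_def)
  next
    fix e t'
    assume e: "e < k" "inv (D \<union> {m} \<times> {..<e} \<times> {..<?N}) t'"
      "\<forall>y. y \<notin> insert xe (scalars (For xc xN insert_product)) \<longrightarrow> cell t' 0 y = cell t 0 y"
    have "inv ((D \<union> {m} \<times> {..<e} \<times> {..<?N}) \<union> {m} \<times> {e} \<times> {..<?N}) (sem xs (For xc xN insert_product) (upd t' 0 xe (int e)))"
      by (rule two) (use e vars in \<open>auto simp: inv_upd\<close>)
    moreover have "(D \<union> {m} \<times> {..<e} \<times> {..<?N}) \<union> {m} \<times> {e} \<times> {..<?N} = D \<union> {m} \<times> {..<Suc e} \<times> {..<?N}"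
      by (auto simp: less_Suc_eq)
    ultimately show "inv (D \<union> {m} \<times> {..<Suc e} \<times> {..<?N}) (sem xs (For xc xN insert_product) (upd t' 0 xe (int e)))"
      by simp
  qed (use inv in \<open>auto simp: inv_upd\<close>)
  have "inv ({..<?N} \<times> {..<k} \<times> {..<?N}) (sem xs insert_products s)"
    unfolding insert_products_def
  proof (rule sem_For[where m = ?N and I = "\<lambda>m. inv ({..<m} \<times> {..<k} \<times> {..<?N})"])
    show "inv ({..<0} \<times> {..<k} \<times> {..<?N}) s" using good(2) by (simp add: inv_def same_setting_def)
  next
    fix m t'
    assume m: "m < ?N" "inv ({..<m} \<times> {..<k} \<times> {..<?N}) t'"
    have "inv (({..<m} \<times> {..<k} \<times> {..<?N}) \<union> {m} \<times> {..<k} \<times> {..<?N}) (sem xs (For xe xk (For xc xN insert_product)) (upd t' 0 xm (int m)))"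
      by (rule three) (use m in \<open>auto simp: inv_upd\<close>)
    moreover have "({..<m} \<times> {..<k} \<times> {..<?N}) \<union> {m} \<times> {..<k} \<times> {..<?N} = {..<Suc m} \<times> {..<k} \<times> {..<?N}"
      by (auto simp: less_Suc_eq)
    ultimately show "inv ({..<Suc m} \<times> {..<k} \<times> {..<?N}) (sem xs (For xe xk (For xc xN insert_product)) (upd t' 0 xm (int m)))"
      by simp
  qed (use const in \<open>auto simp: inv_upd\<close>)
  then show ?thesis unfolding inv_def by auto
qed

section \<open>Search\<close>

lemma frame_simps_search [simp]:
  "scalars start_search = {xlen, xx, xt, 0}" "arrays start_search = {aSeen, aQueue}"
  "scalars visit = {xlen, 0}" "arrays visit = {aSeen, aQueue}"
  "scalars search = {xlen, xx, xt, 0, xj, xu, xw}" "arrays search = {aSeen, aQueue}"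
  unfolding start_search_def visit_def search_def by auto

definition line_table :: "nat \<Rightarrow> state \<Rightarrow> bool" where
  "line_table n s \<longleftrightarrow> (\<forall>u<n. cell s aLine u = int (u * n + 3))"

definition seen :: "nat \<Rightarrow> state \<Rightarrow> nat list \<Rightarrow> nat \<Rightarrow> bool" where
  "seen n s L i \<longleftrightarrow> is_queue s L \<and> distinct L \<and> set L \<subseteq> {..<n} \<and>
     (\<forall>x<i. cell s aSeen x = (if x \<in> set L then 1 else 0))"

lemma arc_expr:
  assumes "encodes xs n E b p" "line_table n s" "cell s 0 xu = int u" "cell s 0 xw = int w" "u < n" "w < n"
  shows "eval_expr xs arc_expr s = (if E u w then 1 else 0)"
proof -
  have "rd s aLine (int u) = int (u * n + 3)" using assms(2,5) unfolding rd_int line_table_def by blast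
  then have "eval_expr xs arc_expr s = input_at xs (int (u * n + 3 + w))"
    using assms(3,4) by (simp add: arc_expr_def)
  then show ?thesis using assms(1,5,6) by (simp only: encodes_def)
qed

lemma is_queue_append:
  assumes "is_queue s L" "cell t 0 xlen = cell s 0 xlen + 1" "cell t aQueue = (cell s aQueue)(length L := int x)"
  shows "is_queue t (L @ [x])"
  using assms by (auto simp: is_queue_def nth_append less_Suc_eq)

lemma start_search:
  assumes "cell s 0 xn = int n" "cell s 0 xv = int v"
    and "\<forall>x<n. cell s aAlive x = (if x \<in> R then 1 else 0)"
  shows "\<exists>L. seen n (sem xs start_search s) L n \<and> set L = {x. x < n \<and> (x \<in> R \<or> x = v)}"
proof -
  let ?c = "Assign xt (Arr aAlive (Var xx)) ;;
        Cond (Minus (Var xx) (Var xv)) Skip (Cond (Minus (Var xv) (Var xx)) Skip (Assign xt (Num 1))) ;;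
        Put aSeen (Var xx) (Var xt) ;;
        Cond (Var xt) (Put aQueue (Var xlen) (Var xx) ;; Assign xlen (Plus (Var xlen) (Num 1))) Skip"
  define s1 where "s1 = upd s 0 xlen 0"
  have "\<exists>L. seen n (sem xs (For xx xn ?c) s1) L n \<and> set L = {x. x < n \<and> (x \<in> R \<or> x = v)}"
  proof (rule sem_For[where m = n and I = "\<lambda>i t. \<exists>L. seen n t L i \<and> set L = {x. x < i \<and> (x \<in> R \<or> x = v)}"])
    show "\<exists>L. seen n s1 L 0 \<and> set L = {x. x < 0 \<and> (x \<in> R \<or> x = v)}"
      by (intro exI[of _ "[]"]) (simp add: seen_def is_queue_def s1_def)
  next
    fix i t
    assume i: "i < n" and "\<exists>L. seen n t L i \<and> set L = {x. x < i \<and> (x \<in> R \<or> x = v)}"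
      and fr: "\<forall>y. y \<notin> insert xx (scalars ?c) \<longrightarrow> cell t 0 y = cell s1 0 y"
        "\<forall>a. a \<noteq> 0 \<and> a \<notin> arrays ?c \<longrightarrow> cell t a = cell s1 a"
    then obtain L where L: "seen n t L i" "set L = {x. x < i \<and> (x \<in> R \<or> x = v)}" by blast
    let ?t' = "sem xs ?c (upd t 0 xx (int i))"
    have v: "cell t 0 xv = int v" "cell t aAlive i = (if i \<in> R then 1 else 0)" "cell t 0 xlen = int (length L)"
      using fr assms i L(1) by (auto simp: s1_def seen_def is_queue_def)
    show "\<exists>L. seen n ?t' L (Suc i) \<and> set L = {x. x < Suc i \<and> (x \<in> R \<or> x = v)}"
    proof (cases "i \<in> R \<or> i = v")
      case True
      have t': "cell ?t' 0 xlen = cell t 0 xlen + 1" "cell ?t' aQueue = (cell t aQueue)(length L := int i)"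
        "cell ?t' aSeen = (cell t aSeen)(i := 1)"
        using v True by (auto simp: fun_eq_iff)
      have "is_queue ?t' (L @ [i])" by (rule is_queue_append[OF _ t'(1,2)]) (use L in \<open>simp add: seen_def\<close>)
      moreover have "set (L @ [i]) = {x. x < Suc i \<and> (x \<in> R \<or> x = v)}" using L(2) True by (auto simp: less_Suc_eq)
      ultimately show ?thesis using L i t'(3)
        by (intro exI[of _ "L @ [i]"]) (auto simp: seen_def less_Suc_eq)
    next
      case False
      have t': "cell ?t' 0 xlen = cell t 0 xlen" "cell ?t' aQueue = cell t aQueue"
        "cell ?t' aSeen = (cell t aSeen)(i := 0)"
        using v False by (auto simp: fun_eq_iff)
      have "set L = {x. x < Suc i \<and> (x \<in> R \<or> x = v)}" using L(2) False by (auto simp: less_Suc_eq)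
      then show ?thesis using L i t' False
        by (intro exI[of _ L]) (auto simp: seen_def is_queue_def less_Suc_eq)
    qed
  next
    fix t assume "\<exists>L. seen n t L n \<and> set L = {x. x < n \<and> (x \<in> R \<or> x = v)}"
    then show "\<exists>L. seen n (upd t 0 xx (int n)) L n \<and> set L = {x. x < n \<and> (x \<in> R \<or> x = v)}"
      by (simp add: seen_def is_queue_def)
  qed (use assms in \<open>auto simp: s1_def\<close>)
  then show ?thesis by (simp add: start_search_def s1_def del: sem.simps(6))
qed

lemma visit:
  assumes "encodes xs n E b p" "line_table n s" "cell s 0 xu = int u" "cell s 0 xw = int w" "u < n" "w < n"
    and L: "seen n s L n"
  shows "seen n (sem xs visit s) (if E u w \<and> w \<notin> set L then L @ [w] else L) n"
proof -
  note arc = arc_expr[OF assms(1-6)]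
  have len: "cell s 0 xlen = int (length L)" using L by (simp add: seen_def is_queue_def)
  have w: "cell s aSeen w = (if w \<in> set L then 1 else 0)" using L assms(6) by (simp add: seen_def)
  show ?thesis
  proof (cases "E u w \<and> w \<notin> set L")
    case True
    let ?t = "sem xs visit s"
    have t: "cell ?t 0 xlen = cell s 0 xlen + 1" "cell ?t aQueue = (cell s aQueue)(length L := int w)"
      "cell ?t aSeen = (cell s aSeen)(w := 1)"
      using arc True len w assms(4) by (auto simp: visit_def fun_eq_iff)
    have "is_queue ?t (L @ [w])" by (rule is_queue_append[OF _ t(1,2)]) (use L in \<open>simp add: seen_def\<close>)
    then show ?thesis using True L t(3) assms(6) by (auto simp: seen_def)
  next
    case False
    then have "sem xs visit s = s" using arc w assms(4) by (auto simp: visit_def)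
    then show ?thesis using False L by auto
  qed
qed

lemma search:
  assumes enc: "encodes xs n E b p" "line_table n s"
    and const: "cell s 0 xn = int n" "cell s 0 xq = int q" "cell s 0 xv = int v" "v < n"
    and alive: "\<forall>x<n. cell s aAlive x = (if x \<in> one_core n E then 1 else 0)"
  shows "\<exists>L. is_queue (sem xs search s) L \<and> distinct L \<and> set L \<subseteq> covered n E v \<and>
    (length L < q \<longrightarrow> set L = covered n E v)"
proof -
  let ?c = "Cond (Minus (Var xlen) (Var xj)) (Assign xu (Arr aQueue (Var xj)) ;; For xw xn visit) Skip"
  define s1 where "s1 = sem xs start_search s"
  have s1: "cell s1 0 xn = int n" "cell s1 0 xq = int q" "line_table n s1"
    using const enc(2) by (auto simp: s1_def sem_scalar_frame sem_array_frame line_table_def)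
  obtain L0 where L0: "seen n s1 L0 n" "set L0 = {x. x < n \<and> (x \<in> one_core n E \<or> x = v)}"
    using start_search[OF const(1,3) alive, of xs] unfolding s1_def by blast
  \<comment> \<open>Breadth-first search: the queue entries before position \<open>j\<close> have
    all their out-neighbours in the queue.\<close>
  define I where "I = (\<lambda>j t. \<exists>L. seen n t L n \<and> one_core n E \<subseteq> set L \<and> v \<in> set L \<and> set L \<subseteq> covered n E v \<and>
      (\<forall>i<j. i < length L \<longrightarrow> (\<forall>w<n. E (L ! i) w \<longrightarrow> w \<in> set L)))"
  have "I q (sem xs (For xj xq ?c) s1)"
  proof (rule sem_For[where m = q and I = I])
    have "set L0 \<subseteq> covered n E v" unfolding L0(2) covered_def using reached_refl[of v n E] by blast
    moreover have "one_core n E \<subseteq> set L0" "v \<in> set L0"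
      unfolding L0(2) using one_core_subset[of n E] const(4) by auto
    ultimately show "I 0 s1" using L0(1) unfolding I_def by auto
  next
    fix j t
    assume j: "j < q" and "I j t"
      and fr: "\<forall>y. y \<notin> insert xj (scalars ?c) \<longrightarrow> cell t 0 y = cell s1 0 y"
        "\<forall>a. a \<noteq> 0 \<and> a \<notin> arrays ?c \<longrightarrow> cell t a = cell s1 a"
    then obtain L where L: "seen n t L n" "one_core n E \<subseteq> set L" "v \<in> set L" "set L \<subseteq> covered n E v"
      and closed: "\<forall>i<j. i < length L \<longrightarrow> (\<forall>w<n. E (L ! i) w \<longrightarrow> w \<in> set L)"
      unfolding I_def by blast
    let ?t = "upd t 0 xj (int j)"
    have len: "cell t 0 xlen = int (length L)" using L by (simp add: seen_def is_queue_def)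
    show "I (Suc j) (sem xs ?c ?t)"
    proof (cases "j < length L")
      case False
      then have "sem xs ?c ?t = ?t" using len by simp
      moreover have "seen n ?t L n" using L(1) by (simp add: seen_def is_queue_def)
      ultimately show ?thesis using L closed False unfolding I_def
        by (intro exI[of _ L]) (auto simp: less_Suc_eq)
    next
      case True
      let ?u = "L ! j"
      have "cell t aQueue j = int ?u" "?u \<in> set L"
        using L True by (simp_all add: seen_def is_queue_def)
      moreover have "?u < n" using calculation L(1) unfolding seen_def by blast
      ultimately have u: "cell t aQueue j = int ?u" "?u \<in> set L" "?u < n" by simp_all
      define t1 where "t1 = upd ?t 0 xu (int ?u)"
      have c: "sem xs ?c ?t = sem xs (For xw xn visit) t1"
        using True len u(1) by (simp add: t1_def)
      have t1: "cell t1 0 xn = int n" "cell t1 0 xu = int ?u" "line_table n t1" "seen n t1 L n"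
        using fr s1 L(1) by (auto simp: t1_def line_table_def seen_def is_queue_def)
      have "\<exists>ys. seen n (sem xs (For xw xn visit) t1) (L @ ys) n \<and> set ys \<subseteq> {w. w < n \<and> E ?u w} \<and>
          {w. w < n \<and> E ?u w} \<subseteq> set (L @ ys)"
      proof (rule sem_For[where m = n and I = "\<lambda>w t'. \<exists>ys. seen n t' (L @ ys) n \<and> set ys \<subseteq> {w. w < n \<and> E ?u w} \<and>
          {w'. w' < w \<and> E ?u w'} \<subseteq> set (L @ ys)"])
        show "\<exists>ys. seen n t1 (L @ ys) n \<and> set ys \<subseteq> {w. w < n \<and> E ?u w} \<and> {w'. w' < 0 \<and> E ?u w'} \<subseteq> set (L @ ys)"
          using t1(4) by (intro exI[of _ "[]"]) simp
      next
        fix w t'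
        assume w: "w < n" and "\<exists>ys. seen n t' (L @ ys) n \<and> set ys \<subseteq> {w. w < n \<and> E ?u w} \<and>
            {w'. w' < w \<and> E ?u w'} \<subseteq> set (L @ ys)"
          and fr': "\<forall>y. y \<notin> insert xw (scalars visit) \<longrightarrow> cell t' 0 y = cell t1 0 y"
            "\<forall>a. a \<noteq> 0 \<and> a \<notin> arrays visit \<longrightarrow> cell t' a = cell t1 a"
        then obtain ys where ys: "seen n t' (L @ ys) n" "set ys \<subseteq> {w. w < n \<and> E ?u w}"
            "{w'. w' < w \<and> E ?u w'} \<subseteq> set (L @ ys)" by blast
        let ?t' = "upd t' 0 xw (int w)"
        have pre: "line_table n ?t'" "cell ?t' 0 xu = int ?u" "cell ?t' 0 xw = int w" "seen n ?t' (L @ ys) n"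
          using fr' t1 ys(1) by (auto simp: line_table_def seen_def is_queue_def)
        note v = visit[OF enc(1) pre(1-3) u(3) w pre(4)]
        show "\<exists>ys. seen n (sem xs visit ?t') (L @ ys) n \<and> set ys \<subseteq> {w. w < n \<and> E ?u w} \<and>
            {w'. w' < Suc w \<and> E ?u w'} \<subseteq> set (L @ ys)"
        proof (cases "E ?u w \<and> w \<notin> set (L @ ys)")
          case True
          then have "seen n (sem xs visit ?t') (L @ (ys @ [w])) n" using v by simp
          then show ?thesis using ys True w by (intro exI[of _ "ys @ [w]"]) (auto simp: less_Suc_eq)
        next
          case False
          then have "seen n (sem xs visit ?t') (L @ ys) n" using v by (simp only: if_False)
          then show ?thesis using ys False by (intro exI[of _ ys]) (auto simp: less_Suc_eq)
        qed
      next
        fix t' assume "\<exists>ys. seen n t' (L @ ys) n \<and> set ys \<subseteq> {w. w < n \<and> E ?u w} \<and> {w'. w' < n \<and> E ?u w'} \<subseteq> set (L @ ys)"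
        then show "\<exists>ys. seen n (upd t' 0 xw (int n)) (L @ ys) n \<and> set ys \<subseteq> {w. w < n \<and> E ?u w} \<and> {w. w < n \<and> E ?u w} \<subseteq> set (L @ ys)"
          by (simp add: seen_def is_queue_def)
      qed (use t1 in auto)
      then obtain ys where ys: "seen n (sem xs ?c ?t) (L @ ys) n" "set ys \<subseteq> {w. w < n \<and> E ?u w}"
          "{w. w < n \<and> E ?u w} \<subseteq> set (L @ ys)" unfolding c by blast
      \<comment> \<open>Both parts of \<open>covered\<close> are closed under arcs, the core by
        \<open>one_core_step\<close>.\<close>
      have "w \<in> covered n E v" if "w < n" "E ?u w" for w
        using u(2,3) L(4) that one_core_step[of ?u n E w] reached_step[of ?u n E v w] unfolding covered_def by blast
      then have "set (L @ ys) \<subseteq> covered n E v" using L(4) ys(2) by auto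
      moreover have "w \<in> set (L @ ys)" if "i < Suc j" "w < n" "E ((L @ ys) ! i) w" for i w
      proof (cases "i = j")
        case True
        then have "(L @ ys) ! i = ?u" using \<open>j < length L\<close> by (simp add: nth_append)
        then show ?thesis using ys(3) that by auto
      next
        case False
        then have "i < j" "i < length L" using that(1) \<open>j < length L\<close> by auto
        then show ?thesis using closed that by (auto simp: nth_append)
      qed
      ultimately show ?thesis using ys(1) L(2,3) unfolding I_def by (intro exI[of _ "L @ ys"]) auto
    qed
  next
    fix t assume "I q t"
    then show "I q (upd t 0 xj (int q))" unfolding I_def seen_def is_queue_def by simp
  qed (use s1 in auto)
  moreover have "sem xs search s = sem xs (For xj xq ?c) s1"
    by (simp add: search_def s1_def)
  ultimately have "I q (sem xs search s)" by simp
  then obtain L where L: "seen n (sem xs search s) L n" "one_core n E \<subseteq> set L" "v \<in> set L" "set L \<subseteq> covered n E v"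
      and closed: "\<forall>i<q. i < length L \<longrightarrow> (\<forall>w<n. E (L ! i) w \<longrightarrow> w \<in> set L)"
    unfolding I_def by blast
  \<comment> \<open>With fewer than \<open>q\<close> entries every position has been expanded, so
    the queue is a closed set containing \<open>v\<close>.\<close>
  have "set L = covered n E v" if "length L < q"
  proof -
    have "w \<in> set L" if u: "u \<in> set L" and w: "u < n" "w < n" "E u w" for u w
    proof -
      obtain i where "i < length L" "L ! i = u" using u by (auto simp: in_set_conv_nth)
      moreover from this have "i < q" using \<open>length L < q\<close> by simp
      ultimately show ?thesis using closed w by blast
    qed
    then have "reached n E v \<subseteq> set L" by (rule reached_least[OF L(3)])
    then show ?thesis using L(2,4) unfolding covered_def by blast
  qed
  then show ?thesis using L(1,4) unfolding seen_def by blast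
qed

section \<open>Rounds\<close>

lemma frame_simps_rounds [simp]:
  "scalars one_round = {xprod, xz, xacc, xrest, xsign, xpow, xi, 0, xhalf, xS, xd, xmask, xj, xy,
     xrow, xhit, xbase, xf, xm, xe, xc, xlen, xx, xt, xu, xw, xbig, xv, xnext, xcur}"
  "arrays one_round = {aOut, aVec, aRow, aSeen, aQueue}"
  "scalars rounds = {xprod, xz, xacc, xrest, xsign, xpow, xi, 0, xhalf, xS, xd, xmask, xj, xy,
     xrow, xhit, xbase, xf, xm, xe, xc, xlen, xx, xt, xu, xw, xbig, xv, xnext, xcur, xr}"
  "arrays rounds = {aOut, aVec, aRow, aSeen, aQueue}"
  unfolding one_round_def rounds_def by auto

text \<open>The list is existentially quantified: searches in different rounds are compared only
  through the set \<open>U v\<close>.\<close>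

definition products_spanned :: "nat \<Rightarrow> nat \<Rightarrow> (nat \<Rightarrow> nat set) \<Rightarrow> nat \<Rightarrow> basis \<Rightarrow> basis \<Rightarrow> bool" where
  "products_spanned p k U v B B' \<longleftrightarrow> (\<exists>L. distinct L \<and> length L \<le> p \<and> set L = U v \<and>
     (\<forall>m<2 ^ p. \<forall>e<k. \<forall>c<2 ^ p. wedges p (sel m L) (B e c) \<in> lspan (2 ^ p) B' (k - e) e))"

lemma products_spanned_mono: "products_spanned p k U v B B' \<Longrightarrow> extends B' B'' \<Longrightarrow> products_spanned p k U v B B''"
  unfolding products_spanned_def using lspan_mono by blast

text \<open>The contents of the registers and tables that the rounds only read.\<close>

definition setting :: "nat \<Rightarrow> (nat \<Rightarrow> nat \<Rightarrow> bool) \<Rightarrow> nat \<Rightarrow> nat \<Rightarrow> nat \<Rightarrow> state \<Rightarrow> bool" where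
  "setting n E p k T s \<longleftrightarrow> cell s 0 xN = int (2 ^ p) \<and> cell s 0 xk = int k \<and> cell s 0 xq = int p \<and>
     cell s 0 xn = int n \<and> multiples (2 ^ p) T s \<and> line_table n s \<and>
     (\<forall>x<n. cell s aAlive x = (if x \<in> one_core n E then 1 else 0))"

lemma setting_cong:
  assumes "\<And>y. y \<in> {xN, xk, xq, xn} \<Longrightarrow> cell t 0 y = cell s 0 y"
    "\<And>a. a \<in> {aMul, aLine, aAlive} \<Longrightarrow> cell t a = cell s a"
  shows "setting n E p k T t \<longleftrightarrow> setting n E p k T s"
  using assms by (simp add: setting_def multiples_def line_table_def)

definition big_flag :: "nat \<Rightarrow> nat \<Rightarrow> (nat \<Rightarrow> nat set) \<Rightarrow> state \<Rightarrow> bool" where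
  "big_flag p n U s \<longleftrightarrow> cell s 0 xbig = 0 \<or> cell s 0 xbig = 1 \<and> (\<exists>v<n. p \<le> card (U v))"

lemma one_round:
  assumes enc: "encodes xs n E b pp" and set: "setting n E p k T s"
    and q: "cell s 0 xcur = int q" "(q + k + k) * 2 ^ p \<le> T"
    and good: "good p k (covered n E) n i (basis_at (2 ^ p) k s q)"
    and fresh: "\<forall>j\<ge>(q + k) * 2 ^ p. row (2 ^ p) s j = (\<lambda>_. 0)"
    and big: "big_flag p n (covered n E) s"
  shows "setting n E p k T (sem xs one_round s) \<and> cell (sem xs one_round s) 0 xcur = int (q + k) \<and>
    good p k (covered n E) n (Suc i) (basis_at (2 ^ p) k (sem xs one_round s) (q + k)) \<and>
    (\<forall>j\<ge>(q + k + k) * 2 ^ p. row (2 ^ p) (sem xs one_round s) j = (\<lambda>_. 0)) \<and>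
    (\<forall>j<(q + k) * 2 ^ p. row (2 ^ p) (sem xs one_round s) j = row (2 ^ p) s j) \<and>
    big_flag p n (covered n E) (sem xs one_round s) \<and>
    (cell (sem xs one_round s) 0 xbig = 0 \<longrightarrow> cell s 0 xbig = 0 \<and>
      (\<forall>v<n. products_spanned p k (covered n E) v (basis_at (2 ^ p) k s q) (basis_at (2 ^ p) k (sem xs one_round s) (q + k))))"
proof -
  let ?N = "2 ^ p :: nat" and ?U = "covered n E"
  let ?B0 = "basis_at ?N k s q"
  let ?c = "search ;; Cond (Plus (Minus (Var xlen) (Var xq)) (Num 1)) (Assign xbig (Num 1)) Skip ;; insert_products"
  define s1 where "s1 = upd s 0 xnext (int (q + k))"
  define I where "I = (\<lambda>v t. setting n E p k T t \<and> cell t 0 xcur = int q \<and> cell t 0 xnext = int (q + k) \<and>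
    good p k ?U n (Suc i) (basis_at ?N k t (q + k)) \<and>
    (\<forall>j. j < (q + k) * ?N \<or> (q + k + k) * ?N \<le> j \<longrightarrow> row ?N t j = row ?N s j) \<and>
    big_flag p n ?U t \<and>
    (cell t 0 xbig = 0 \<longrightarrow> cell s 0 xbig = 0 \<and> (\<forall>v'<v. products_spanned p k ?U v' ?B0 (basis_at ?N k t (q + k)))))"
  have row_upd: "row ?N (upd t 0 x z) = row ?N t" for t x z by (rule row_cong) simp
  have basis_upd: "basis_at ?N k (upd t 0 x z) = basis_at ?N k t" for t x z
    by (rule basis_at_cong[OF row_upd])
  have I_upd: "I v (upd t 0 x z) \<longleftrightarrow> I v t" if "x \<notin> {xN, xk, xq, xn, xcur, xnext, xbig}" for v t x z
  proof -
    have "setting n E p k T (upd t 0 x z) \<longleftrightarrow> setting n E p k T t" by (rule setting_cong) (use that in auto)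
    then show ?thesis using that by (auto simp: I_def row_upd basis_upd big_flag_def)
  qed
  define s2 where "s2 = sem xs (For xv xn ?c) s1"
  have I: "I n s2"
    unfolding s2_def
  proof (rule sem_For[where m = n and I = I])
    show "cell s1 0 xn = int n" using set by (simp add: s1_def setting_def)
    have "row ?N s ((q + k + e) * ?N + c) = (\<lambda>_. 0)" for e c
    proof -
      have "(q + k) * ?N \<le> (q + k + e) * ?N + c" by (simp add: algebra_simps)
      then show ?thesis using fresh by blast
    qed
    \<comment> \<open>The memory of the new basis is untouched, hence empty, and the empty basis is
      \<open>good\<close> for every number of sets.\<close>
    then have empty: "basis_at ?N k s (q + k) = (\<lambda>_ _ _. 0)"
      unfolding basis_at_def by (auto simp: fun_eq_iff)
    have "good p k ?U n (Suc i) (\<lambda>_ _ _. 0)"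
      unfolding good_def echelon_def saturated_def using lspan_zero generated.zero by auto
    then have "good p k ?U n (Suc i) (basis_at ?N k s1 (q + k))" unfolding s1_def basis_upd empty .
    moreover have "setting n E p k T s1" unfolding s1_def by (subst setting_cong[of _ s]) (use set in auto)
    ultimately show "I 0 s1" using q(1) big unfolding I_def by (simp add: s1_def row_upd big_flag_def)
  next
    fix v t
    assume v: "v < n" and I0: "I v t"
    let ?t = "upd t 0 xv (int v)"
    have I: "I v ?t" using I0 by (simp add: I_upd)
    define t1 where "t1 = sem xs search ?t"
    define t2 where "t2 = (if p \<le> nat (cell t1 0 xlen) then upd t1 0 xbig 1 else t1)"
    define t3 where "t3 = sem xs insert_products t2"
    have set: "setting n E p k T ?t" using I by (simp add: I_def)
    have pre: "line_table n ?t" "cell ?t 0 xn = int n" "cell ?t 0 xq = int p" "cell ?t 0 xv = int v"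
      "\<forall>x<n. cell ?t aAlive x = (if x \<in> one_core n E then 1 else 0)"
      using set by (auto simp: setting_def line_table_def)
    obtain L where L: "is_queue t1 L" "distinct L" "set L \<subseteq> ?U v" "length L < p \<longrightarrow> set L = ?U v"
      using search[OF enc pre(1-4) v pre(5)] unfolding t1_def by blast
    have len: "cell t1 0 xlen = int (length L)" using L(1) by (simp add: is_queue_def)
    have fr1: "cell t1 0 y = cell ?t 0 y" if "y \<notin> scalars search" for y
      unfolding t1_def using that by (rule sem_scalar_frame)
    have fa1: "cell t1 a = cell ?t a" if "a \<noteq> 0" "a \<notin> arrays search" for a
      unfolding t1_def using that by (rule sem_array_frame)
    have fr2: "cell t2 0 y = cell ?t 0 y" if "y \<notin> insert xbig (scalars search)" for y
      using that fr1 by (simp add: t2_def)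
    have fa2: "cell t2 a = cell t1 a" if "a \<noteq> 0" for a
      using that by (simp add: t2_def)
    have row2: "row ?N t2 = row ?N ?t" by (rule row_cong) (simp add: fa1 fa2)
    have basis2: "basis_at ?N k t2 = basis_at ?N k ?t" by (rule basis_at_cong[OF row2])
    have xq: "cell t1 0 xq = int p" using fr1[of xq] pre(3) by simp
    have c: "sem xs ?c ?t = t3"
      unfolding sem.simps(4) t1_def[symmetric] t3_def t2_def using len xq by simp
    have set2: "setting n E p k T t2"
      by (subst setting_cong[of _ ?t]) (use fr2 fa2 fa1 set in auto)
    have queue2: "is_queue t2 L" using L(1) by (simp add: t2_def is_queue_def)
    have sub: "set L \<subseteq> {..<n}" using L(3) covered_subset[OF v, of E] by (rule order_trans)
    have sub': "set (take p L) \<subseteq> ?U v" using L(3) set_take_subset[of p L] by (rule order_trans[rotated])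
    have const: "cell t2 0 xN = int ?N" "cell t2 0 xk = int k" "cell t2 0 xq = int p" "cell t2 0 xn = int n"
      "multiples ?N T t2"
      using set2 by (auto simp: setting_def)
    have cur: "cell t2 0 xcur = int q" "cell t2 0 xnext = int (q + k)"
      using fr2[of xcur] fr2[of xnext] I by (auto simp: I_def)
    have low: "row ?N ?t j = row ?N s j" if "j < (q + k) * ?N" for j using that I by (simp add: I_def)
    have B0: "basis_at ?N k t2 q = ?B0"
      unfolding basis2 using low slot_bound[of _ k _ ?N q] by (auto simp: basis_at_def fun_eq_iff)
    have goods: "good p k ?U n i (basis_at ?N k t2 q)" "good p k ?U n (Suc i) (basis_at ?N k t2 (q + k))"
      unfolding B0 unfolding basis2 using good I by (auto simp: I_def)
    note ins = insert_products[OF const(1-4) cur const(5) q(2) queue2 sub sub' v goods, of xs,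
        unfolded t3_def[symmetric] B0, unfolded basis2 row2]
    have set3: "setting n E p k T t3"
      unfolding t3_def by (subst setting_cong[of _ t2]) (use set2 in \<open>auto simp: sem_scalar_frame sem_array_frame\<close>)
    have cur3: "cell t3 0 xcur = int q" "cell t3 0 xnext = int (q + k)" "cell t3 0 xbig = cell t2 0 xbig"
      unfolding t3_def using cur by (simp_all add: sem_scalar_frame)
    have bigt: "cell t1 0 xbig = cell ?t 0 xbig" using fr1[of xbig] by simp
    have "finite (?U v)" using covered_subset[OF v, of E] finite_subset by blast
    \<comment> \<open>A long queue certifies a large set, as it is distinct and contained in it; a
      short queue is the whole set.\<close>
    then have "length L \<le> card (?U v)" using L(2,3) card_mono distinct_card by metis
    then have flag: "big_flag p n ?U t3"
      using I v cur3(3) bigt len unfolding I_def big_flag_def t2_def by auto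
    have ext: "extends (basis_at ?N k ?t (q + k)) (basis_at ?N k t3 (q + k))" using ins by blast
    have "cell s 0 xbig = 0 \<and> (\<forall>v'<Suc v. products_spanned p k ?U v' ?B0 (basis_at ?N k t3 (q + k)))"
      if z: "cell t3 0 xbig = 0"
    proof -
      have short: "length L < p" using z cur3(3) len by (auto simp: t2_def split: if_splits)
      have "cell ?t 0 xbig = 0" using z cur3(3) bigt short len by (simp add: t2_def)
      then have "cell s 0 xbig = 0" "\<forall>v'<v. products_spanned p k ?U v' ?B0 (basis_at ?N k ?t (q + k))"
        using I by (auto simp: I_def)
      moreover have "products_spanned p k ?U v ?B0 (basis_at ?N k t3 (q + k))"
        using L short ins unfolding products_spanned_def by (intro exI[of _ L]) auto
      ultimately show ?thesis using products_spanned_mono[OF _ ext] by (auto simp: less_Suc_eq)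
    qed
    then show "I (Suc v) (sem xs ?c ?t)"
      unfolding c I_def using set3 cur3(1,2) ins flag I by (auto simp: I_def)
  next
    fix t assume "I n t"
    then show "I n (upd t 0 xv (int n))" by (simp add: I_upd)
  qed
  have eq: "sem xs one_round s = upd s2 0 xcur (int (q + k))"
    using I unfolding one_round_def s2_def s1_def I_def using q(1) set
    by (simp add: setting_def del: sem.simps(6))
  have "setting n E p k T (upd s2 0 xcur z) \<longleftrightarrow> setting n E p k T s2" for z
    by (rule setting_cong) auto
  moreover have "row ?N s2 j = (\<lambda>_. 0)" if "(q + k + k) * ?N \<le> j" for j
  proof -
    have "(q + k) * ?N \<le> (q + k + k) * ?N" by (intro mult_right_mono) auto
    also note that
    finally have "row ?N s j = (\<lambda>_. 0)" using fresh by blast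
    then show ?thesis using that I by (simp add: I_def)
  qed
  ultimately show ?thesis unfolding eq using I by (simp add: I_def row_upd basis_upd big_flag_def)
qed

lemma rounds:
  assumes enc: "encodes xs n E b pp" and set: "setting n E p k T s"
    and T: "T = (p + 1) * k * 2 ^ p" and R: "cell s 0 xrounds = int R" "R \<le> p"
    and good: "good p k (covered n E) n 0 (basis_at (2 ^ p) k s 0)"
    and fresh: "\<forall>j\<ge>k * 2 ^ p. row (2 ^ p) s j = (\<lambda>_. 0)"
  shows "setting n E p k T (sem xs rounds s) \<and>
    (\<forall>i\<le>R. good p k (covered n E) n i (basis_at (2 ^ p) k (sem xs rounds s) (i * k))) \<and>
    (\<forall>j\<ge>(R * k + k) * 2 ^ p. row (2 ^ p) (sem xs rounds s) j = (\<lambda>_. 0)) \<and>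
    basis_at (2 ^ p) k (sem xs rounds s) 0 = basis_at (2 ^ p) k s 0 \<and>
    (cell (sem xs rounds s) 0 xbig = 0 \<or>
      cell (sem xs rounds s) 0 xbig = 1 \<and> 0 < R \<and> (\<exists>v<n. p \<le> card (covered n E v))) \<and>
    (cell (sem xs rounds s) 0 xbig = 0 \<longrightarrow> (\<forall>i<R. \<forall>v<n. products_spanned p k (covered n E) v
       (basis_at (2 ^ p) k (sem xs rounds s) (i * k)) (basis_at (2 ^ p) k (sem xs rounds s) (Suc i * k))))"
proof -
  let ?N = "2 ^ p :: nat" and ?U = "covered n E"
  define s1 where "s1 = upd (upd s 0 xcur 0) 0 xbig 0"
  define I where "I = (\<lambda>r t. setting n E p k T t \<and> cell t 0 xcur = int (r * k) \<and>
    (\<forall>i\<le>r. good p k ?U n i (basis_at ?N k t (i * k))) \<and>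
    (\<forall>j\<ge>(r * k + k) * ?N. row ?N t j = (\<lambda>_. 0)) \<and>
    basis_at ?N k t 0 = basis_at ?N k s 0 \<and>
    big_flag p n ?U t \<and> (cell t 0 xbig = 1 \<longrightarrow> 0 < r) \<and>
    (cell t 0 xbig = 0 \<longrightarrow> (\<forall>i<r. \<forall>v<n. products_spanned p k ?U v (basis_at ?N k t (i * k)) (basis_at ?N k t (Suc i * k)))))"
  have row_upd: "row ?N (upd t 0 x z) = row ?N t" for t x z by (rule row_cong) simp
  have basis_upd: "basis_at ?N k (upd t 0 x z) = basis_at ?N k t" for t x z
    by (rule basis_at_cong[OF row_upd])
  have I_upd: "I r (upd t 0 xr z) \<longleftrightarrow> I r t" for r t z
  proof -
    have "setting n E p k T (upd t 0 xr z) \<longleftrightarrow> setting n E p k T t" by (rule setting_cong) auto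
    then show ?thesis by (simp add: I_def row_upd basis_upd big_flag_def)
  qed
  define s2 where "s2 = sem xs (For xr xrounds one_round) s1"
  have "I R s2"
    unfolding s2_def
  proof (rule sem_For[where m = R and I = I])
    show "cell s1 0 xrounds = int R" using R by (simp add: s1_def)
    have "setting n E p k T s1" unfolding s1_def by (subst setting_cong[of _ s]) (use set in auto)
    then show "I 0 s1" using good fresh by (simp add: I_def s1_def row_upd basis_upd big_flag_def)
  next
    fix r t
    assume r: "r < R" and I0: "I r t"
    let ?t = "upd t 0 xr (int r)"
    let ?t' = "sem xs one_round ?t"
    have I: "I r ?t" using I0 by (simp add: I_upd)
    have "(r + 1 + 1) * k * ?N \<le> (p + 1) * k * ?N" using r R by (intro mult_right_mono) auto
    then have "(r * k + k + k) * ?N \<le> T" unfolding T by (simp add: algebra_simps)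
    have one: "setting n E p k T ?t' \<and> cell ?t' 0 xcur = int (r * k + k) \<and>
      good p k ?U n (Suc r) (basis_at ?N k ?t' (r * k + k)) \<and>
      (\<forall>j\<ge>(r * k + k + k) * ?N. row ?N ?t' j = (\<lambda>_. 0)) \<and>
      (\<forall>j<(r * k + k) * ?N. row ?N ?t' j = row ?N ?t j) \<and> big_flag p n ?U ?t' \<and>
      (cell ?t' 0 xbig = 0 \<longrightarrow> cell ?t 0 xbig = 0 \<and>
        (\<forall>v<n. products_spanned p k ?U v (basis_at ?N k ?t (r * k)) (basis_at ?N k ?t' (r * k + k))))"
      by (rule one_round[OF enc]) (use I \<open>(r * k + k + k) * ?N \<le> T\<close> in \<open>auto simp: I_def\<close>)
    \<comment> \<open>A round writes only above the bases constructed so far, so the statements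
      about them carry over.\<close>
    have old: "basis_at ?N k ?t' (i * k) = basis_at ?N k ?t (i * k)" if "i \<le> r" for i
    proof -
      have "(i * k + e) * ?N + c < (r * k + k) * ?N" if "e < k" "c < ?N" for e c
      proof -
        have "(i * k + e) * ?N + c < (i * k + k) * ?N" using slot_bound[OF that] by blast
        also have "\<dots> \<le> (r * k + k) * ?N" using \<open>i \<le> r\<close> by (intro mult_right_mono add_right_mono) auto
        finally show ?thesis .
      qed
      then show ?thesis using one by (auto simp: basis_at_def fun_eq_iff)
    qed
    have old0: "basis_at ?N k ?t' 0 = basis_at ?N k ?t 0" using old[of 0] by simp
    have new: "Suc r * k = r * k + k" by simp
    have "good p k ?U n i (basis_at ?N k ?t' (i * k))" if "i \<le> Suc r" for i
    proof (cases "i \<le> r")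
      case True
      then show ?thesis using old[OF True] I by (simp add: I_def)
    next
      case False
      then have "i = Suc r" using that by simp
      show ?thesis unfolding \<open>i = Suc r\<close> new using one by blast
    qed
    moreover have "products_spanned p k ?U v (basis_at ?N k ?t' (i * k)) (basis_at ?N k ?t' (Suc i * k))"
      if "i < Suc r" "v < n" "cell ?t' 0 xbig = 0" for i v
    proof (cases "i < r")
      case True
      then have "basis_at ?N k ?t' (i * k) = basis_at ?N k ?t (i * k)"
        "basis_at ?N k ?t' (Suc i * k) = basis_at ?N k ?t (Suc i * k)"
        using old[of i] old[of "Suc i"] by auto
      moreover have "cell ?t 0 xbig = 0" using one that(3) by blast
      ultimately show ?thesis using I True that(2) by (simp add: I_def)
    next
      case False
      then have i: "i = r" using that by simp
      show ?thesis unfolding i new old[OF order_refl] using one that by blast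
    qed
    ultimately show "I (Suc r) ?t'"
      using one I old0 new unfolding I_def by (simp add: add.commute)
  next
    fix t assume "I R t"
    then show "I R (upd t 0 xr (int R))" by (simp add: I_upd)
  qed
  moreover have "sem xs rounds s = s2"
    by (simp add: rounds_def s1_def s2_def del: sem.simps(6))
  ultimately show ?thesis by (auto simp: I_def big_flag_def)
qed

section \<open>The initial basis and the inspection of top pivots\<close>

lemma frame_simps_rest [simp]:
  "scalars start_basis = {xe, 0}" "arrays start_basis = {aRow}"
  "scalars find_top = {xtop, xz}" "arrays find_top = {}"
  "scalars in_degrees = {xx, 0, xu, xw}" "arrays in_degrees = {aAlive, aDeg}"
  "scalars peel_one = {xu, xx, 0, xw}" "arrays peel_one = {aAlive, aDeg}"
  "scalars peel = {xx, 0, xu, xw, xt, xcore}" "arrays peel = {aAlive, aDeg}"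
  "scalars read_input = {xn, xb, xp, xq, xrounds, xq1}" "arrays read_input = {}"
  "scalars sizes = {xN, xi, xpow, xlog, xk, xj}" "arrays sizes = {}"
  "scalars count_levels = {xlevels, xi}" "arrays count_levels = {}"
  "scalars count_slots = {xslots, xi}" "arrays count_slots = {}"
  "scalars tables = {xacc, xi, 0}" "arrays tables = {aMul, aLine}"
  unfolding prog_defs by auto

lemma find_top:
  assumes const: "cell s 0 xN = int N" "0 < N" "cell s 0 xlevels = int Z" "multiples N T s" "Z * N \<le> T"
  shows "cell (sem xs find_top s) 0 xtop =
     (if \<exists>z<Z. odd (row N s (z * N + (N - 1)) (N - 1)) then 1 else 0)"
proof -
  let ?c = "Cond (odd_expr (Arr aRow (Minus (Plus (Arr aMul (Minus (Plus (Arr aMul (Var xz)) (Var xN)) (Num 1))) (Var xN)) (Num 1))))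
          (Assign xtop (Num 1)) Skip"
  define s1 where "s1 = upd s 0 xtop 0"
  have "cell (sem xs (For xz xlevels ?c) s1) 0 xtop =
      (if \<exists>z<Z. odd (row N s (z * N + (N - 1)) (N - 1)) then 1 else 0)"
  proof (rule sem_For[where m = Z and I = "\<lambda>i t. cell t 0 xtop =
      (if \<exists>z<i. odd (row N s (z * N + (N - 1)) (N - 1)) then 1 else 0)"])
    fix z t
    assume z: "z < Z" and I: "cell t 0 xtop = (if \<exists>z'<z. odd (row N s (z' * N + (N - 1)) (N - 1)) then 1 else 0)"
      and fr: "\<forall>y. y \<notin> insert xz (scalars ?c) \<longrightarrow> cell t 0 y = cell s1 0 y"
        "\<forall>a. a \<noteq> 0 \<and> a \<notin> arrays ?c \<longrightarrow> cell t a = cell s1 a"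
    let ?t = "upd t 0 xz (int z)"
    have t: "cell ?t 0 xN = int N" "cell ?t aRow = cell s aRow" "multiples N T ?t"
      using fr const multiples_cong[of ?t s N T] by (auto simp: s1_def)
    \<comment> \<open>\<open>j\<close> is the slot of the last coordinate at level \<open>z\<close>,
      and \<open>w\<close> the cell of its diagonal entry, the only possible pivot there.\<close>
    define j where "j = z * N + (N - 1)"
    define w where "w = j * N + (N - 1)"
    have "j < Suc z * N" using const(2) by (simp add: j_def)
    also have "\<dots> \<le> Z * N" using z by (intro mult_right_mono) auto
    finally have j: "j < T" using const(5) by linarith
    have "z \<le> z * N" using const(2) by simp
    then have "z < T" using j unfolding j_def by linarith
    then have "rd ?t aMul (int z) = int (z * N)"
      using t(3) unfolding rd_int multiples_def by blast
    moreover have "rd ?t aMul (int j) = int (j * N)"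
      using t(3) j unfolding rd_int multiples_def by blast
    moreover have "int (z * N) + int N - 1 = int j" using const(2) by (simp add: j_def of_nat_diff)
    moreover have "int (j * N) + int N - 1 = int w" using const(2) by (simp add: w_def of_nat_diff)
    ultimately have "eval_expr xs (Arr aRow (Minus (Plus (Arr aMul (Minus (Plus (Arr aMul (Var xz)) (Var xN)) (Num 1))) (Var xN)) (Num 1))) ?t
        = rd ?t aRow (int w)"
      using t(1) by (simp del: rd_int of_nat_mult of_nat_add of_nat_diff)
    also have "\<dots> = row N s j (N - 1)" unfolding rd_int t(2) w_def using const(2) by (simp add: row_def)
    finally have step: "sem xs ?c ?t = (if odd (row N s j (N - 1)) then upd ?t 0 xtop 1 else ?t)"
      by (simp only: sem.simps odd_expr_pos) simp
    show "cell (sem xs ?c ?t) 0 xtop = (if \<exists>z'<Suc z. odd (row N s (z' * N + (N - 1)) (N - 1)) then 1 else 0)"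
      unfolding step using I by (auto simp: less_Suc_eq j_def)
  next
    fix t assume "cell t 0 xtop = (if \<exists>z<Z. odd (row N s (z * N + (N - 1)) (N - 1)) then 1 else 0)"
    then show "cell (upd t 0 xz (int Z)) 0 xtop = (if \<exists>z<Z. odd (row N s (z * N + (N - 1)) (N - 1)) then 1 else 0)"
      by simp
  qed (use const in \<open>auto simp: s1_def\<close>)
  then show ?thesis by (simp add: find_top_def s1_def del: sem.simps(6))
qed

lemma start_basis:
  assumes const: "cell s 0 xk = int k" "0 < N" "multiples N T s" "k * N \<le> T"
    and zero: "\<forall>z. cell s aRow z = 0"
  shows "row N (sem xs start_basis s) j =
     (\<lambda>d. if d = 0 \<and> (\<exists>e<k. j = e * N) then 1 else 0)"
proof -
  let ?c = "Put aRow (Arr aMul (Arr aMul (Var xe))) (Num 1)"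
  have "\<forall>z. cell (sem xs (For xe xk ?c) s) aRow z = (if \<exists>e<k. z = e * N * N then 1 else 0)"
  proof (rule sem_For[where m = k and I = "\<lambda>i t. \<forall>z. cell t aRow z = (if \<exists>e<i. z = e * N * N then 1 else 0)"])
    fix e t
    assume e: "e < k" and I: "\<forall>z. cell t aRow z = (if \<exists>e'<e. z = e' * N * N then 1 else 0)"
      and fr: "\<forall>a. a \<noteq> 0 \<and> a \<notin> arrays ?c \<longrightarrow> cell t a = cell s a"
    let ?t = "upd t 0 xe (int e)"
    have "e * N < k * N" "e \<le> e * N" using e const(2) by auto
    then have "e * N < T" "e < T" using const(4) by linarith+
    moreover have "multiples N T ?t" using fr const(3) multiples_cong[of ?t s N T] by simp
    ultimately have "rd ?t aMul (int e) = int (e * N)" "rd ?t aMul (int (e * N)) = int (e * N * N)"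
      unfolding rd_int multiples_def by blast+
    then have "sem xs ?c ?t = wr ?t aRow (int (e * N * N)) 1"
      by (simp del: rd_int wr_int of_nat_mult)
    then show "\<forall>z. cell (sem xs ?c ?t) aRow z = (if \<exists>e'<Suc e. z = e' * N * N then 1 else 0)"
      unfolding wr_int using I by (auto simp: less_Suc_eq)
  next
    fix t assume "\<forall>z. cell t aRow z = (if \<exists>e<k. z = e * N * N then 1 else 0)"
    then show "\<forall>z. cell (upd t 0 xe (int k)) aRow z = (if \<exists>e<k. z = e * N * N then 1 else 0)" by simp
  qed (use const zero in auto)
  moreover have "(\<exists>e<k. j * N + d = e * N * N) \<longleftrightarrow> d = 0 \<and> (\<exists>e<k. j = e * N)" if "d < N" for d
    using slot_eq_iff[OF that const(2), of j "_ * N"] by auto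
  ultimately show ?thesis using const(2) unfolding row_def start_basis_def by (auto simp: fun_eq_iff)
qed

lemma start_basis_good:
  assumes row: "\<And>j. row (2 ^ p) s j = (\<lambda>d. if d = 0 \<and> (\<exists>e<k. j = e * 2 ^ p) then 1 else 0)" and "0 < k"
  shows "good p k U n 0 (basis_at (2 ^ p) k s 0)" "unit_vec \<in> lspan (2 ^ p) (basis_at (2 ^ p) k s 0) k 0"
    "\<forall>j\<ge>k * 2 ^ p. row (2 ^ p) s j = (\<lambda>_. 0)"
proof -
  let ?N = "2 ^ p :: nat"
  let ?B = "basis_at ?N k s 0"
  have B: "?B = (\<lambda>e c. if e < k \<and> c = 0 then unit_vec else (\<lambda>_. 0))"
  proof (intro ext)
    fix e c d
    have "(\<exists>e'<k. e * ?N + c = e' * ?N) \<longleftrightarrow> e < k \<and> c = 0" if "c < ?N"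
      using slot_eq_iff[OF that, of 0 e] by (auto dest: spec[of _ e])
    then show "?B e c d = (if e < k \<and> c = 0 then unit_vec else (\<lambda>_. 0)) d"
      unfolding basis_at_def row by (auto simp: unit_vec_def)
  qed
  \<comment> \<open>Each level contains the unit vector as its own row, so level
    \<open>f + 1\<close> contains the double of the row of level \<open>f\<close>.\<close>
  have unit: "unit_vec \<in> lspan ?N ?B r e" if "e + r = k" for e r
  proof (cases r)
    case (Suc r')
    have "unit_vec d = (\<Sum>c<?N. (if c = 0 then 1 else 0) * ?B e c d) + 2 * 0" for d
    proof -
      have "(\<Sum>c<?N. (if c = 0 then 1 else 0) * ?B e c d) = (\<Sum>c<?N. if c = 0 then unit_vec d else 0)"
        by (rule sum.cong) (use Suc that in \<open>auto simp: B\<close>)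
      then show ?thesis by simp
    qed
    then show ?thesis unfolding Suc by (intro lspanI[OF lspan_zero, where a = "\<lambda>c. if c = 0 then 1 else 0"])
  qed simp
  then show "unit_vec \<in> lspan ?N ?B k 0" by simp
  have "echelon ?B" unfolding B echelon_def by (auto simp: unit_vec_def)
  moreover have "saturated ?N k ?B 0"
    unfolding saturated_def
  proof (intro allI impI)
    fix f c assume "0 \<le> f \<and> f < k \<and> c < ?N"
    then have "unit_vec \<in> lspan ?N ?B (k - Suc f) (Suc f)" by (intro unit) auto
    then show "?B f c \<in> lspan ?N ?B (k - Suc f) (Suc f)"
      using lspan_zero[of ?N ?B "k - Suc f" "Suc f"] by (cases "c = 0") (auto simp: B)
  qed
  moreover have "generated p U n 0 unit_vec" using generated.gen[of "[]" 0 n "[]" U p] by simp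
  then have "generated p U n 0 (\<lambda>d. 2 ^ f * ?B f c d)" for f c
    using generated_scale generated.zero by (auto simp: B)
  moreover have "\<forall>f c. \<forall>d\<ge>?N. ?B f c d = 0"
    by (auto simp: B unit_vec_def)
  ultimately show "good p k U n 0 ?B" by (simp add: good_def)
  show "\<forall>j\<ge>k * 2 ^ p. row (2 ^ p) s j = (\<lambda>_. 0)"
  proof (intro allI impI)
    fix j assume "k * 2 ^ p \<le> j"
    then have "\<not> (\<exists>e<k. j = e * 2 ^ p)" by auto
    then show "row (2 ^ p) s j = (\<lambda>_. 0)" unfolding row by (auto simp: fun_eq_iff)
  qed
qed

section \<open>Peeling\<close>

definition degrees_in :: "nat \<Rightarrow> (nat \<Rightarrow> nat \<Rightarrow> bool) \<Rightarrow> nat set \<Rightarrow> state \<Rightarrow> bool" where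
  "degrees_in n E C s \<longleftrightarrow> C \<subseteq> {..<n} \<and> (\<forall>x<n. cell s aAlive x = (if x \<in> C then 1 else 0)) \<and>
     (\<forall>w<n. cell s aDeg w = int (card {u\<in>C. E u w}))"

lemma card_insert_pred:
  "u \<notin> C \<Longrightarrow> finite C \<Longrightarrow> int (card {x\<in>insert u C. E x w}) = int (card {x\<in>C. E x w}) + (if E u w then 1 else 0)"
proof -
  assume "u \<notin> C" "finite C"
  moreover have "{x\<in>insert u C. E x w} = (if E u w then insert u {x\<in>C. E x w} else {x\<in>C. E x w})" by auto
  ultimately show ?thesis by simp
qed

lemma in_degrees:
  assumes enc: "encodes xs n E b p" "line_table n s" "cell s 0 xn = int n"
  shows "degrees_in n E {..<n} (sem xs in_degrees s)"
proof -
  let ?c1 = "Put aAlive (Var xx) (Num 1) ;; Put aDeg (Var xx) (Num 0)"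
  let ?c2 = "Put aDeg (Var xw) (Plus (Arr aDeg (Var xw)) arc_expr)"
  define s1 where "s1 = sem xs (For xx xn ?c1) s"
  have s1: "(\<forall>x<n. cell s1 aAlive x = 1) \<and> (\<forall>x<n. cell s1 aDeg x = 0)"
    unfolding s1_def
  proof (rule sem_For[where m = n and I = "\<lambda>i t. (\<forall>x<i. cell t aAlive x = 1) \<and> (\<forall>x<i. cell t aDeg x = 0)"])
    fix i t assume "(\<forall>x<i. cell t aAlive x = 1) \<and> (\<forall>x<i. cell t aDeg x = 0)"
    then show "(\<forall>x<Suc i. cell (sem xs ?c1 (upd t 0 xx (int i))) aAlive x = 1) \<and>
      (\<forall>x<Suc i. cell (sem xs ?c1 (upd t 0 xx (int i))) aDeg x = 0)"
      by (simp add: less_Suc_eq)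
  qed (use enc in auto)
  have fr: "cell s1 0 xn = int n" "line_table n s1"
    unfolding s1_def using enc
    by (auto simp: sem_scalar_frame sem_array_frame line_table_def simp del: sem.simps(6))
  have "degrees_in n E {..<n} (sem xs (For xu xn (For xw xn ?c2)) s1)"
  proof (rule sem_For[where m = n and I = "\<lambda>i t. (\<forall>x<n. cell t aAlive x = 1) \<and>
      (\<forall>w<n. cell t aDeg w = int (card {u\<in>{..<i}. E u w}))"])
    fix u t
    assume u: "u < n" and I: "(\<forall>x<n. cell t aAlive x = 1) \<and> (\<forall>w<n. cell t aDeg w = int (card {u'\<in>{..<u}. E u' w}))"
      and fr1: "\<forall>y. y \<notin> insert xu (scalars (For xw xn ?c2)) \<longrightarrow> cell t 0 y = cell s1 0 y"
        "\<forall>a. a \<noteq> 0 \<and> a \<notin> arrays (For xw xn ?c2) \<longrightarrow> cell t a = cell s1 a"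
    let ?t = "upd t 0 xu (int u)"
    have "\<forall>w<n. cell (sem xs (For xw xn ?c2) ?t) aDeg w = cell t aDeg w + (if E u w then 1 else 0)"
    proof (rule sem_For[where m = n and I = "\<lambda>i t'. \<forall>w<n. cell t' aDeg w = cell t aDeg w + (if w < i \<and> E u w then 1 else 0)"])
      fix w t'
      assume w: "w < n" and I': "\<forall>w'<n. cell t' aDeg w' = cell t aDeg w' + (if w' < w \<and> E u w' then 1 else 0)"
        and fr2: "\<forall>y. y \<notin> insert xw (scalars ?c2) \<longrightarrow> cell t' 0 y = cell ?t 0 y"
          "\<forall>a. a \<noteq> 0 \<and> a \<notin> arrays ?c2 \<longrightarrow> cell t' a = cell ?t a"
      let ?t' = "upd t' 0 xw (int w)"
      have "eval_expr xs arc_expr ?t' = (if E u w then 1 else 0)"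
        by (rule arc_expr[OF enc(1)]) (use fr fr1 fr2 u w in \<open>auto simp: line_table_def\<close>)
      then show "\<forall>w'<n. cell (sem xs ?c2 ?t') aDeg w' = cell t aDeg w' + (if w' < Suc w \<and> E u w' then 1 else 0)"
        using I' by (auto simp: less_Suc_eq)
    next
      fix t' assume "\<forall>w<n. cell t' aDeg w = cell t aDeg w + (if w < n \<and> E u w then 1 else 0)"
      then show "\<forall>w<n. cell (upd t' 0 xw (int n)) aDeg w = cell t aDeg w + (if E u w then 1 else 0)" by simp
    qed (use fr fr1 in auto)
    moreover have "int (card {x\<in>{..<Suc u}. E x w}) = int (card {x\<in>{..<u}. E x w}) + (if E u w then 1 else 0)" for w
      using card_insert_pred[of u "{..<u}" E w] by (simp add: lessThan_Suc)
    moreover have "cell (sem xs (For xw xn ?c2) ?t) aAlive = cell t aAlive"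
      by (simp add: sem_array_frame del: sem.simps)
    ultimately show "(\<forall>x<n. cell (sem xs (For xw xn ?c2) ?t) aAlive x = 1) \<and>
        (\<forall>w<n. cell (sem xs (For xw xn ?c2) ?t) aDeg w = int (card {x\<in>{..<Suc u}. E x w}))"
      using I by simp
  qed (use s1 fr in \<open>auto simp: degrees_in_def\<close>)
  then show ?thesis by (simp add: in_degrees_def s1_def del: sem.simps(6))
qed

lemma peel_one:
  assumes enc: "encodes xs n E b p" "line_table n s" "cell s 0 xn = int n"
    and C: "degrees_in n E C s"
  shows "degrees_in n E C (sem xs peel_one s) \<and> (\<forall>w\<in>C. {u\<in>C. E u w} \<noteq> {}) \<or>
    (\<exists>u\<in>C. {x\<in>C. E x u} = {} \<and> degrees_in n E (C - {u}) (sem xs peel_one s))"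
proof -
  let ?c1 = "Cond (Arr aAlive (Var xx)) (Cond (Minus (Num 1) (Arr aDeg (Var xx))) (Assign xu (Var xx)) Skip) Skip"
  let ?c2 = "Put aDeg (Var xw) (Minus (Arr aDeg (Var xw)) arc_expr)"
  have fin: "finite C" using C finite_subset[of C "{..<n}"] by (auto simp: degrees_in_def)
  define s0 where "s0 = upd s 0 xu (-1)"
  define s1 where "s1 = sem xs (For xx xn ?c1) s0"
  have deg: "cell s aDeg w = int (card {u\<in>C. E u w})" if "w < n" for w using C that by (simp add: degrees_in_def)
  have alive: "cell s aAlive w = (if w \<in> C then 1 else 0)" if "w < n" for w using C that by (simp add: degrees_in_def)
  have s1: "(cell s1 0 xu = -1 \<and> (\<forall>w<n. w \<in> C \<longrightarrow> {u\<in>C. E u w} \<noteq> {})) \<or>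
      (\<exists>u<n. cell s1 0 xu = int u \<and> u \<in> C \<and> {x\<in>C. E x u} = {})"
    unfolding s1_def
  proof (rule sem_For[where m = n and I = "\<lambda>i t. (cell t 0 xu = -1 \<and> (\<forall>w<i. w \<in> C \<longrightarrow> {u\<in>C. E u w} \<noteq> {})) \<or>
      (\<exists>u<n. cell t 0 xu = int u \<and> u \<in> C \<and> {x\<in>C. E x u} = {})"])
    fix i t
    assume i: "i < n" and I: "(cell t 0 xu = -1 \<and> (\<forall>w<i. w \<in> C \<longrightarrow> {u\<in>C. E u w} \<noteq> {})) \<or>
        (\<exists>u<n. cell t 0 xu = int u \<and> u \<in> C \<and> {x\<in>C. E x u} = {})"
      and fr: "\<forall>a. a \<noteq> 0 \<and> a \<notin> arrays ?c1 \<longrightarrow> cell t a = cell s0 a"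
    let ?t = "upd t 0 xx (int i)"
    have "cell t aAlive i = (if i \<in> C then 1 else 0)" "cell t aDeg i = int (card {u\<in>C. E u i})"
      using fr alive[OF i] deg[OF i] by (auto simp: s0_def)
    moreover have "card {u\<in>C. E u i} = 0 \<longleftrightarrow> {u\<in>C. E u i} = {}" using fin by simp
    ultimately have "sem xs ?c1 ?t = (if i \<in> C \<and> {u\<in>C. E u i} = {} then upd ?t 0 xu (int i) else ?t)"
      by (cases "card {u\<in>C. E u i} = 0") (simp_all, auto)
    then show "(cell (sem xs ?c1 ?t) 0 xu = -1 \<and> (\<forall>w<Suc i. w \<in> C \<longrightarrow> {u\<in>C. E u w} \<noteq> {})) \<or>
        (\<exists>u<n. cell (sem xs ?c1 ?t) 0 xu = int u \<and> u \<in> C \<and> {x\<in>C. E x u} = {})"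
      using I i by (cases "i \<in> C \<and> {u\<in>C. E u i} = {}") (simp_all only: if_True if_False, auto simp: less_Suc_eq)
  next
    fix t assume "(cell t 0 xu = -1 \<and> (\<forall>w<n. w \<in> C \<longrightarrow> {u\<in>C. E u w} \<noteq> {})) \<or>
        (\<exists>u<n. cell t 0 xu = int u \<and> u \<in> C \<and> {x\<in>C. E x u} = {})"
    then show "(cell (upd t 0 xx (int n)) 0 xu = -1 \<and> (\<forall>w<n. w \<in> C \<longrightarrow> {u\<in>C. E u w} \<noteq> {})) \<or>
        (\<exists>u<n. cell (upd t 0 xx (int n)) 0 xu = int u \<and> u \<in> C \<and> {x\<in>C. E x u} = {})" by simp
  qed (use enc in \<open>auto simp: s0_def\<close>)
  have fr: "cell s1 0 xn = int n" "line_table n s1" "cell s1 aAlive = cell s aAlive" "cell s1 aDeg = cell s aDeg"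
    unfolding s1_def s0_def using enc
    by (auto simp: sem_scalar_frame sem_array_frame line_table_def simp del: sem.simps(6))
  have prog: "sem xs peel_one s = (if 0 < cell s1 0 xu + 1
      then sem xs (For xw xn ?c2) (sem xs (Put aAlive (Var xu) (Num 0)) s1) else s1)"
    unfolding peel_one_def s1_def s0_def by (simp del: sem.simps(6))
  from s1 show ?thesis
  proof (elim disjE exE conjE)
    assume none: "cell s1 0 xu = -1" "\<forall>w<n. w \<in> C \<longrightarrow> {u\<in>C. E u w} \<noteq> {}"
    then have "sem xs peel_one s = s1" unfolding prog by simp
    moreover have "degrees_in n E C s1" using C fr(3,4) by (simp add: degrees_in_def)
    moreover have "\<forall>w\<in>C. {u\<in>C. E u w} \<noteq> {}" using none(2) C unfolding degrees_in_def by blast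
    ultimately show ?thesis by simp
  next
    fix u assume u: "u < n" "cell s1 0 xu = int u" "u \<in> C" "{x\<in>C. E x u} = {}"
    define s2 where "s2 = upd s1 aAlive u 0"
    have p: "sem xs peel_one s = sem xs (For xw xn ?c2) s2"
      unfolding prog using u(2) by (simp add: s2_def)
    have "\<forall>w<n. cell (sem xs (For xw xn ?c2) s2) aDeg w = cell s aDeg w - (if E u w then 1 else 0)"
    proof (rule sem_For[where m = n and I = "\<lambda>i t'. \<forall>w<n. cell t' aDeg w = cell s aDeg w - (if w < i \<and> E u w then 1 else 0)"])
      fix w t'
      assume w: "w < n" and I': "\<forall>w'<n. cell t' aDeg w' = cell s aDeg w' - (if w' < w \<and> E u w' then 1 else 0)"
        and fr2: "\<forall>y. y \<notin> insert xw (scalars ?c2) \<longrightarrow> cell t' 0 y = cell s2 0 y"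
          "\<forall>a. a \<noteq> 0 \<and> a \<notin> arrays ?c2 \<longrightarrow> cell t' a = cell s2 a"
      let ?t' = "upd t' 0 xw (int w)"
      have "eval_expr xs arc_expr ?t' = (if E u w then 1 else 0)"
        by (rule arc_expr[OF enc(1)]) (use fr fr2 u w in \<open>auto simp: line_table_def s2_def\<close>)
      then show "\<forall>w'<n. cell (sem xs ?c2 ?t') aDeg w' = cell s aDeg w' - (if w' < Suc w \<and> E u w' then 1 else 0)"
        using I' by (auto simp: less_Suc_eq)
    next
      fix t' assume "\<forall>w<n. cell t' aDeg w = cell s aDeg w - (if w < n \<and> E u w then 1 else 0)"
      then show "\<forall>w<n. cell (upd t' 0 xw (int n)) aDeg w = cell s aDeg w - (if E u w then 1 else 0)" by simp
    qed (use fr in \<open>auto simp: s2_def\<close>)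
    moreover have "int (card {x\<in>C. E x w}) = int (card {x\<in>C - {u}. E x w}) + (if E u w then 1 else 0)" for w
      using card_insert_pred[of u "C - {u}" E w] fin u(3) by (simp add: insert_absorb)
    moreover have "cell (sem xs (For xw xn ?c2) s2) aAlive = cell s2 aAlive"
      by (simp add: sem_array_frame del: sem.simps)
    ultimately have "degrees_in n E (C - {u}) (sem xs peel_one s)"
      using C deg alive fr(3) unfolding degrees_in_def p by (auto simp: s2_def)
    then show ?thesis using u by blast
  qed
qed

lemma peel:
  assumes enc: "encodes xs n E b p" "line_table n s" "cell s 0 xn = int n"
  shows "(\<forall>x<n. cell (sem xs peel s) aAlive x = (if x \<in> one_core n E then 1 else 0)) \<and>
    cell (sem xs peel s) 0 xcore = int (card (one_core n E))"
proof -
  define s1 where "s1 = sem xs in_degrees s"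
  have s1: "degrees_in n E {..<n} s1" unfolding s1_def by (rule in_degrees[OF enc])
  have fr: "cell s1 0 xn = int n" "line_table n s1"
    unfolding s1_def using enc by (auto simp: sem_scalar_frame sem_array_frame line_table_def)
  \<comment> \<open>Each pass deletes a vertex unless the set is already stable. After
    \<open>n\<close> passes it is therefore empty or stable, and supported in either case.\<close>
  define J where "J = (\<lambda>i t. \<exists>C. degrees_in n E C t \<and> one_core n E \<subseteq> C \<and>
     (card C + i \<le> n \<or> (\<forall>w\<in>C. {u\<in>C. E u w} \<noteq> {})))"
  define s2 where "s2 = sem xs (For xt xn peel_one) s1"
  have "J n s2"
    unfolding s2_def
  proof (rule sem_For[where m = n and I = J])
    show "J 0 s1" using s1 one_core_subset[of n E] unfolding J_def by (intro exI[of _ "{..<n}"]) auto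
  next
    fix i t
    assume i: "i < n" and "J i t"
      and fr1: "\<forall>y. y \<notin> insert xt (scalars peel_one) \<longrightarrow> cell t 0 y = cell s1 0 y"
        "\<forall>a. a \<noteq> 0 \<and> a \<notin> arrays peel_one \<longrightarrow> cell t a = cell s1 a"
    then obtain C where C: "degrees_in n E C t" "one_core n E \<subseteq> C" "card C + i \<le> n \<or> (\<forall>w\<in>C. {u\<in>C. E u w} \<noteq> {})"
      unfolding J_def by blast
    let ?t = "upd t 0 xt (int i)"
    have pre: "line_table n ?t" "cell ?t 0 xn = int n" "degrees_in n E C ?t"
      using fr fr1 C(1) by (auto simp: line_table_def degrees_in_def)
    from peel_one[OF enc(1) pre] show "J (Suc i) (sem xs peel_one ?t)"
    proof (elim disjE bexE conjE)
      assume "degrees_in n E C (sem xs peel_one ?t)" "\<forall>w\<in>C. {u\<in>C. E u w} \<noteq> {}"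
      then show ?thesis using C(2) unfolding J_def by blast
    next
      fix u assume u: "u \<in> C" "{x\<in>C. E x u} = {}" "degrees_in n E (C - {u}) (sem xs peel_one ?t)"
      \<comment> \<open>A core vertex has an in-neighbour in the core and hence in
        \<open>C\<close>.\<close>
      have "u \<notin> one_core n E"
        using supported_one_core[of n E] u(2) C(2) unfolding supported_def by blast
      then have "one_core n E \<subseteq> C - {u}" using C(2) by blast
      moreover have "finite C" using C(1) finite_subset[of C "{..<n}"] by (auto simp: degrees_in_def)
      then have "card (C - {u}) + Suc i \<le> n"
        using C(3) u(1,2) card_Suc_Diff1[of C u] by auto
      ultimately show ?thesis using u(3) unfolding J_def by blast
    qed
  next
    fix t assume "J n t"
    then show "J n (upd t 0 xt (int n))" by (simp add: J_def degrees_in_def)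
  qed (use fr in auto)
  then obtain C where C: "degrees_in n E C s2" "one_core n E \<subseteq> C" "card C + n \<le> n \<or> (\<forall>w\<in>C. {u\<in>C. E u w} \<noteq> {})"
    unfolding J_def by blast
  have finC: "finite C" using C(1) finite_subset[of C "{..<n}"] by (auto simp: degrees_in_def)
  then have "\<forall>w\<in>C. {u\<in>C. E u w} \<noteq> {}" using C(3) by auto
  then have "supported n E C" using C(1) by (auto simp: supported_def degrees_in_def)
  then have "C \<subseteq> one_core n E" by (rule one_core_greatest)
  with C(2) have core: "C = one_core n E" by (rule equalityI[rotated])
  have alive: "\<forall>x<n. cell s2 aAlive x = (if x \<in> one_core n E then 1 else 0)"
    using C(1) by (simp add: core degrees_in_def)
  have xn: "cell s2 0 xn = int n"
    unfolding s2_def using fr by (simp add: sem_scalar_frame del: sem.simps(6))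
  let ?c = "Assign xcore (Plus (Var xcore) (Arr aAlive (Var xx)))"
  define s3 where "s3 = upd s2 0 xcore 0"
  have "(\<forall>x<n. cell (sem xs (For xx xn ?c) s3) aAlive x = (if x \<in> one_core n E then 1 else 0)) \<and>
    cell (sem xs (For xx xn ?c) s3) 0 xcore = int (card (one_core n E))"
  proof (rule sem_For[where m = n and I = "\<lambda>i t. cell t aAlive = cell s2 aAlive \<and>
      cell t 0 xcore = int (card (one_core n E \<inter> {..<i}))"])
    fix i t
    assume i: "i < n" and I: "cell t aAlive = cell s2 aAlive \<and> cell t 0 xcore = int (card (one_core n E \<inter> {..<i}))"
    have "one_core n E \<inter> {..<Suc i} = (if i \<in> one_core n E then insert i (one_core n E \<inter> {..<i}) else one_core n E \<inter> {..<i})"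
      by (auto simp: less_Suc_eq)
    then show "cell (sem xs ?c (upd t 0 xx (int i))) aAlive = cell s2 aAlive \<and>
        cell (sem xs ?c (upd t 0 xx (int i))) 0 xcore = int (card (one_core n E \<inter> {..<Suc i}))"
      using I alive i by simp
  next
    fix t assume "cell t aAlive = cell s2 aAlive \<and> cell t 0 xcore = int (card (one_core n E \<inter> {..<n}))"
    moreover have "one_core n E \<inter> {..<n} = one_core n E" using one_core_subset[of n E] by blast
    ultimately show "(\<forall>x<n. cell (upd t 0 xx (int n)) aAlive x = (if x \<in> one_core n E then 1 else 0)) \<and>
        cell (upd t 0 xx (int n)) 0 xcore = int (card (one_core n E))"
      using alive by simp
  qed (use xn in \<open>auto simp: s3_def\<close>)
  moreover have "sem xs peel s = sem xs (For xx xn ?c) s3"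
    by (simp add: peel_def s1_def s2_def s3_def del: sem.simps(6))
  ultimately show ?thesis by simp
qed

section \<open>Correctness\<close>

lemma read_input:
  assumes "encodes xs n E b p"
  shows "cell (sem xs read_input s) 0 xn = int n" "cell (sem xs read_input s) 0 xb = b"
    "cell (sem xs read_input s) 0 xp = p" "cell (sem xs read_input s) 0 xq = int (nat p)"
    "cell (sem xs read_input s) 0 xrounds = int (nat (min b p))"
    "cell (sem xs read_input s) 0 xq1 = int (nat p + 1)"
  using assms by (auto simp: read_input_def encodes_def)

lemma sizes:
  assumes "cell s 0 xq = int q" "cell s 0 xn = int n"
  shows "\<exists>l. n \<le> 2 ^ l \<and> (l = 0 \<or> 2 ^ l < 2 * n) \<and> cell (sem xs sizes s) 0 xN = int (2 ^ q) \<and>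
    cell (sem xs sizes s) 0 xk = int (q * q * l + 1)"
proof -
  let ?c1 = "Assign xN (Plus (Var xN) (Var xN))"
  let ?c2 = "Cond (Minus (Var xn) (Var xpow))
       (Assign xpow (Plus (Var xpow) (Var xpow)) ;; Assign xlog (Plus (Var xlog) (Num 1))) Skip"
  let ?c3 = "Assign xk (Plus (Var xk) (Var xlog))"
  define s1 where "s1 = upd s 0 xN 1"
  define s2 where "s2 = sem xs (For xi xq ?c1) s1"
  define s3 where "s3 = upd (upd s2 0 xpow 1) 0 xlog 0"
  define s4 where "s4 = sem xs (For xi xn ?c2) s3"
  define s5 where "s5 = upd s4 0 xk 1"
  define s6 where "s6 = sem xs (For xi xq (For xj xq ?c3)) s5"
  have s6: "sem xs sizes s = s6"
    by (simp add: sizes_def s1_def s2_def s3_def s4_def s5_def s6_def del: sem.simps(6))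
  have fr2: "cell s2 0 y = cell s 0 y" if "y \<notin> {xN, xi}" for y
    unfolding s2_def s1_def using that by (simp add: sem_scalar_frame del: sem.simps(6))
  have N: "cell s2 0 xN = int (2 ^ q)"
    unfolding s2_def
    by (rule sem_For[where m = q and I = "\<lambda>i t. cell t 0 xN = int (2 ^ i)"]) (use assms in \<open>auto simp: s1_def\<close>)
  have fr4: "cell s4 0 y = cell s2 0 y" if "y \<notin> {xpow, xlog, xi}" for y
    unfolding s4_def s3_def using that by (simp add: sem_scalar_frame del: sem.simps(6))
  have "\<exists>l. n \<le> 2 ^ l \<and> (l = 0 \<or> 2 ^ l < 2 * n) \<and> cell s4 0 xlog = int l"
    unfolding s4_def
  \<comment> \<open>While \<open>2 ^ l\<close> is below \<open>n\<close> each pass increases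
    \<open>l\<close>, so \<open>n\<close> passes suffice because \<open>l < 2 ^ l\<close>.\<close>
  proof (rule sem_For[where m = n and I = "\<lambda>i t. \<exists>l. (i \<le> l \<or> n \<le> 2 ^ l) \<and> (l = 0 \<or> 2 ^ l < 2 * n) \<and>
      cell t 0 xlog = int l \<and> cell t 0 xpow = int (2 ^ l)"])
    show "\<exists>l. (0 \<le> l \<or> n \<le> 2 ^ l) \<and> (l = 0 \<or> 2 ^ l < 2 * n) \<and> cell s3 0 xlog = int l \<and> cell s3 0 xpow = int (2 ^ l)"
      by (intro exI[of _ 0]) (simp add: s3_def)
  next
    fix i t
    assume "\<exists>l. (i \<le> l \<or> n \<le> 2 ^ l) \<and> (l = 0 \<or> 2 ^ l < 2 * n) \<and> cell t 0 xlog = int l \<and> cell t 0 xpow = int (2 ^ l)"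
      and fr: "\<forall>y. y \<notin> insert xi (scalars ?c2) \<longrightarrow> cell t 0 y = cell s3 0 y"
    then obtain l where l: "i \<le> l \<or> n \<le> 2 ^ l" "l = 0 \<or> 2 ^ l < 2 * n" "cell t 0 xlog = int l" "cell t 0 xpow = int (2 ^ l)"
      by blast
    have xn: "cell t 0 xn = int n" using fr fr2 assms by (simp add: s3_def)
    let ?t' = "sem xs ?c2 (upd t 0 xi (int i))"
    show "\<exists>l. (Suc i \<le> l \<or> n \<le> 2 ^ l) \<and> (l = 0 \<or> 2 ^ l < 2 * n) \<and> cell ?t' 0 xlog = int l \<and> cell ?t' 0 xpow = int (2 ^ l)"
    proof (cases "2 ^ l < n")
      case True
      then have "int (2 ^ l) < int n" by (simp only: of_nat_less_iff)
      then have "cell ?t' 0 xlog = int (Suc l)" "cell ?t' 0 xpow = int (2 ^ Suc l)" using l xn by auto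
      then show ?thesis using l True by (intro exI[of _ "Suc l"]) auto
    next
      case False
      then have "int n \<le> int (2 ^ l)" by (simp only: not_less of_nat_le_iff)
      then have "?t' = upd t 0 xi (int i)" using l xn by simp
      then show ?thesis using l False by (intro exI[of _ l]) auto
    qed
  next
    fix t
    assume "\<exists>l. (n \<le> l \<or> n \<le> 2 ^ l) \<and> (l = 0 \<or> 2 ^ l < 2 * n) \<and> cell t 0 xlog = int l \<and> cell t 0 xpow = int (2 ^ l)"
    then obtain l where l: "n \<le> l \<or> n \<le> 2 ^ l" "l = 0 \<or> 2 ^ l < 2 * n" "cell t 0 xlog = int l" by blast
    have "l < 2 ^ l" by (rule less_exp)
    then have "n \<le> 2 ^ l" using l(1) by linarith
    then show "\<exists>l. n \<le> 2 ^ l \<and> (l = 0 \<or> 2 ^ l < 2 * n) \<and> cell (upd t 0 xi (int n)) 0 xlog = int l"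
      using l by auto
  qed (use fr2 assms in \<open>auto simp: s3_def\<close>)
  then obtain l where l: "n \<le> 2 ^ l" "l = 0 \<or> 2 ^ l < 2 * n" "cell s4 0 xlog = int l" by blast
  have const: "cell s5 0 xq = int q" "cell s5 0 xlog = int l" "cell s5 0 xN = int (2 ^ q)"
    using fr4[of xq] fr4[of xN] fr2[of xq] N assms l(3) by (auto simp: s5_def)
  have "cell s6 0 xk = int (q * q * l + 1)"
    unfolding s6_def
  proof (rule sem_For[where m = q and I = "\<lambda>i t. cell t 0 xk = int (i * q * l + 1)"])
    fix i t
    assume I: "cell t 0 xk = int (i * q * l + 1)"
      and fr: "\<forall>y. y \<notin> insert xi (scalars (For xj xq ?c3)) \<longrightarrow> cell t 0 y = cell s5 0 y"
    show "cell (sem xs (For xj xq ?c3) (upd t 0 xi (int i))) 0 xk = int (Suc i * q * l + 1)"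
    proof (rule sem_For[where m = q and I = "\<lambda>j t. cell t 0 xk = int (i * q * l + j * l + 1)"])
      fix j t'
      assume "cell t' 0 xk = int (i * q * l + j * l + 1)"
        and "\<forall>y. y \<notin> insert xj (scalars ?c3) \<longrightarrow> cell t' 0 y = cell (upd t 0 xi (int i)) 0 y"
      then show "cell (sem xs ?c3 (upd t' 0 xj (int j))) 0 xk = int (i * q * l + Suc j * l + 1)"
        using fr const by (simp add: algebra_simps)
    qed (use fr const I in \<open>auto simp: algebra_simps\<close>)
  qed (use const in \<open>auto simp: s5_def\<close>)
  moreover have "cell s6 0 xN = int (2 ^ q)"
    unfolding s6_def using const(3) by (simp add: sem_scalar_frame del: sem.simps(6))
  ultimately show ?thesis using l s6 by auto
qed

lemma count_levels:
  assumes "cell s 0 xq1 = int q1" "cell s 0 xk = int k"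
  shows "cell (sem xs count_levels s) 0 xlevels = int (q1 * k)"
proof -
  let ?c = "Assign xlevels (Plus (Var xlevels) (Var xk))"
  define s1 where "s1 = upd s 0 xlevels 0"
  have "cell (sem xs (For xi xq1 ?c) s1) 0 xlevels = int (q1 * k)"
  proof (rule sem_For[where m = q1 and I = "\<lambda>i t. cell t 0 xlevels = int (i * k)"])
    fix i t assume "cell t 0 xlevels = int (i * k)" "\<forall>y. y \<notin> insert xi (scalars ?c) \<longrightarrow> cell t 0 y = cell s1 0 y"
    then show "cell (sem xs ?c (upd t 0 xi (int i))) 0 xlevels = int (Suc i * k)"
      using assms by (simp add: s1_def algebra_simps)
  qed (use assms in \<open>auto simp: s1_def\<close>)
  then show ?thesis by (simp add: count_levels_def s1_def del: sem.simps(6))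
qed

lemma count_slots:
  assumes "cell s 0 xlevels = int Z" "cell s 0 xN = int N"
  shows "cell (sem xs count_slots s) 0 xslots = int (Z * N)"
proof -
  let ?c = "Assign xslots (Plus (Var xslots) (Var xN))"
  define s1 where "s1 = upd s 0 xslots 0"
  have "cell (sem xs (For xi xlevels ?c) s1) 0 xslots = int (Z * N)"
  proof (rule sem_For[where m = Z and I = "\<lambda>i t. cell t 0 xslots = int (i * N)"])
    fix i t assume "cell t 0 xslots = int (i * N)" "\<forall>y. y \<notin> insert xi (scalars ?c) \<longrightarrow> cell t 0 y = cell s1 0 y"
    then show "cell (sem xs ?c (upd t 0 xi (int i))) 0 xslots = int (Suc i * N)"
      using assms by (simp add: s1_def algebra_simps)
  qed (use assms in \<open>auto simp: s1_def\<close>)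
  then show ?thesis by (simp add: count_slots_def s1_def del: sem.simps(6))
qed

lemma tables:
  assumes "cell s 0 xslots = int T" "cell s 0 xN = int N" "cell s 0 xn = int n"
  shows "multiples N T (sem xs tables s) \<and> line_table n (sem xs tables s)"
proof -
  let ?c1 = "Put aMul (Var xi) (Var xacc) ;; Assign xacc (Plus (Var xacc) (Var xN))"
  let ?c2 = "Put aLine (Var xi) (Var xacc) ;; Assign xacc (Plus (Var xacc) (Var xn))"
  define s1 where "s1 = upd s 0 xacc 0"
  define s2 where "s2 = sem xs (For xi xslots ?c1) s1"
  define s3 where "s3 = upd s2 0 xacc 3"
  define s4 where "s4 = sem xs (For xi xn ?c2) s3"
  have "multiples N T s2"
    unfolding s2_def
  proof (rule sem_For[where m = T and I = "\<lambda>i t. cell t 0 xacc = int (i * N) \<and> multiples N i t"])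
    fix i t assume "cell t 0 xacc = int (i * N) \<and> multiples N i t"
      "\<forall>y. y \<notin> insert xi (scalars ?c1) \<longrightarrow> cell t 0 y = cell s1 0 y"
    then show "cell (sem xs ?c1 (upd t 0 xi (int i))) 0 xacc = int (Suc i * N) \<and>
        multiples N (Suc i) (sem xs ?c1 (upd t 0 xi (int i)))"
      using assms by (simp add: s1_def multiples_def less_Suc_eq algebra_simps)
  qed (use assms in \<open>auto simp: s1_def multiples_def\<close>)
  then have mult: "multiples N T s4"
    unfolding s4_def s3_def multiples_def by (simp add: sem_array_frame del: sem.simps(6))
  have xn: "cell s3 0 xn = int n"
    unfolding s3_def s2_def s1_def using assms(3) by (simp add: sem_scalar_frame del: sem.simps(6))
  have "line_table n s4"
    unfolding s4_def
  proof (rule sem_For[where m = n and I = "\<lambda>i t. cell t 0 xacc = int (i * n + 3) \<and> (\<forall>u<i. cell t aLine u = int (u * n + 3))"])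
    fix i t assume "cell t 0 xacc = int (i * n + 3) \<and> (\<forall>u<i. cell t aLine u = int (u * n + 3))"
      "\<forall>y. y \<notin> insert xi (scalars ?c2) \<longrightarrow> cell t 0 y = cell s3 0 y"
    then show "cell (sem xs ?c2 (upd t 0 xi (int i))) 0 xacc = int (Suc i * n + 3) \<and>
        (\<forall>u<Suc i. cell (sem xs ?c2 (upd t 0 xi (int i))) aLine u = int (u * n + 3))"
      using xn by (simp add: less_Suc_eq algebra_simps)
  qed (use xn in \<open>auto simp: s3_def line_table_def\<close>)
  then show ?thesis using mult by (simp add: tables_def s1_def s2_def s3_def s4_def del: sem.simps(6))
qed

lemma answer:
  assumes "cell s 0 xb = b" "cell s 0 xp = p" "cell s 0 xcore = int c" "cell s 0 xbig = (if B then 1 else 0)"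
    "cell s 0 xtop = (if T then 1 else 0)"
  shows "cell (sem xs answer s) 0 0 = (if 0 \<le> b \<and> (p \<le> 0 \<or> p \<le> int c \<or> B \<or> T) then 1 else 0)"
  using assms by (simp add: answer_def)

lemma cover_pad:
  assumes "length vs \<le> R" "vs \<noteq> []"
  shows "\<exists>ws. length ws = R \<and> set ws = set vs"
  using assms hd_in_set[OF assms(2)]
  by (intro exI[of _ "vs @ replicate (R - length vs) (hd vs)"]) auto

text \<open>An odd top entry in any of the bases is accepted: it yields a cover by
  \<open>i \<le> R\<close> sets, which can be padded to \<open>R\<close>. Conversely a cover by
  \<open>R\<close> sets shows up in the last basis.\<close>

lemma decide_cover:
  assumes "0 < p" "0 < k" "R \<le> p" "int n ^ (p * p) < 2 ^ k"
    and good: "\<forall>i\<le>R. good p k (covered n E) n i (basis_at (2 ^ p) k s (i * k))"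
    and fresh: "\<forall>j\<ge>(R * k + k) * 2 ^ p. row (2 ^ p) s j = (\<lambda>_. 0)"
    and start: "unit_vec \<in> lspan (2 ^ p) (basis_at (2 ^ p) k s 0) k 0"
    and big: "cell s 0 xbig = 0 \<or> cell s 0 xbig = 1 \<and> 0 < R \<and> (\<exists>v<n. p \<le> card (covered n E v))"
    and spanned: "cell s 0 xbig = 0 \<longrightarrow> (\<forall>i<R. \<forall>v<n. products_spanned p k (covered n E) v
       (basis_at (2 ^ p) k s (i * k)) (basis_at (2 ^ p) k s (Suc i * k)))"
  shows "cell s 0 xbig = 1 \<or> (\<exists>z<(p + 1) * k. odd (row (2 ^ p) s (z * 2 ^ p + (2 ^ p - 1)) (2 ^ p - 1))) \<longleftrightarrow>
    (\<exists>vs. length vs = R \<and> set vs \<subseteq> {..<n} \<and> p \<le> card (\<Union> (covered n E ` set vs)))"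
    (is "?big \<or> ?top \<longleftrightarrow> ?cover")
proof -
  let ?N = "2 ^ p :: nat" and ?U = "covered n E"
  have fin: "finite (?U v)" if "v < n" for v using covered_subset[OF that, of E] finite_subset by blast
  have "?cover" if is_big: "?big"
  proof -
    obtain v where "0 < R" "v < n" "p \<le> card (?U v)" using big is_big by auto
    then show ?thesis by (intro exI[of _ "replicate R v"]) auto
  qed
  moreover have "?cover" if "?top"
  proof -
    obtain z where z: "odd (row ?N s (z * ?N + (?N - 1)) (?N - 1))" using \<open>?top\<close> by blast
    \<comment> \<open>A level in the stack is split into the number \<open>i\<close> of its basis
      and the level \<open>e\<close> within it.\<close>
    define i where "i = z div k"
    define e where "e = z mod k"
    have ie: "z = i * k + e" "e < k" using \<open>0 < k\<close> by (auto simp: i_def e_def)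
    have iR: "i \<le> R"
    proof (rule ccontr)
      assume "\<not> i \<le> R"
      then have "(R + 1) * k \<le> i * k" by (intro mult_right_mono) auto
      then have "(R * k + k) * ?N \<le> z * ?N" unfolding ie by (intro mult_right_mono) auto
      then have "(R * k + k) * ?N \<le> z * ?N + (?N - 1)" by (rule trans_le_add1)
      then have "row ?N s (z * ?N + (?N - 1)) = (\<lambda>_. 0)" using fresh by blast
      then show False using z by simp
    qed
    have "basis_at ?N k s (i * k) e (?N - 1) = row ?N s (z * ?N + (?N - 1))"
      using ie by (simp add: basis_at_def)
    then have "2 ^ e * basis_at ?N k s (i * k) e (?N - 1) (?N - 1) \<noteq> 0" using z by auto
    moreover have "generated p ?U n i (\<lambda>d. 2 ^ e * basis_at ?N k s (i * k) e (?N - 1) d)"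
      using good iR by (simp add: good_def)
    ultimately obtain vs where vs: "length vs = i" "set vs \<subseteq> {..<n}" "p \<le> card (\<Union> (?U ` set vs))"
      using generated_top[of p ?U n i "\<lambda>d. 2 ^ e * basis_at ?N k s (i * k) e (?N - 1) d"] fin by blast
    have "vs \<noteq> []" using vs(3) \<open>0 < p\<close> by auto
    then obtain ws where "length ws = R" "set ws = set vs" using cover_pad[of vs R] vs(1) iR by auto
    then show ?thesis using vs by metis
  qed
  moreover have "?top" if "\<not> ?big" and "?cover"
  proof -
    obtain vs where vs: "length vs = R" "set vs \<subseteq> {..<n}" "p \<le> card (\<Union> (?U ` set vs))" using \<open>?cover\<close> by blast
    have "\<forall>i v. \<exists>L. i < R \<longrightarrow> v < n \<longrightarrow> distinct L \<and> length L \<le> p \<and> set L = ?U v \<and>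
      (\<forall>m<2 ^ p. \<forall>e<k. \<forall>c<2 ^ p. wedges p (sel m L) (basis_at ?N k s (i * k) e c)
         \<in> lspan ?N (basis_at ?N k s (Suc i * k)) (k - e) e)"
      using spanned big \<open>\<not> ?big\<close> unfolding products_spanned_def by meson
    then obtain Q where Q: "\<And>i v. i < R \<Longrightarrow> v < n \<Longrightarrow> distinct (Q i v) \<and> length (Q i v) \<le> p \<and> set (Q i v) = ?U v \<and>
      (\<forall>m<2 ^ p. \<forall>e<k. \<forall>c<2 ^ p. wedges p (sel m (Q i v)) (basis_at ?N k s (i * k) e c)
         \<in> lspan ?N (basis_at ?N k s (Suc i * k)) (k - e) e)"
      by metis
    have "\<exists>e<k. odd (basis_at ?N k s (R * k) e (?N - 1) (?N - 1))"
    proof (rule cover_found[where B = "\<lambda>i. basis_at ?N k s (i * k)" and Q = Q and U = ?U])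
      show "echelon (basis_at ?N k s (R * k))" "saturated ?N k (basis_at ?N k s (R * k)) 0"
        using good by (auto simp: good_def)
    qed (use Q start vs assms(4) covered_subset in auto)
    then obtain e where e: "e < k" "odd (basis_at ?N k s (R * k) e (?N - 1) (?N - 1))" by blast
    have "R * k + e < (R + 1) * k" using e(1) by simp
    also have "\<dots> \<le> (p + 1) * k" using assms(3) by (intro mult_right_mono) auto
    finally show ?thesis using e by (intro exI[of _ "R * k + e"]) (simp add: basis_at_def)
  qed
  ultimately show ?thesis by blast
qed


section \<open>The states between the phases of the program\<close>

abbreviation "zero_state \<equiv> State (\<lambda>_ _. 0)"

definition after_input :: "int list \<Rightarrow> state" where
  "after_input xs = sem xs read_input zero_state"

definition after_sizes :: "int list \<Rightarrow> state" where
  "after_sizes xs = sem xs sizes (after_input xs)"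

definition after_levels :: "int list \<Rightarrow> state" where
  "after_levels xs = sem xs count_levels (after_sizes xs)"

definition after_slots :: "int list \<Rightarrow> state" where
  "after_slots xs = sem xs count_slots (after_levels xs)"

definition after_tables :: "int list \<Rightarrow> state" where
  "after_tables xs = sem xs tables (after_slots xs)"

definition after_peel :: "int list \<Rightarrow> state" where
  "after_peel xs = sem xs peel (after_tables xs)"

definition after_start :: "int list \<Rightarrow> state" where
  "after_start xs = sem xs start_basis (after_peel xs)"

definition after_rounds :: "int list \<Rightarrow> state" where
  "after_rounds xs = sem xs rounds (after_start xs)"

definition after_top :: "int list \<Rightarrow> state" where
  "after_top xs = sem xs find_top (after_rounds xs)"

lemmas after_defs = after_input_def after_sizes_def after_levels_def after_slots_def after_tables_def
  after_peel_def after_start_def after_rounds_def after_top_def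

lemma sem_anchored_core: "sem xs anchored_core zero_state = sem xs answer (after_top xs)"
  unfolding after_defs anchored_core_def by simp

lemma anchored_core_phases:
  assumes enc: "encodes xs n E b p"
  obtains l where "n \<le> 2 ^ l" "l = 0 \<or> 2 ^ l < 2 * n"
    "\<And>s. s \<in> {after_sizes xs, after_levels xs, after_slots xs, after_tables xs, after_peel xs,
        after_start xs, after_rounds xs, after_top xs} \<Longrightarrow>
      cell s 0 xn = int n \<and> cell s 0 xb = b \<and> cell s 0 xp = p \<and> cell s 0 xq = int (nat p) \<and>
      cell s 0 xrounds = int (nat (min b p)) \<and> cell s 0 xq1 = int (nat p + 1) \<and>
      cell s 0 xN = int (2 ^ nat p) \<and> cell s 0 xk = int (nat p * nat p * l + 1)"
    "\<And>s. s \<in> {after_levels xs, after_slots xs, after_tables xs, after_peel xs,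
        after_start xs, after_rounds xs, after_top xs} \<Longrightarrow>
      cell s 0 xlevels = int ((nat p + 1) * (nat p * nat p * l + 1))"
    "cell (after_slots xs) 0 xslots = int ((nat p + 1) * (nat p * nat p * l + 1) * 2 ^ nat p)"
proof -
  note input = read_input[OF enc, of zero_state, folded after_input_def]
  obtain l where l: "n \<le> 2 ^ l" "l = 0 \<or> 2 ^ l < 2 * n" "cell (after_sizes xs) 0 xN = int (2 ^ nat p)"
      "cell (after_sizes xs) 0 xk = int (nat p * nat p * l + 1)"
    using sizes[OF input(4,1)] unfolding after_sizes_def by blast
  have sizes: "cell (after_sizes xs) 0 y = cell (after_input xs) 0 y" if "y \<notin> {xN, xi, xpow, xlog, xk, xj}" for y
    unfolding after_sizes_def by (rule sem_scalar_frame) (use that in simp)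
  have all: "cell s 0 y = cell (after_sizes xs) 0 y"
    if "y \<in> {xn, xb, xp, xq, xrounds, xq1, xN, xk}" and "s \<in> {after_sizes xs, after_levels xs, after_slots xs,
        after_tables xs, after_peel xs, after_start xs, after_rounds xs, after_top xs}" for y s
    using that unfolding after_top_def after_rounds_def after_start_def after_peel_def after_tables_def
      after_slots_def after_levels_def by (elim insertE emptyE) (simp_all add: sem_scalar_frame)
  have all': "cell s 0 xlevels = cell (after_levels xs) 0 xlevels"
    if "s \<in> {after_levels xs, after_slots xs,
        after_tables xs, after_peel xs, after_start xs, after_rounds xs, after_top xs}" for s
    using that unfolding after_top_def after_rounds_def after_start_def after_peel_def after_tables_def
      after_slots_def by (elim insertE emptyE) (simp_all add: sem_scalar_frame)
  have const: "cell s 0 xn = int n \<and> cell s 0 xb = b \<and> cell s 0 xp = p \<and> cell s 0 xq = int (nat p) \<and>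
      cell s 0 xrounds = int (nat (min b p)) \<and> cell s 0 xq1 = int (nat p + 1) \<and>
      cell s 0 xN = int (2 ^ nat p) \<and> cell s 0 xk = int (nat p * nat p * l + 1)"
    if "s \<in> {after_sizes xs, after_levels xs, after_slots xs, after_tables xs, after_peel xs,
        after_start xs, after_rounds xs, after_top xs}" for s
    using all[OF _ that] sizes input l(3,4) by simp
  have levels: "cell (after_levels xs) 0 xlevels = int ((nat p + 1) * (nat p * nat p * l + 1))"
    unfolding after_levels_def by (rule count_levels) (use const[of "after_sizes xs"] in auto)
  have "cell (after_slots xs) 0 xslots = int ((nat p + 1) * (nat p * nat p * l + 1) * 2 ^ nat p)"
    unfolding after_slots_def by (rule count_slots[OF levels]) (use const[of "after_levels xs"] in auto)
  then show thesis using that[OF l(1,2) const _ ] all' levels by simp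
qed

lemma anchored_core_correct:
  assumes enc: "encodes xs n E b p"
  shows "cell (sem xs anchored_core zero_state) 0 0 = (if indexed_core n E b p then 1 else 0)"
proof -
  define q where "q = nat p"
  define R where "R = nat (min b p)"
  let ?N = "2 ^ q :: nat" and ?U = "covered n E"
  obtain l where l: "n \<le> 2 ^ l"
    and const: "\<And>s. s \<in> {after_sizes xs, after_levels xs, after_slots xs, after_tables xs, after_peel xs,
        after_start xs, after_rounds xs, after_top xs} \<Longrightarrow>
      cell s 0 xn = int n \<and> cell s 0 xb = b \<and> cell s 0 xp = p \<and> cell s 0 xq = int q \<and>
      cell s 0 xrounds = int R \<and> cell s 0 xq1 = int (q + 1) \<and>
      cell s 0 xN = int ?N \<and> cell s 0 xk = int (q * q * l + 1)"
    and levels: "\<And>s. s \<in> {after_levels xs, after_slots xs, after_tables xs, after_peel xs,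
        after_start xs, after_rounds xs, after_top xs} \<Longrightarrow> cell s 0 xlevels = int ((q + 1) * (q * q * l + 1))"
    and slots: "cell (after_slots xs) 0 xslots = int ((q + 1) * (q * q * l + 1) * ?N)"
    using anchored_core_phases[OF enc] unfolding q_def R_def by metis
  define k where "k = q * q * l + 1"
  define T where "T = (q + 1) * k * ?N"
  note const = const[folded k_def] and levels = levels[folded k_def] and slots = slots[folded k_def T_def]
  have tab: "multiples ?N T (after_tables xs)" "line_table n (after_tables xs)"
    using tables[OF slots, of ?N n xs] const[of "after_slots xs"] unfolding after_tables_def by auto
  have peel: "(\<forall>x<n. cell (after_peel xs) aAlive x = (if x \<in> one_core n E then 1 else 0)) \<and>
    cell (after_peel xs) 0 xcore = int (card (one_core n E))"
    unfolding after_peel_def by (rule peel[OF enc tab(2)]) (use const in simp)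
  have zero: "cell (after_peel xs) aRow z = 0" for z
    unfolding after_peel_def after_tables_def after_slots_def after_levels_def after_sizes_def after_input_def
    by (simp add: sem_array_frame)
  have tabp: "multiples ?N T (after_peel xs)" "line_table n (after_peel xs)"
    using tab multiples_cong[of "after_peel xs" "after_tables xs"]
    unfolding after_peel_def line_table_def by (simp_all add: sem_array_frame)
  have kT: "k * ?N \<le> T" unfolding T_def by simp
  have row: "row ?N (after_start xs) j = (\<lambda>d. if d = 0 \<and> (\<exists>e<k. j = e * ?N) then 1 else 0)" for j
    unfolding after_start_def by (rule start_basis[OF _ _ tabp(1) kT]) (use const zero in auto)
  have "0 < k" by (simp add: k_def)
  note start = start_basis_good[OF row this]
  have "setting n E q k T (after_start xs)"
    using const[of "after_start xs"] tabp peel multiples_cong[of "after_start xs" "after_peel xs" ?N T]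
    unfolding setting_def line_table_def after_start_def by (simp add: sem_array_frame)
  moreover have "R \<le> q" by (auto simp: R_def q_def)
  moreover have "cell (after_start xs) 0 xrounds = int R" using const by simp
  ultimately have rounds: "setting n E q k T (after_rounds xs) \<and>
    (\<forall>i\<le>R. good q k ?U n i (basis_at ?N k (after_rounds xs) (i * k))) \<and>
    (\<forall>j\<ge>(R * k + k) * ?N. row ?N (after_rounds xs) j = (\<lambda>_. 0)) \<and>
    basis_at ?N k (after_rounds xs) 0 = basis_at ?N k (after_start xs) 0 \<and>
    (cell (after_rounds xs) 0 xbig = 0 \<or>
      cell (after_rounds xs) 0 xbig = 1 \<and> 0 < R \<and> (\<exists>v<n. q \<le> card (?U v))) \<and>
    (cell (after_rounds xs) 0 xbig = 0 \<longrightarrow> (\<forall>i<R. \<forall>v<n. products_spanned q k ?U v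
       (basis_at ?N k (after_rounds xs) (i * k)) (basis_at ?N k (after_rounds xs) (Suc i * k))))"
    unfolding after_rounds_def by (intro rounds[OF enc _ T_def]) (use start in auto)
  define top where "top \<longleftrightarrow> (\<exists>z<(q + 1) * k. odd (row ?N (after_rounds xs) (z * ?N + (?N - 1)) (?N - 1)))"
  have xtop: "cell (after_top xs) 0 xtop = (if top then 1 else 0)"
    unfolding after_top_def top_def
    by (rule find_top) (use const[of "after_rounds xs"] levels[of "after_rounds xs"] rounds in \<open>auto simp: setting_def T_def\<close>)
  define big where "big \<longleftrightarrow> cell (after_rounds xs) 0 xbig = 1"
  have xbig: "cell (after_top xs) 0 xbig = (if big then 1 else 0)"
    using rounds unfolding after_top_def big_def by (auto simp: sem_scalar_frame)
  have xcore: "cell (after_top xs) 0 xcore = int (card (one_core n E))"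
    using peel unfolding after_top_def after_rounds_def after_start_def by (simp add: sem_scalar_frame)
  \<comment> \<open>Here the choice \<open>k = q * q * l + 1\<close> pays: the summand 1 makes the
    bound on determinants strict.\<close>
  have "int n \<le> int (2 ^ l)" using l by (simp only: of_nat_le_iff)
  then have "int n ^ (q * q) \<le> (2 ^ l) ^ (q * q)" by (intro power_mono) auto
  also have "\<dots> < 2 ^ k" by (simp add: k_def mult.commute flip: power_mult)
  finally have bound: "int n ^ (q * q) < 2 ^ k" .
  have "big \<or> top \<longleftrightarrow> (\<exists>vs. length vs = R \<and> set vs \<subseteq> {..<n} \<and> q \<le> card (\<Union> (?U ` set vs)))" if "0 < p"
    unfolding big_def top_def
    by (rule decide_cover[OF _ \<open>0 < k\<close> \<open>R \<le> q\<close> bound]) (use rounds start that in \<open>auto simp: q_def\<close>)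
  then have "(0 \<le> b \<and> (p \<le> 0 \<or> p \<le> int (card (one_core n E)) \<or> big \<or> top)) = indexed_core n E b p"
    unfolding indexed_core_iff R_def q_def by (cases "0 < p") auto
  then show ?thesis
    unfolding sem_anchored_core
    using answer[OF _ _ xcore xbig xtop, of b p xs] const[of "after_top xs"] by auto
qed

section \<open>Running time\<close>

text \<open>\<open>X\<close>, \<open>n\<close> and \<open>M\<close> bound \<open>2 ^ p\<close>, the number of vertices and its logarithm, up to constants.\<close>

definition admissible :: "(nat \<Rightarrow> nat) \<Rightarrow> nat \<Rightarrow> nat \<Rightarrow> nat \<Rightarrow> bool" where
  "admissible \<rho> X n M \<longleftrightarrow> 1 \<le> X \<and> 1 \<le> M \<and> M \<le> n \<and> \<rho> xn + 1 \<le> n \<and>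
     (\<forall>l\<in>{xq, xrounds, xN, xq1}. \<rho> l + 1 \<le> X) \<and> \<rho> xk + 1 \<le> X ^ 2 * M \<and>
     \<rho> xlevels + 1 \<le> X ^ 3 * M \<and> \<rho> xslots + 1 \<le> X ^ 4 * M"

text \<open>\<open>K\<close> may depend on the statement only, not on the instance; the exponents
  belong to \<open>X\<close>, \<open>n\<close> and \<open>M\<close>.\<close>

definition bounded :: "stmt \<Rightarrow> nat \<Rightarrow> nat \<Rightarrow> nat \<Rightarrow> bool" where
  "bounded c i j m \<longleftrightarrow>
     (\<exists>K. \<forall>\<rho> X n M. admissible \<rho> X n M \<longrightarrow> time_bound \<rho> c \<le> K * (X ^ i * n ^ j * M ^ m))"

lemma admissible_ge_one: "admissible \<rho> X n M \<Longrightarrow> 1 \<le> X ^ i * n ^ j * M ^ m"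
  by (auto simp: admissible_def)

lemma time_bound_no_limits: "limits c = {} \<Longrightarrow> time_bound \<rho> c = time_bound \<rho>' c"
  by (induction c) auto

lemma bounded_no_limits:
  assumes "limits c = {}"
  shows "bounded c i j m"
  unfolding bounded_def
proof (intro exI allI impI)
  fix \<rho> X n M assume a: "admissible \<rho> X n M"
  have "time_bound \<rho> c * 1 \<le> time_bound \<rho> c * (X ^ i * n ^ j * M ^ m)"
    by (rule mult_le_mono2[OF admissible_ge_one[OF a]])
  then show "time_bound \<rho> c \<le> time_bound (\<lambda>_. 0) c * (X ^ i * n ^ j * M ^ m)"
    using time_bound_no_limits[OF assms, of \<rho> "\<lambda>_. 0"] by simp
qed

lemma bounded_Seq:
  assumes "bounded c1 i j m" "bounded c2 i j m"
  shows "bounded (c1 ;; c2) i j m"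
proof -
  obtain K1 K2 where "\<And>\<rho> X n M. admissible \<rho> X n M \<Longrightarrow> time_bound \<rho> c1 \<le> K1 * (X ^ i * n ^ j * M ^ m)"
    "\<And>\<rho> X n M. admissible \<rho> X n M \<Longrightarrow> time_bound \<rho> c2 \<le> K2 * (X ^ i * n ^ j * M ^ m)"
    using assms unfolding bounded_def by blast
  then have "time_bound \<rho> (c1 ;; c2) \<le> (K1 + K2) * (X ^ i * n ^ j * M ^ m)" if "admissible \<rho> X n M" for \<rho> X n M
    unfolding time_bound.simps add_mult_distrib using that by (intro add_mono) blast+
  then show ?thesis unfolding bounded_def by blast
qed

lemma bounded_Cond:
  assumes "bounded c1 i j m" "bounded c2 i j m"
  shows "bounded (Cond e c1 c2) i j m"
proof -
  obtain K1 K2 where K: "\<And>\<rho> X n M. admissible \<rho> X n M \<Longrightarrow> time_bound \<rho> c1 \<le> K1 * (X ^ i * n ^ j * M ^ m)"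
    "\<And>\<rho> X n M. admissible \<rho> X n M \<Longrightarrow> time_bound \<rho> c2 \<le> K2 * (X ^ i * n ^ j * M ^ m)"
    using assms unfolding bounded_def by blast
  have "time_bound \<rho> (Cond e c1 c2) \<le> (expr_cost e + 2 + K1 + K2) * (X ^ i * n ^ j * M ^ m)"
    if a: "admissible \<rho> X n M" for \<rho> X n M
  proof -
    have "(expr_cost e + 2) * 1 \<le> (expr_cost e + 2) * (X ^ i * n ^ j * M ^ m)"
      by (rule mult_le_mono2[OF admissible_ge_one[OF a]])
    then show ?thesis
      unfolding time_bound.simps add_mult_distrib[of _ K2] add_mult_distrib[of _ K1] mult_1_right
      by (intro add_mono K a)
  qed
  then show ?thesis unfolding bounded_def by blast
qed

text \<open>The limit is increased by one to absorb the overhead of a loop without iterations; the 9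
  consists of 5 per pass and 4 for the loop itself.\<close>

lemma bounded_For:
  assumes "bounded c i j m"
    and lim: "\<And>\<rho> X n M. admissible \<rho> X n M \<Longrightarrow> (\<rho> l + 1) * (X ^ i * n ^ j * M ^ m) \<le> X ^ i' * n ^ j' * M ^ m'"
  shows "bounded (For x l c) i' j' m'"
proof -
  obtain K where K: "\<And>\<rho> X n M. admissible \<rho> X n M \<Longrightarrow> time_bound \<rho> c \<le> K * (X ^ i * n ^ j * M ^ m)"
    using assms(1) unfolding bounded_def by blast
  have "time_bound \<rho> (For x l c) \<le> (K + 9) * (X ^ i' * n ^ j' * M ^ m')" if a: "admissible \<rho> X n M" for \<rho> X n M
  proof -
    let ?Y = "X ^ i * n ^ j * M ^ m"
    have Y: "1 \<le> ?Y" by (rule admissible_ge_one[OF a])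
    have "5 * 1 + time_bound \<rho> c \<le> 5 * ?Y + K * ?Y"
      by (intro add_mono mult_le_mono2 Y K a)
    also have "\<dots> \<le> (K + 9) * ?Y" by (simp add: add_mult_distrib)
    finally have "\<rho> l * (5 * 1 + time_bound \<rho> c) \<le> \<rho> l * ((K + 9) * ?Y)" by (rule mult_le_mono2)
    moreover have "4 * 1 \<le> (K + 9) * ?Y" by (intro mult_le_mono Y) simp
    ultimately have "4 * 1 + \<rho> l * (5 * 1 + time_bound \<rho> c) \<le> (K + 9) * ?Y + \<rho> l * ((K + 9) * ?Y)"
      by (intro add_mono)
    then have "time_bound \<rho> (For x l c) \<le> (\<rho> l + 1) * ((K + 9) * ?Y)"
      by (simp only: time_bound.simps add_mult_distrib mult_1 mult_1_right add.commute)
    also have "\<dots> = (K + 9) * ((\<rho> l + 1) * ?Y)" by (rule mult.left_commute)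
    also have "\<dots> \<le> (K + 9) * (X ^ i' * n ^ j' * M ^ m')" by (rule mult_le_mono2[OF lim[OF a]])
    finally show ?thesis .
  qed
  then show ?thesis unfolding bounded_def by blast
qed

lemma bounded_For_X:
  assumes "bounded c (i - 1) j m" "l \<in> {xq, xrounds, xN, xq1}" "1 \<le> i"
  shows "bounded (For x l c) i j m"
proof (rule bounded_For[OF assms(1)])
  fix \<rho> X n M assume "admissible \<rho> X n M"
  then have "\<rho> l + 1 \<le> X" using assms(2) unfolding admissible_def by blast
  then have "(\<rho> l + 1) * (X ^ (i - 1) * n ^ j * M ^ m) \<le> X * (X ^ (i - 1) * n ^ j * M ^ m)" by (rule mult_le_mono1)
  also have "\<dots> = X ^ Suc (i - 1) * n ^ j * M ^ m" by (simp only: power_Suc mult.assoc)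
  finally show "(\<rho> l + 1) * (X ^ (i - 1) * n ^ j * M ^ m) \<le> X ^ i * n ^ j * M ^ m" using assms(3) by simp
qed

lemma bounded_For_n:
  assumes "bounded c i (j - 1) m" "1 \<le> j"
  shows "bounded (For x xn c) i j m"
proof (rule bounded_For[OF assms(1)])
  fix \<rho> X n M assume "admissible \<rho> X n M"
  then have "\<rho> xn + 1 \<le> n" unfolding admissible_def by blast
  then have "(\<rho> xn + 1) * (X ^ i * n ^ (j - 1) * M ^ m) \<le> n * (X ^ i * n ^ (j - 1) * M ^ m)" by (rule mult_le_mono1)
  also have "\<dots> = X ^ i * n ^ Suc (j - 1) * M ^ m" by (simp only: power_Suc mult_ac)
  finally show "(\<rho> xn + 1) * (X ^ i * n ^ (j - 1) * M ^ m) \<le> X ^ i * n ^ j * M ^ m" using assms(2) by simp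
qed

lemma bounded_For_M:
  assumes "bounded c (i - a) j (m - 1)" "l = xk \<and> a = 2 \<or> l = xlevels \<and> a = 3 \<or> l = xslots \<and> a = 4"
    and "a \<le> i" "1 \<le> m"
  shows "bounded (For x l c) i j m"
proof (rule bounded_For[OF assms(1)])
  fix \<rho> X n M assume "admissible \<rho> X n M"
  then have "\<rho> l + 1 \<le> X ^ a * M" using assms(2) unfolding admissible_def by auto
  then have "(\<rho> l + 1) * (X ^ (i - a) * n ^ j * M ^ (m - 1)) \<le> X ^ a * M * (X ^ (i - a) * n ^ j * M ^ (m - 1))"
    by (rule mult_le_mono1)
  also have "\<dots> = X ^ (a + (i - a)) * n ^ j * M ^ Suc (m - 1)" by (simp only: power_Suc power_add mult_ac)
  finally show "(\<rho> l + 1) * (X ^ (i - a) * n ^ j * M ^ (m - 1)) \<le> X ^ i * n ^ j * M ^ m" using assms(3,4) by simp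
qed

text \<open>Since \<open>M \<le> n\<close>, a loop over the levels may be charged to
  \<open>n\<close> instead of \<open>M\<close>.\<close>

lemma bounded_For_k_n:
  assumes "bounded c (i - 2) (j - 1) m" "2 \<le> i" "1 \<le> j"
  shows "bounded (For x xk c) i j m"
proof (rule bounded_For[OF assms(1)])
  fix \<rho> X n M assume a: "admissible \<rho> X n M"
  then have "\<rho> xk + 1 \<le> X ^ 2 * M" unfolding admissible_def by blast
  also have "\<dots> \<le> X ^ 2 * n" using a unfolding admissible_def by (intro mult_le_mono2) blast
  finally have "(\<rho> xk + 1) * (X ^ (i - 2) * n ^ (j - 1) * M ^ m) \<le> X ^ 2 * n * (X ^ (i - 2) * n ^ (j - 1) * M ^ m)"
    by (rule mult_le_mono1)
  also have "\<dots> = X ^ (2 + (i - 2)) * n ^ Suc (j - 1) * M ^ m" by (simp only: power_Suc power_add mult_ac)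
  finally show "(\<rho> xk + 1) * (X ^ (i - 2) * n ^ (j - 1) * M ^ m) \<le> X ^ i * n ^ j * M ^ m"
    using assms(2,3) by (simp only: le_add_diff_inverse Suc_diff_le diff_Suc_1 Suc_eq_plus1 le_add_diff_inverse2)
qed

lemma bounded_For_q: "bounded c (i - 1) j m \<Longrightarrow> 1 \<le> i \<Longrightarrow> bounded (For x xq c) i j m"
  and bounded_For_rounds: "bounded c (i - 1) j m \<Longrightarrow> 1 \<le> i \<Longrightarrow> bounded (For x xrounds c) i j m"
  and bounded_For_N: "bounded c (i - 1) j m \<Longrightarrow> 1 \<le> i \<Longrightarrow> bounded (For x xN c) i j m"
  and bounded_For_q1: "bounded c (i - 1) j m \<Longrightarrow> 1 \<le> i \<Longrightarrow> bounded (For x xq1 c) i j m"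
  by (rule bounded_For_X; simp)+

lemma bounded_For_k: "bounded c (i - 2) j (m - 1) \<Longrightarrow> 2 \<le> i \<Longrightarrow> 1 \<le> m \<Longrightarrow> bounded (For x xk c) i j m"
  and bounded_For_levels: "bounded c (i - 3) j (m - 1) \<Longrightarrow> 3 \<le> i \<Longrightarrow> 1 \<le> m \<Longrightarrow> bounded (For x xlevels c) i j m"
  and bounded_For_slots: "bounded c (i - 4) j (m - 1) \<Longrightarrow> 4 \<le> i \<Longrightarrow> 1 \<le> m \<Longrightarrow> bounded (For x xslots c) i j m"
  by (rule bounded_For_M; simp)+

lemmas bounded_intros = bounded_Seq bounded_Cond bounded_For_q bounded_For_rounds bounded_For_N
  bounded_For_q1 bounded_For_n bounded_For_levels bounded_For_slots

text \<open>The factors \<open>X\<close> come from the selected elements, the coordinates and their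
  digits, the factor \<open>n\<close> from multiplication by repeated addition.\<close>

lemma bounded_wedge_selected: "3 \<le> i \<Longrightarrow> 1 \<le> j \<Longrightarrow> bounded wedge_selected i j m"
  unfolding wedge_selected_def wedge_vec_def wedge_coordinate_def wedge_digit_def times_y_def
  by (intro bounded_intros; (rule bounded_no_limits)?; simp)

text \<open>Inside the insertion the number of levels is charged to \<open>n\<close>: only one factor \<open>log n\<close>
  is available.\<close>

lemma bounded_sift_vec: "4 \<le> i \<Longrightarrow> 1 \<le> j \<Longrightarrow> bounded sift_vec i j m"
  unfolding sift_vec_def scan_level_def scan_step_def sub_row_def store_row_def halve_vec_def
  by (intro bounded_intros bounded_For_k_n; (rule bounded_no_limits)?; simp)

text \<open>The exponents are those of \<open>rounds\<close>. The loops over rounds, masks, levels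
  and coordinates give \<open>X ^ (1 + 1 + 2 + 1)\<close>, the insertion itself
  \<open>X ^ 4\<close>; one \<open>n\<close> comes from the vertices and one from the insertion, and
  \<open>M\<close> from the levels.\<close>

lemma bounded_phases:
  "bounded read_input 9 2 1" "bounded sizes 9 2 1" "bounded count_levels 9 2 1"
  "bounded count_slots 9 2 1" "bounded tables 9 2 1" "bounded peel 9 2 1" "bounded start_basis 9 2 1"
  "bounded rounds 9 2 1" "bounded find_top 9 2 1" "bounded answer 9 2 1"
  unfolding read_input_def sizes_def count_levels_def count_slots_def tables_def peel_def in_degrees_def
    peel_one_def start_basis_def rounds_def one_round_def search_def start_search_def visit_def
    insert_products_def insert_product_def load_row_def find_top_def answer_def
  by (intro bounded_intros bounded_For_k bounded_wedge_selected bounded_sift_vec;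
      (rule bounded_no_limits)?; simp)+

lemma limits_phases:
  "limits read_input = {}" "limits sizes = {xq, xn}" "limits count_levels = {xq1}"
  "limits count_slots = {xlevels}" "limits tables = {xslots, xn}" "limits peel = {xn}"
  "limits start_basis = {xk}" "limits rounds = {xrounds, xn, xq, xN, xk}" "limits find_top = {xlevels}"
  "limits answer = {}"
  unfolding prog_defs by auto


lemma time_phase:
  assumes "bounded c 9 2 1" "limits c \<inter> scalars c = {}"
  shows "\<exists>K. \<forall>\<rho> X n M xs s. admissible \<rho> X n M \<longrightarrow> (\<forall>l\<in>limits c. cell s 0 l \<le> int (\<rho> l)) \<longrightarrow>
    time xs c s \<le> K * (X ^ 9 * n ^ 2 * M)"
proof -
  obtain K where K: "\<And>\<rho> X n M. admissible \<rho> X n M \<Longrightarrow> time_bound \<rho> c \<le> K * (X ^ 9 * n ^ 2 * M ^ 1)"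
    using assms(1) unfolding bounded_def by blast
  have "time xs c s \<le> K * (X ^ 9 * n ^ 2 * M)"
    if "admissible \<rho> X n M" "\<forall>l\<in>limits c. cell s 0 l \<le> int (\<rho> l)" for \<rho> X n M xs s
    using order_trans[OF time_le_time_bound[OF assms(2)] K[OF that(1)]] that(2) by simp
  then show ?thesis by blast
qed

lemma time_phases: "\<exists>K. \<forall>c\<in>{read_input, sizes, count_levels, count_slots, tables, peel, start_basis,
    rounds, find_top, answer}. \<forall>\<rho> X n M xs s. admissible \<rho> X n M \<longrightarrow>
    (\<forall>l\<in>limits c. cell s 0 l \<le> int (\<rho> l)) \<longrightarrow> time xs c s \<le> K * (X ^ 9 * n ^ 2 * M)"
proof -
  let ?C = "{read_input, sizes, count_levels, count_slots, tables, peel, start_basis, rounds, find_top, answer}"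
  define P where "P = (\<lambda>c K. \<forall>\<rho> X n M xs s. admissible \<rho> X n M \<longrightarrow>
    (\<forall>l\<in>limits c. cell s 0 l \<le> int (\<rho> l)) \<longrightarrow> time xs c s \<le> K * (X ^ 9 * n ^ 2 * M))"
  have mono: "P c K'" if "P c K" "K \<le> K'" for c K K'
    using that unfolding P_def by (meson mult_le_mono1 order_trans)
  have "\<exists>K. P c K" if "c \<in> ?C" for c
    unfolding P_def using that
    by (elim insertE emptyE; simp only:; intro time_phase bounded_phases) (auto simp: limits_phases)
  then have "\<forall>c\<in>?C. \<exists>K. P c K" by blast
  then obtain K where "\<forall>c\<in>?C. P c (K c)" by (rule bchoice[THEN exE])
  moreover have "K c \<le> sum K ?C" if "c \<in> ?C" for c using that by (intro member_le_sum) auto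
  ultimately have "\<forall>c\<in>?C. P c (sum K ?C)" using mono by blast
  then show ?thesis unfolding P_def by blast
qed

lemma bit_length_le:
  fixes l n :: nat
  assumes "l = 0 \<or> 2 ^ l < 2 * n"
  shows "l \<le> n"
proof (cases "l = 0")
  case False
  then have "2 ^ l < 2 * n" using assms by blast
  also have "\<dots> < 2 ^ Suc n" using less_exp[of n] by simp
  finally have "l < Suc n" by (simp only: power_strict_increasing_iff one_less_numeral_iff semiring_norm)
  then show ?thesis by simp
qed simp

lemma time_anchored_core:
  "\<exists>K. \<forall>xs n E b p. encodes xs n E b p \<longrightarrow> (\<exists>l. (l = 0 \<or> 2 ^ l < 2 * n) \<and>
     time xs anchored_core zero_state \<le> K * ((2 ^ (nat p + 2)) ^ 9 * (n + 1) ^ 2 * (l + 1)))"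
proof -
  obtain K where K: "\<And>c \<rho> X n M xs s. c \<in> {read_input, sizes, count_levels, count_slots, tables, peel,
      start_basis, rounds, find_top, answer} \<Longrightarrow> admissible \<rho> X n M \<Longrightarrow>
      (\<forall>l\<in>limits c. cell s 0 l \<le> int (\<rho> l)) \<Longrightarrow> time xs c s \<le> K * (X ^ 9 * n ^ 2 * M)"
    using time_phases by blast
  have "\<exists>l. (l = 0 \<or> 2 ^ l < 2 * n) \<and>
     time xs anchored_core zero_state \<le> 10 * K * ((2 ^ (nat p + 2)) ^ 9 * (n + 1) ^ 2 * (l + 1))"
    if enc: "encodes xs n E b p" for xs n E b p
  proof -
    define q where "q = nat p"
    define R where "R = nat (min b p)"
    note input = read_input[OF enc, of zero_state, folded after_input_def]
    obtain l where l: "l = 0 \<or> 2 ^ l < 2 * n"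
      and const: "\<And>s. s \<in> {after_sizes xs, after_levels xs, after_slots xs, after_tables xs, after_peel xs,
          after_start xs, after_rounds xs, after_top xs} \<Longrightarrow>
        cell s 0 xn = int n \<and> cell s 0 xb = b \<and> cell s 0 xp = p \<and> cell s 0 xq = int q \<and>
        cell s 0 xrounds = int R \<and> cell s 0 xq1 = int (q + 1) \<and>
        cell s 0 xN = int (2 ^ q) \<and> cell s 0 xk = int (q * q * l + 1)"
      and levels: "\<And>s. s \<in> {after_levels xs, after_slots xs, after_tables xs, after_peel xs,
          after_start xs, after_rounds xs, after_top xs} \<Longrightarrow> cell s 0 xlevels = int ((q + 1) * (q * q * l + 1))"
      and slots: "cell (after_slots xs) 0 xslots = int ((q + 1) * (q * q * l + 1) * 2 ^ q)"
      using anchored_core_phases[OF enc] unfolding q_def R_def by metis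
    define k where "k = q * q * l + 1"
    note const = const[folded k_def] and levels = levels[folded k_def] and slots = slots[folded k_def]
    \<comment> \<open>Beyond \<open>2 ^ q\<close> there is a factor 4 that absorbs the additive
      constants in all the limits.\<close>
    define X where "X = (2::nat) ^ (q + 2)"
    define \<rho> where "\<rho> = (\<lambda>y. 0)(xn := n, xq := q, xrounds := R, xN := 2 ^ q, xq1 := q + 1, xk := k,
      xlevels := (q + 1) * k, xslots := (q + 1) * k * 2 ^ q)"
    have q: "q + 1 \<le> 2 ^ q" by (rule Suc_leI[OF less_exp, unfolded Suc_eq_plus1])
    have X: "X = 4 * 2 ^ q" by (simp add: X_def)
    have "l \<le> n" by (rule bit_length_le[OF l])
    have "q * q \<le> 2 ^ q * 2 ^ q" using q by (intro mult_le_mono) auto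
    then have "q * q * l \<le> 2 ^ q * 2 ^ q * l" by (rule mult_le_mono1)
    moreover have "(1::nat) * 1 \<le> 2 ^ q * 2 ^ q" by (intro mult_le_mono) auto
    ultimately have k2: "k + 1 \<le> 2 * (2 ^ q * 2 ^ q * (l + 1))" unfolding k_def by (simp only: add_mult_distrib2 mult_1 mult_1_right)
    then have k: "k + 1 \<le> X ^ 2 * (l + 1)" unfolding X by (simp add: power2_eq_square algebra_simps)
    have lev: "(q + 1) * k + 1 \<le> X ^ 3 * (l + 1)"
    proof -
      have "(q + 1) * k + 1 \<le> (q + 1) * (k + 1)" by simp
      also have "\<dots> \<le> X * (X ^ 2 * (l + 1))" using q by (intro mult_le_mono k) (simp add: X)
      finally show ?thesis by (simp only: power3_eq_cube power2_eq_square mult.assoc)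
    qed
    have slo: "(q + 1) * k * 2 ^ q + 1 \<le> X ^ 4 * (l + 1)"
    proof -
      have "(q + 1) * k * 2 ^ q + 1 \<le> ((q + 1) * k + 1) * 2 ^ q" by simp
      also have "\<dots> \<le> (X ^ 3 * (l + 1)) * X" by (intro mult_le_mono lev) (simp add: X)
      also have "\<dots> = X ^ 4 * (l + 1)" by (simp add: eval_nat_numeral mult_ac)
      finally show ?thesis .
    qed
    have "R \<le> q" by (auto simp: R_def q_def)
    then have adm: "admissible \<rho> X (n + 1) (l + 1)"
      using \<open>l \<le> n\<close> q k lev slo unfolding admissible_def by (auto simp: \<rho>_def X)
    let ?B = "K * (X ^ 9 * (n + 1) ^ 2 * (l + 1))"
    have "time xs read_input zero_state \<le> ?B"
      by (rule K[OF _ adm]) (simp_all add: limits_phases)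
    moreover have "time xs sizes (after_input xs) \<le> ?B"
      by (rule K[OF _ adm]) (use input in \<open>simp_all add: limits_phases \<rho>_def q_def\<close>)
    moreover have "time xs count_levels (after_sizes xs) \<le> ?B"
      by (rule K[OF _ adm]) (use const[of "after_sizes xs"] in \<open>simp_all add: limits_phases \<rho>_def\<close>)
    moreover have "time xs count_slots (after_levels xs) \<le> ?B"
      by (rule K[OF _ adm]) (use levels[of "after_levels xs"] in \<open>simp_all add: limits_phases \<rho>_def\<close>)
    moreover have "time xs tables (after_slots xs) \<le> ?B"
      by (rule K[OF _ adm]) (use const[of "after_slots xs"] slots in \<open>simp_all add: limits_phases \<rho>_def\<close>)
    moreover have "time xs peel (after_tables xs) \<le> ?B"
      by (rule K[OF _ adm]) (use const[of "after_tables xs"] in \<open>simp_all add: limits_phases \<rho>_def\<close>)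
    moreover have "time xs start_basis (after_peel xs) \<le> ?B"
      by (rule K[OF _ adm]) (use const[of "after_peel xs"] in \<open>simp_all add: limits_phases \<rho>_def\<close>)
    moreover have "time xs rounds (after_start xs) \<le> ?B"
      by (rule K[OF _ adm]) (use const[of "after_start xs"] in \<open>simp_all add: limits_phases \<rho>_def\<close>)
    moreover have "time xs find_top (after_rounds xs) \<le> ?B"
      by (rule K[OF _ adm]) (use levels[of "after_rounds xs"] in \<open>simp_all add: limits_phases \<rho>_def\<close>)
    moreover have "time xs answer (after_top xs) \<le> ?B"
      by (rule K[OF _ adm]) (simp_all add: limits_phases)
    moreover have "time xs anchored_core zero_state = time xs read_input zero_state + time xs sizes (after_input xs) +
      time xs count_levels (after_sizes xs) + time xs count_slots (after_levels xs) + time xs tables (after_slots xs) +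
      time xs peel (after_tables xs) + time xs start_basis (after_peel xs) + time xs rounds (after_start xs) +
      time xs find_top (after_rounds xs) + time xs answer (after_top xs)"
      unfolding anchored_core_def after_defs by simp
    ultimately have "time xs anchored_core zero_state \<le> 10 * ?B" by linarith
    then show ?thesis using l unfolding X_def q_def by (intro exI[of _ l]) (simp add: mult.assoc)
  qed
  then show ?thesis by blast
qed

section \<open>Computability of the parameter function and the final bounds\<close>

definition exp_prog :: "nat \<Rightarrow> stmt" where
  "exp_prog c = Assign 1 (Inp (Num 0)) ;; Assign 0 (Num (2 ^ c)) ;;
     Assign 4 (Num 9) ;;
     For 2 1 (For 3 4 (Assign 0 (Plus (Var 0) (Var 0))))"

text \<open>Nine doublings for every unit of \<open>x\<close>, starting from the constant
  \<open>2 ^ c\<close>. The 9 is the exponent of \<open>X\<close> in the time bound.\<close>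

lemma computable_exp: "computable (\<lambda>x. 2 ^ (9 * x + c))"
proof -
  let ?d = "Assign 0 (Plus (Var 0) (Var 0))"
  have "cell (sem [int x] (exp_prog c) zero_state) 0 0 = int (2 ^ (9 * x + c))" for x
  proof -
    define s where "s = upd (upd (upd zero_state 0 1 (int x)) 0 0 (2 ^ c)) 0 4 9"
    have "cell (sem [int x] (For 2 1 (For 3 4 ?d)) s) 0 0 = int (2 ^ (9 * x + c))"
    proof (rule sem_For[where m = x and I = "\<lambda>i t. cell t 0 0 = int (2 ^ (9 * i + c))"])
      fix i t
      assume I: "cell t 0 0 = int (2 ^ (9 * i + c))"
        and fr: "\<forall>y. y \<notin> insert 2 (scalars (For 3 4 ?d)) \<longrightarrow> cell t 0 y = cell s 0 y"
      show "cell (sem [int x] (For 3 4 ?d) (upd t 0 2 (int i))) 0 0 = int (2 ^ (9 * Suc i + c))"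
        by (rule sem_For[where m = 9 and I = "\<lambda>j t. cell t 0 0 = int (2 ^ (9 * i + j + c))"])
          (use I fr in \<open>auto simp: s_def algebra_simps\<close>)
    qed (auto simp: s_def)
    then show ?thesis by (simp add: exp_prog_def s_def input_at_def del: sem.simps(6))
  qed
  moreover have "wf_stmt (exp_prog c)" by (simp add: exp_prog_def)
  ultimately show ?thesis
    unfolding computable_def using comp_outputs[OF _ order_refl] by metis
qed

text \<open>The 12 is 4 times 3: \<open>(n + 1) ^ 2 \<le> 4 * n ^ 2\<close>, and
  \<open>l + 1 \<le> 3 * log 2 n\<close> once \<open>n \<ge> 2\<close>. For smaller \<open>n\<close>
  the logarithm gives nothing, and the maximum with 1 takes over.\<close>

lemma log_bound:
  assumes "l = 0 \<or> 2 ^ l < 2 * n"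
  shows "real ((n + 1) ^ 2 * (l + 1)) \<le> 12 * max 1 (real n ^ 2 * log 2 (real n))"
proof (cases "n \<le> 1")
  case True
  have "l = 0"
  proof (rule ccontr)
    assume "l \<noteq> 0"
    then have "(2::nat) ^ 1 \<le> 2 ^ l" by (intro power_increasing) auto
    then show False using assms True \<open>l \<noteq> 0\<close> by auto
  qed
  moreover have "(n + 1) ^ 2 \<le> 2 ^ 2" using True by (intro power_mono) auto
  then have "real ((n + 1) ^ 2) \<le> 4" by (simp only: of_nat_le_numeral_iff) simp
  moreover have "12 * 1 \<le> 12 * max 1 (real n ^ 2 * log 2 (real n))" by (intro mult_left_mono) auto
  ultimately show ?thesis by simp
next
  case False
  then have n: "2 \<le> real n" by simp
  have log1: "1 \<le> log 2 (real n)" using n by simp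
  have "real l \<le> 1 + log 2 (real n)"
  proof (cases "l = 0")
    case False
    then have "2 ^ l < 2 * n" using assms by simp
    then have "real (2 ^ l) \<le> real (2 * n)" by (simp only: of_nat_le_iff)
    then have "2 ^ l \<le> 2 * real n" by simp
    then have "real l \<le> log 2 (2 * real n)" by (intro le_log_of_power) auto
    also have "\<dots> = 1 + log 2 (real n)" using n by (subst log_mult) auto
    finally show ?thesis by simp
  qed (use log1 in simp)
  then have l: "real (l + 1) \<le> 3 * log 2 (real n)" using log1 by simp
  have "real (n + 1) \<le> 2 * real n" using n by simp
  then have "real (n + 1) ^ 2 \<le> (2 * real n) ^ 2" by (intro power_mono) auto
  then have "real (n + 1) ^ 2 * real (l + 1) \<le> (2 * real n) ^ 2 * (3 * log 2 (real n))"
    using l by (intro mult_mono) auto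
  also have "\<dots> = 12 * (real n ^ 2 * log 2 (real n))" by (simp add: power2_eq_square)
  also have "\<dots> \<le> 12 * max 1 (real n ^ 2 * log 2 (real n))" by simp
  finally show ?thesis by (simp only: of_nat_mult of_nat_power)
qed

lemma length_le_input_size: "length xs \<le> input_size xs"
  unfolding input_size_def by (induction xs) auto

text \<open>The time \<open>t\<close> is left open, with the factor 12 on its side, because it is
  chosen twice: against \<open>log_bound\<close>, which cancels the 12, and against the input
  size.\<close>

lemma anchored_core_solves:
  "\<exists>c. \<forall>x\<in>instances. \<exists>l. (l = 0 \<or> 2 ^ l < 2 * num_verts x) \<and>
     (\<forall>t. 2 ^ (9 * param x + c) * ((num_verts x + 1) ^ 2 * (l + 1)) \<le> 12 * t \<longrightarrow>
       outputs_within (comp anchored_core 0) (encode x) (if core_inst 1 x then 1 else 0) t)"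
proof -
  obtain K where K: "\<And>xs n E b p. encodes xs n E b p \<Longrightarrow> \<exists>l. (l = 0 \<or> 2 ^ l < 2 * n) \<and>
     time xs anchored_core zero_state \<le> K * ((2 ^ (nat p + 2)) ^ 9 * (n + 1) ^ 2 * (l + 1))"
    using time_anchored_core by blast
  have "\<exists>l. (l = 0 \<or> 2 ^ l < 2 * num_verts x) \<and>
     (\<forall>t. 2 ^ (9 * param x + (12 * K + 18)) * ((num_verts x + 1) ^ 2 * (l + 1)) \<le> 12 * t \<longrightarrow>
       outputs_within (comp anchored_core 0) (encode x) (if core_inst 1 x then 1 else 0) t)"
    if "x \<in> instances" for x
  proof -
    obtain G b p where x: "x = (G, b, p)" by (metis prod_cases3)
    then have G: "digraph G" using that by (simp add: instances_def)
    let ?n = "card (verts G)"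
    note enc = encode_encodes(1)[OF G, of b p]
    obtain l where l: "l = 0 \<or> 2 ^ l < 2 * ?n"
      "time (encode (G, b, p)) anchored_core zero_state \<le> K * ((2 ^ (nat p + 2)) ^ 9 * (?n + 1) ^ 2 * (l + 1))"
      using K[OF enc] by blast
    have "outputs_within (comp anchored_core 0) (encode x) (if core_inst 1 x then 1 else 0) t"
      if t: "2 ^ (9 * nat p + (12 * K + 18)) * ((?n + 1) ^ 2 * (l + 1)) \<le> 12 * t" for t
    proof -
      let ?D = "(?n + 1) ^ 2 * (l + 1)"
      \<comment> \<open>The multiplicative constant is moved into the exponent; the 18 there is
        \<open>2 * 9\<close>, from \<open>X = 2 ^ (p + 2)\<close>.\<close>
      have "12 * K \<le> 2 ^ (12 * K)" by (rule less_imp_le[OF less_exp])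
      then have "12 * K * (2 ^ (9 * nat p + 18) * ?D) \<le> 2 ^ (12 * K) * (2 ^ (9 * nat p + 18) * ?D)"
        by (rule mult_le_mono1)
      also have "\<dots> = 2 ^ (9 * nat p + (12 * K + 18)) * ?D" by (simp only: power_add mult_ac)
      also note t
      finally have "K * (2 ^ (9 * nat p + 18) * ?D) \<le> t" by simp
      moreover have "(2 ^ (nat p + 2)) ^ 9 = (2::nat) ^ (9 * nat p + 18)"
        by (simp only: power_mult[symmetric] add_mult_distrib mult.commute) simp
      ultimately have "time (encode (G, b, p)) anchored_core zero_state \<le> t" using l(2) by (simp only: mult.assoc)
      then show ?thesis
        using comp_outputs[OF wf_anchored_core] anchored_core_correct[OF enc] core_inst_iff[OF G, of b p] x
        by metis
    qed
    then show ?thesis using l(1) unfolding x param.simps num_verts.simps by blast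
  qed
  then show ?thesis by blast
qed

theorem theorem2:
  shows "(\<exists>(P :: program) (f :: nat \<Rightarrow> real).
            f \<in> O(\<lambda>p. real p) \<and>
            solves_in_time P instances encode (core_inst 1)
              (\<lambda>x. 2 powr f (param x) *
                   max 1 (real (num_verts x) ^ 2 * log 2 (real (num_verts x)))))
         \<and> fpt instances encode (core_inst 1) param"
proof -
  obtain c where c: "\<And>x. x \<in> instances \<Longrightarrow> \<exists>l. (l = 0 \<or> 2 ^ l < 2 * num_verts x) \<and>
     (\<forall>t. 2 ^ (9 * param x + c) * ((num_verts x + 1) ^ 2 * (l + 1)) \<le> 12 * t \<longrightarrow>
       outputs_within (comp anchored_core 0) (encode x) (if core_inst 1 x then 1 else 0) t)"
    using anchored_core_solves by blast
  \<comment> \<open>The extra 1 in the exponent pays for rounding the time up to an integer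
    below.\<close>
  define f where "f = (\<lambda>p. real (9 * p + (c + 1)))"
  have "f \<in> O(\<lambda>p. real p)"
  proof (rule bigoI)
    show "\<forall>\<^sub>F p in sequentially. norm (f p) \<le> real (c + 10) * norm (real p)"
      using eventually_ge_at_top[of 1]
    proof eventually_elim
      case (elim p)
      then have "(c + 1) * 1 \<le> (c + 1) * p" by (rule mult_le_mono2)
      then have "9 * p + (c + 1) \<le> (c + 10) * p" by (simp add: algebra_simps)
      then have "real (9 * p + (c + 1)) \<le> real ((c + 10) * p)" by (simp only: of_nat_le_iff)
      then show ?case unfolding f_def by (simp only: real_norm_def abs_of_nat of_nat_mult)
    qed
  qed
  moreover have "solves_in_time (comp anchored_core 0) instances encode (core_inst 1)
      (\<lambda>x. 2 powr f (param x) * max 1 (real (num_verts x) ^ 2 * log 2 (real (num_verts x))))"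
    unfolding solves_in_time_def
  proof
    fix x assume "x \<in> instances"
    then obtain l where l: "l = 0 \<or> 2 ^ l < 2 * num_verts x"
      and out: "\<And>t. 2 ^ (9 * param x + c) * ((num_verts x + 1) ^ 2 * (l + 1)) \<le> 12 * t \<Longrightarrow>
       outputs_within (comp anchored_core 0) (encode x) (if core_inst 1 x then 1 else 0) t"
      using c by blast
    let ?m = "max 1 (real (num_verts x) ^ 2 * log 2 (real (num_verts x)))"
    define B where "B = (2::nat) ^ (9 * param x + c) * ((num_verts x + 1) ^ 2 * (l + 1))"
    \<comment> \<open>The rounding adds at most 1, hence at most doubles the bound, which is at
      least 1.\<close>
    define t where "t = B div 12 + 1"
    have "B \<le> 12 * t" unfolding t_def by presburger
    moreover have "real t \<le> 2 powr f (param x) * ?m"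
    proof -
      have "real B = 2 ^ (9 * param x + c) * real ((num_verts x + 1) ^ 2 * (l + 1))"
        by (simp add: B_def)
      also have "\<dots> \<le> 2 ^ (9 * param x + c) * (12 * ?m)"
        by (intro mult_left_mono log_bound l) simp
      finally have "real B / 12 \<le> 2 ^ (9 * param x + c) * ?m" by simp
      moreover have "real (12 * (B div 12)) \<le> real B" by (simp only: of_nat_le_iff times_div_less_eq_dividend)
      moreover have "1 * 1 \<le> 2 ^ (9 * param x + c) * ?m" by (intro mult_mono) auto
      ultimately have "real t \<le> 2 * (2 ^ (9 * param x + c) * ?m)" unfolding t_def by simp
      also have "\<dots> = 2 powr f (param x) * ?m"
        unfolding f_def by (subst powr_realpow) (auto simp: power_add)
      finally show ?thesis .
    qed
    ultimately show "\<exists>t. real t \<le> 2 powr f (param x) * ?m \<and>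
        outputs_within (comp anchored_core 0) (encode x) (if core_inst 1 x then 1 else 0) t"
      using out unfolding B_def by blast
  qed
  moreover have "fpt instances encode (core_inst 1) param"
    unfolding fpt_def
  proof (intro exI conjI)
    show "computable (\<lambda>x. 2 ^ (9 * x + c))" by (rule computable_exp)
    show "solves_in_time (comp anchored_core 0) instances encode (core_inst 1)
        (\<lambda>x. real (2 ^ (9 * param x + c) * input_size (encode x) ^ 3))"
      unfolding solves_in_time_def
    proof
      fix x assume x: "x \<in> instances"
      then obtain l where l: "l = 0 \<or> 2 ^ l < 2 * num_verts x"
        and out: "\<And>t. 2 ^ (9 * param x + c) * ((num_verts x + 1) ^ 2 * (l + 1)) \<le> 12 * t \<Longrightarrow>
         outputs_within (comp anchored_core 0) (encode x) (if core_inst 1 x then 1 else 0) t"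
        using c by blast
      let ?n = "num_verts x" and ?I = "input_size (encode x)"
      have "l \<le> ?n" by (rule bit_length_le[OF l])
      obtain G b p where G: "x = (G, b, p)" by (metis prod_cases3)
      then have "length (encode x) = 3 + ?n * ?n"
        using x encode_encodes(2)[of G b p] by (simp add: instances_def del: encode.simps)
      moreover have "?n \<le> ?n * ?n" by (cases ?n) auto
      \<comment> \<open>The input contains the whole matrix, so its size exceeds \<open>n\<close>
        and its cube dominates \<open>(n + 1) ^ 2 * (l + 1)\<close>.\<close>
      ultimately have "?n + 1 \<le> ?I" using length_le_input_size[of "encode x"] by linarith
      then have "(?n + 1) ^ 2 * (l + 1) \<le> ?I ^ 2 * ?I"
        using \<open>l \<le> ?n\<close> by (intro mult_le_mono power_mono) auto
      also have "\<dots> = ?I ^ 3" by (simp add: power3_eq_cube power2_eq_square)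
      finally have "2 ^ (9 * param x + c) * ((?n + 1) ^ 2 * (l + 1)) \<le> 2 ^ (9 * param x + c) * ?I ^ 3"
        by (rule mult_le_mono2)
      then have "2 ^ (9 * param x + c) * ((?n + 1) ^ 2 * (l + 1)) \<le> 12 * (2 ^ (9 * param x + c) * ?I ^ 3)"
        by linarith
      from out[OF this] show "\<exists>t. real t \<le> real (2 ^ (9 * param x + c) * ?I ^ 3) \<and>
          outputs_within (comp anchored_core 0) (encode x) (if core_inst 1 x then 1 else 0) t"
        by blast
    qed
  qed
  ultimately show ?thesis by blast
qed

end
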